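(* Let $k$ be a field and let $\varphi$ be an $n\times(n-1)$ matrix whose entries are linear forms of $R=k[x,y,z]$, with $\mathrm{ht}\, I_1(\varphi)=3$, $\mathrm{ht}\, I_{n-1}(\varphi)=2$ and chaos invariant $u$. Suppose that $\varphi$ has the following shape: for $1\le i\le u$ its $(i,i)$ entry is $x+a_i$, where $a_i$ is a linear form in $y,z$ only, and every other entry of $\varphi$ is a linear form in $y,z$ only. Let $B'$ be the associated $2\times(n-1-u)$ matrix of linear forms in $k[\mathbf t]=k[t_1,\dots,t_n]$ (defined in the context). Then $k[\mathbf t]/I_2(B')$ is isomorphic to the homogeneous coordinate ring of a rational normal scroll of dimension $u+1$ in $\mathbb P^{n-1}$. In particular, it is a Cohen--Macaulay normal domain.
   Context: $I_t(\cdot)$ denotes the ideal of $t\times t$ minors of a matrix. The chaos invariant of $\varphi$ is the unique integer $1\le u\le n-2$ such that $\mathrm{ht}\, I_t(\varphi)=3$ for $1\le t\le u$ and $\mathrm{ht}\, I_t(\varphi)=2$ for $u+1\le t\le n-1$. Let $B$ be the unique $3\times(n-1)$ matrix with linear entries in $k[\mathbf t]$ such that $(t_1\ \cdots\ t_n)\cdot\varphi=(x\ y\ z)\cdot B$. For $\varphi$ of the given shape, the first row of $B$ is $(t_1,\dots,t_u,0,\dots,0)$. The matrix $B'$ is the $2\times(n-1-u)$ submatrix of $B$ consisting of rows $2,3$ and columns $u+1,\dots,n-1$. A rational normal scroll of dimension $s$ in $\mathbb P^{r+s-1}$ is a variety whose homogeneous defining ideal is, up to a linear change of coordinates, generated by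 the $2$-minors of a $2\times r$ matrix formed by juxtaposing $s$ Hankel blocks $\begin{pmatrix} x_{i,0}&x_{i,1}&\cdots&x_{i,a_i-1}\\ x_{i,1}&x_{i,2}&\cdots&x_{i,a_i}\end{pmatrix}$, $1\le i\le s$, $a_i\ge 1$, on mutually disjoint sets of variables, with $r=a_1+\cdots+a_s$.
   Formalization: In the definition of a rational normal scroll the block sizes a_i are allowed to be 0 (not all 0), so cones and linear spaces count; with all a_i ≥ 1 the claim fails, e.g. n=3, u=1, φ with rows (x,y),(y,z),(z,0). *)

theory Defs
  imports
    "HOL-Algebra.Algebra"
    "HOL-Library.Poly_Mapping"
    "HOL-Library.Extended_Nat"
    "Jordan_Normal_Form.Determinant"
    "Jordan_Normal_Form.DL_Submatrix"
begin

section \<open>Polynomial rings\<close>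

text \<open>
  All polynomials live in one type, with indeterminates x, y, z and t_1, t_2, ...; in accordance
  with the 0-based indexing of matrices, \<open>Vt i\<close> is the variable t_{i+1}. The rings k[x,y,z],
  k[t_1,...,t_n] are the subrings of polynomials involving only the indicated variables.
\<close>

datatype indet = Vx | Vy | Vz | Vt nat

type_synonym 'k mpol = "(indet \<Rightarrow>\<^sub>0 nat) \<Rightarrow>\<^sub>0 'k"

definition var_poly :: "indet \<Rightarrow> 'k::field mpol" where
  "var_poly v = Poly_Mapping.single (Poly_Mapping.single v 1) 1"

definition const_poly :: "'k::field \<Rightarrow> 'k mpol" where
  "const_poly c = Poly_Mapping.single 0 c"

definition pol_ring :: "indet set \<Rightarrow> 'k::field mpol ring" where
  "pol_ring V = \<lparr>carrier = {p. \<forall>m \<in> Poly_Mapping.keys p. Poly_Mapping.keys m \<subseteq> V},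
     monoid.mult = (*), one = 1, ring.zero = 0, ring.add = (+)\<rparr>"

definition homogeneous :: "nat \<Rightarrow> 'k::field mpol \<Rightarrow> bool" where
  "homogeneous d p \<longleftrightarrow>
     (\<forall>m \<in> Poly_Mapping.keys p. (\<Sum>v \<in> Poly_Mapping.keys m. Poly_Mapping.lookup m v) = d)"

text \<open>As usual, the zero polynomial counts as a linear form.\<close>

definition linear_form :: "indet set \<Rightarrow> 'k::field mpol \<Rightarrow> bool" where
  "linear_form V p \<longleftrightarrow> p \<in> carrier (pol_ring V) \<and> homogeneous 1 p"

abbreviation kxyz :: "'k::field mpol ring" where
  "kxyz \<equiv> pol_ring {Vx, Vy, Vz}"

abbreviation tvars :: "nat \<Rightarrow> indet set" where
  "tvars n \<equiv> Vt ` {..<n}"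

abbreviation kt :: "nat \<Rightarrow> 'k::field mpol ring" where
  "kt n \<equiv> pol_ring (tvars n)"


section \<open>Height and determinantal ideals\<close>

text \<open>Supremum of the lengths l of chains P_0 < ... < P_{l-1} < P of prime ideals.\<close>

definition prime_height :: "('a, 'b) ring_scheme \<Rightarrow> 'a set \<Rightarrow> enat" where
  "prime_height R P =
     Sup {enat (length Ps) | Ps. (\<forall>Q \<in> set Ps. primeideal Q R) \<and> sorted_wrt (\<subset>) (Ps @ [P])}"

text \<open>The unit ideal has height \<open>\<infinity>\<close>.\<close>

definition height :: "('a, 'b) ring_scheme \<Rightarrow> 'a set \<Rightarrow> enat" where
  "height R I = Inf {prime_height R P | P. primeideal P R \<and> I \<subseteq> P}"

definition minors_ideal :: "'k::field mpol ring \<Rightarrow> nat \<Rightarrow> 'k mpol mat \<Rightarrow> 'k mpol set" where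
  "minors_ideal R t A = genideal R
     {det (submatrix A I J) | I J.
        I \<subseteq> {..<dim_row A} \<and> J \<subseteq> {..<dim_col A} \<and> card I = t \<and> card J = t}"


section \<open>The chaos invariant and the matrices B, B'\<close>

definition chaos_invariant :: "'k::field mpol mat \<Rightarrow> nat \<Rightarrow> bool" where
  "chaos_invariant \<phi> u \<longleftrightarrow> 1 \<le> u \<and> u + 2 \<le> dim_row \<phi> \<and>
     (\<forall>t. 1 \<le> t \<and> t \<le> u \<longrightarrow> height kxyz (minors_ideal kxyz t \<phi>) = 3) \<and>
     (\<forall>t. u + 1 \<le> t \<and> t \<le> dim_row \<phi> - 1 \<longrightarrow> height kxyz (minors_ideal kxyz t \<phi>) = 2)"

text \<open>
  Comparing the coefficients of the monomials t_i x, t_i y, t_i z shows that for every \<open>n \<times> m\<close>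
  matrix \<open>\<phi>\<close> of linear forms in x, y, z there is exactly one such B.
\<close>

definition is_matrix_B :: "'k::field mpol mat \<Rightarrow> 'k mpol mat \<Rightarrow> bool" where
  "is_matrix_B \<phi> B \<longleftrightarrow>
     B \<in> carrier_mat 3 (dim_col \<phi>) \<and>
     (\<forall>i < 3. \<forall>j < dim_col \<phi>. linear_form (tvars (dim_row \<phi>)) (B $$ (i, j))) \<and>
     mat 1 (dim_row \<phi>) (\<lambda>(_, j). var_poly (Vt j)) * \<phi> =
       mat 1 3 (\<lambda>(_, j). var_poly ([Vx, Vy, Vz] ! j)) * B"

definition matrix_B' :: "nat \<Rightarrow> 'k::field mpol mat \<Rightarrow> 'k mpol mat" where
  "matrix_B' u B = mat 2 (dim_col B - u) (\<lambda>(i, j). B $$ (i + 1, j + u))"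


section \<open>Rational normal scrolls\<close>

text \<open>
  The coordinates \<open>x\<^sub>i\<^sub>,\<^sub>0, \<dots>, x\<^sub>i\<^sub>,\<^sub>a\<close> (a = a_i) of the successive blocks are numbered consecutively,
  starting with \<open>m\<close>; \<open>scroll_tops m as\<close> lists the numbers of the entries of the top row of the
  matrix of Hankel blocks. The entry below the coordinate number c is the coordinate number c + 1.
\<close>

fun scroll_tops :: "nat \<Rightarrow> nat list \<Rightarrow> nat list" where
  "scroll_tops m [] = []"
| "scroll_tops m (a # as) = [m ..< m + a] @ scroll_tops (m + a + 1) as"

definition hankel_blocks :: "(nat \<Rightarrow> 'k mpol) \<Rightarrow> nat list \<Rightarrow> 'k mpol mat" where
  "hankel_blocks x as = mat 2 (sum_list as) (\<lambda>(i, j). x (scroll_tops 0 as ! j + i))"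

text \<open>
  \<open>J\<close> is the homogeneous ideal in k[t_1,...,t_n] of a rational normal scroll of dimension \<open>s\<close>
  in projective (n-1)-space. The matrix \<open>g\<close> is the linear change of coordinates.

  An \<open>a\<^sub>i\<close> may be 0, in which case the block is empty but its single coordinate \<open>x\<^sub>i\<^sub>,\<^sub>0\<close> still
  belongs to the ambient space: the scroll is then a cone, or a linear space if \<open>r = 1\<close>.
  This is the usual convention for scrolls (Eisenbud and Harris, On varieties of minimal degree),
  where only the vanishing of all \<open>a\<^sub>i\<close> is excluded. For \<open>s = u + 1\<close> and \<open>r = n - 1 - u\<close>, requiring
  all \<open>a\<^sub>i \<ge> 1\<close> would force \<open>r \<ge> s\<close>, that is \<open>n \<ge> 2 (u + 1)\<close>, which fails for instance for
  \<open>n = 3\<close>, \<open>u = 1\<close>.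
\<close>

definition rational_normal_scroll_ideal :: "nat \<Rightarrow> nat \<Rightarrow> 'k::field mpol set \<Rightarrow> bool" where
  "rational_normal_scroll_ideal n s J \<longleftrightarrow>
     (\<exists>as g. length as = s \<and> 0 < sum_list as \<and> sum_list as + s = n \<and>
        g \<in> carrier_mat n n \<and> invertible_mat g \<and>
        J = minors_ideal (kt n) 2
              (hankel_blocks (\<lambda>c. \<Sum>l<n. const_poly (g $$ (c, l)) * var_poly (Vt l)) as))"

text \<open>Isomorphism of graded k-algebras between quotients of k[t_1,...,t_n].\<close>

definition graded_algebra_iso :: "nat \<Rightarrow> 'k::field mpol set \<Rightarrow> 'k mpol set \<Rightarrow> bool" where
  "graded_algebra_iso n I J \<longleftrightarrow>
     (\<exists>h \<in> ring_iso (kt n Quot I) (kt n Quot J).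
        (\<forall>c. h (I +>\<^bsub>kt n\<^esub> const_poly c) = J +>\<^bsub>kt n\<^esub> const_poly c) \<and>
        (\<forall>d. \<forall>p \<in> carrier (kt n). homogeneous d p \<longrightarrow>
           (\<exists>q \<in> carrier (kt n). homogeneous d q \<and> h (I +>\<^bsub>kt n\<^esub> p) = J +>\<^bsub>kt n\<^esub> q)))"


section \<open>Normal domains\<close>

definition frac_rel :: "('a, 'b) ring_scheme \<Rightarrow> (('a \<times> 'a) \<times> ('a \<times> 'a)) set" where
  "frac_rel R = {((a, b), (c, d)). a \<in> carrier R \<and> c \<in> carrier R \<and>
     b \<in> carrier R - {\<zero>\<^bsub>R\<^esub>} \<and> d \<in> carrier R - {\<zero>\<^bsub>R\<^esub>} \<and> a \<otimes>\<^bsub>R\<^esub> d = c \<otimes>\<^bsub>R\<^esub> b}"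

definition fraction :: "('a, 'b) ring_scheme \<Rightarrow> 'a \<Rightarrow> 'a \<Rightarrow> ('a \<times> 'a) set" where
  "fraction R a b = frac_rel R `` {(a, b)}"

definition fraction_field :: "('a, 'b) ring_scheme \<Rightarrow> ('a \<times> 'a) set ring" where
  "fraction_field R =
     \<lparr>carrier = (carrier R \<times> (carrier R - {\<zero>\<^bsub>R\<^esub>})) // frac_rel R,
      monoid.mult = (\<lambda>F G. \<Union>(a, b)\<in>F. \<Union>(c, d)\<in>G. fraction R (a \<otimes>\<^bsub>R\<^esub> c) (b \<otimes>\<^bsub>R\<^esub> d)),
      one = fraction R \<one>\<^bsub>R\<^esub> \<one>\<^bsub>R\<^esub>,
      ring.zero = fraction R \<zero>\<^bsub>R\<^esub> \<one>\<^bsub>R\<^esub>,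
      ring.add = (\<lambda>F G. \<Union>(a, b)\<in>F. \<Union>(c, d)\<in>G.
               fraction R ((a \<otimes>\<^bsub>R\<^esub> d) \<oplus>\<^bsub>R\<^esub> (c \<otimes>\<^bsub>R\<^esub> b)) (b \<otimes>\<^bsub>R\<^esub> d))\<rparr>"

text \<open>
  \<open>\<one> # cs\<close> is the coefficient list, leading coefficient first, of a monic polynomial; \<open>x\<close> is
  integral over the subset \<open>S\<close> of the ring \<open>K\<close> if it is a root of one with coefficients in \<open>S\<close>.
\<close>

definition integral_over :: "('a, 'b) ring_scheme \<Rightarrow> 'a set \<Rightarrow> 'a \<Rightarrow> bool" where
  "integral_over K S x \<longleftrightarrow>
     (\<exists>cs. set cs \<subseteq> S \<and> ring.eval K (\<one>\<^bsub>K\<^esub> # cs) x = \<zero>\<^bsub>K\<^esub>)"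

definition normal_domain :: "('a, 'b) ring_scheme \<Rightarrow> bool" where
  "normal_domain R \<longleftrightarrow> domain R \<and>
     (\<forall>x \<in> carrier (fraction_field R).
        integral_over (fraction_field R) ((\<lambda>a. fraction R a \<one>\<^bsub>R\<^esub>) ` carrier R) x \<longrightarrow>
        x \<in> (\<lambda>a. fraction R a \<one>\<^bsub>R\<^esub>) ` carrier R)"


section \<open>Cohen--Macaulay rings\<close>

definition regular_sequence :: "('a, 'b) ring_scheme \<Rightarrow> 'a list \<Rightarrow> bool" where
  "regular_sequence R xs \<longleftrightarrow> set xs \<subseteq> carrier R \<and>
     genideal R (set xs) \<noteq> carrier R \<and>
     (\<forall>i < length xs. \<forall>a \<in> carrier R.
        xs ! i \<otimes>\<^bsub>R\<^esub> a \<in> genideal R (set (take i xs)) \<longrightarrow> a \<in> genideal R (set (take i xs)))"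

definition depth :: "('a, 'b) ring_scheme \<Rightarrow> 'a set \<Rightarrow> enat" where
  "depth R I = Sup {enat (length xs) | xs. regular_sequence R xs \<and> set xs \<subseteq> I}"

text \<open>
  The definition of Eisenbud (Commutative Algebra, Section 18.2), which requires
  \<open>depth P = codim P\<close> for all maximal ideals \<open>P\<close> of a Noetherian ring; it avoids localizations.
\<close>

definition cohen_macaulay :: "('a, 'b) ring_scheme \<Rightarrow> bool" where
  "cohen_macaulay R \<longleftrightarrow> cring R \<and> noetherian_ring R \<and>
     (\<forall>P. maximalideal P R \<longrightarrow> depth R P = prime_height R P)"

end

theory Submission
  imports Defs "HOL-Algebra.Algebraic_Closure_Type"
begin

text \<open>
  The columns of \<open>B'\<close> are pairs \<open>(b\<^sub>j, c\<^sub>j)\<close> of linear forms, which one views as a partial linear map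
  \<open>T : b\<^sub>j \<mapsto> c\<^sub>j\<close> from the span \<open>U\<close> of the \<open>b\<^sub>j\<close> to the space \<open>W\<close> of all linear forms in the \<open>t\<^sub>i\<close>. If the
  \<open>b\<^sub>j\<close> were dependent, or if \<open>U\<close> had a nonzero \<open>T\<close>-invariant subspace, then an eigenvector over the
  algebraic closure would provide a point of the projective line at which the last \<open>n - 1 - u\<close>
  columns of \<open>\<phi>\<close> are dependent, and \<open>I\<^sub>n\<^sub>-\<^sub>1(\<phi>)\<close> would have height at most 1. Otherwise (Kronecker) \<open>W\<close>
  has a basis of chains \<open>w, T w, \<dots>, T\<^sup>a w\<close> whose members other than the last ones form a basis of \<open>U\<close>.
  In this basis \<open>B'\<close> consists of Hankel blocks, so \<open>I\<^sub>2(B')\<close> itself is the ideal of a scroll.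

  The scroll is parametrized by \<open>x\<^sub>i\<^sub>,\<^sub>j \<mapsto> v\<^sub>i w\<^sup>j\<close>. Let the \<open>\<theta>\<^sub>i\<close> be the first coordinate, the differences
  between the last coordinate of a block and the first one of the next block, and the last
  coordinate. For arbitrary monic polynomials \<open>f\<^sub>i\<close>, the products of powers of the \<open>\<theta>\<^sub>i\<close> and the
  \<open>f\<^sub>i(\<theta>\<^sub>i)\<close>, multiplied by 1 or by one further coordinate, span the coordinate ring, and counting
  monomials in each degree shows that they are a basis and that the parametrization is injective.
  The coordinate ring is therefore the algebra of a saturated monoid of monomials, hence normal, and
  the \<open>f\<^sub>i(\<theta>\<^sub>i)\<close> form a regular sequence. By the Nullstellensatz every maximal ideal contains such a
  sequence, whose length \<open>u + 2\<close> bounds all chains of primes, because any \<open>u + 3\<close> elements of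
  the ring are algebraically dependent.
\<close>

\<comment> \<open>Cohen-Macaulayness is tested at every maximal ideal P, not only at the irrelevant
  one, and k need not be algebraically closed. A fixed homogeneous system of parameters
  \<open>\<theta> i\<close> does not suffice for that: at P each of them is replaced by a monic
  polynomial in it that lies in P. Such elements are inhomogeneous, so the coordinate ring is
  treated as a filtered rather than a graded space. The choice of the \<open>\<theta> i\<close> is
  dictated by the relations. Modulo them the Hankel blocks fuse into a single one with entries y_0,
  ..., y_r, where y_0 = y_r = 0, and its minors force all products y_j y_k to vanish. What survives
  is 1, y_1, ..., y_(r-1), as many elements as the degree r = n - 1 - u of the scroll. One dimension
  count then yields both the basis and the kernel of the parametrization, hence primality. The
  eigenvector exists only over the algebraic closure, whereas heights concern primes of k[x,y,z].
  The primes are therefore obtained as kernels of homomorphisms from k[x,y,z] to polynomials over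
  the closure.\<close>
alias lookup = Poly_Mapping.lookup
alias keys = Poly_Mapping.keys
alias single = Poly_Mapping.single

section \<open>Multivariate polynomials\<close>

text \<open>A linear order on the indeterminates turns the monomials into a linearly ordered monoid
  (lexicographic order), which is what leading monomials require.\<close>

instantiation indet :: linorder
begin

fun indet_rank :: "indet \<Rightarrow> nat" where
  "indet_rank Vx = 0"
| "indet_rank Vy = 1"
| "indet_rank Vz = 2"
| "indet_rank (Vt i) = i + 3"

definition less_eq_indet :: "indet \<Rightarrow> indet \<Rightarrow> bool" where
  "less_eq_indet a b \<longleftrightarrow> indet_rank a \<le> indet_rank b"

definition less_indet :: "indet \<Rightarrow> indet \<Rightarrow> bool" where
  "less_indet a b \<longleftrightarrow> indet_rank a < indet_rank b"

instance
proof
  fix x y :: indet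
  assume "x \<le> y" "y \<le> x"
  then show "x = y"
    by (cases x; cases y) (auto simp: less_eq_indet_def)
qed (auto simp: less_eq_indet_def less_indet_def)

end

type_synonym ('v, 'a) mpoly = "('v \<Rightarrow>\<^sub>0 nat) \<Rightarrow>\<^sub>0 'a"

text \<open>The coefficients stay arbitrary because the Nullstellensatz below works with polynomials
  over \<open>'k poly\<close>, and the pencil argument with polynomials over the algebraic
  closure.\<close>

definition Pol :: "'v set \<Rightarrow> ('v, 'a::zero) mpoly set" where
  "Pol V = {p. \<forall>m \<in> keys p. keys m \<subseteq> V}"

lemma keys_nat_add: "keys (a + b :: 'v \<Rightarrow>\<^sub>0 nat) = keys a \<union> keys b"
  by (auto simp: in_keys_iff lookup_add)

lemma Pol_UNIV [simp]: "p \<in> Pol UNIV"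
  by (simp add: Pol_def)

lemma Pol_0 [simp]: "0 \<in> Pol V"
  by (simp add: Pol_def)

lemma Pol_single: "keys m \<subseteq> V \<Longrightarrow> single m c \<in> Pol V"
  by (simp add: Pol_def)

lemma Pol_1 [simp]: "(1 :: ('v, 'a::semiring_1) mpoly) \<in> Pol V"
  by (simp add: Pol_def)

lemma Pol_add: "p \<in> Pol V \<Longrightarrow> q \<in> Pol V \<Longrightarrow> p + q \<in> Pol V"
  unfolding Pol_def using keys_add[of p q] by blast

lemma Pol_uminus: "p \<in> Pol V \<Longrightarrow> - p \<in> Pol V" for p :: "('v, 'a::ab_group_add) mpoly"
  by (simp add: Pol_def in_keys_iff)

lemma Pol_diff: "p \<in> Pol V \<Longrightarrow> q \<in> Pol V \<Longrightarrow> p - q \<in> Pol V" for p :: "('v, 'a::ab_group_add) mpoly"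
  using Pol_add[OF _ Pol_uminus, of p V q] by simp

lemma Pol_mult: "p \<in> Pol V \<Longrightarrow> q \<in> Pol V \<Longrightarrow> p * q \<in> Pol V" for p :: "('v, 'a::semiring_0) mpoly"
  unfolding Pol_def using keys_mult[of p q] by (fastforce simp: keys_nat_add)

lemma Pol_sum: "(\<And>i. i \<in> A \<Longrightarrow> f i \<in> Pol V) \<Longrightarrow> sum f A \<in> Pol V"
  by (induction A rule: infinite_finite_induct) (auto intro: Pol_add)

lemma Pol_prod: "(\<And>i. i \<in> A \<Longrightarrow> f i \<in> Pol V) \<Longrightarrow> prod f A \<in> Pol V"
  for f :: "_ \<Rightarrow> ('v, 'a::comm_semiring_1) mpoly"
  by (induction A rule: infinite_finite_induct) (auto intro: Pol_mult)

lemma Pol_power: "p \<in> Pol V \<Longrightarrow> p ^ n \<in> Pol V" for p :: "('v, 'a::comm_semiring_1) mpoly"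
  by (induction n) (auto intro: Pol_mult)

lemmas Pol_intros = Pol_single Pol_add Pol_uminus Pol_diff Pol_mult Pol_sum Pol_prod Pol_power

lemma sum_single_lookup: "finite A \<Longrightarrow> keys p \<subseteq> A \<Longrightarrow> (\<Sum>m\<in>A. single m (lookup p m)) = p"
  by (rule poly_mapping_eqI) (auto simp: lookup_sum lookup_single when_def in_keys_iff)

lemma Pol_induct [consumes 1, case_names single add]:
  fixes p :: "('v, 'a::comm_monoid_add) mpoly"
  assumes "p \<in> Pol V"
    and "\<And>m c. keys m \<subseteq> V \<Longrightarrow> P (single m c)"
    and "\<And>p q. P p \<Longrightarrow> P q \<Longrightarrow> P (p + q)"
  shows "P p"
proof -
  have "P (\<Sum>m\<in>A. single m (lookup p m))" if "finite A" "A \<subseteq> keys p" for A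
    using that
  proof (induction A)
    case empty
    then show ?case using assms(2)[of 0 0] by simp
  next
    case (insert m A)
    then show ?case using assms by (auto simp: Pol_def)
  qed
  from this[of "keys p"] show ?thesis by (simp add: sum_single_lookup)
qed

definition mon_eval :: "('v \<Rightarrow> 'b::comm_semiring_1) \<Rightarrow> ('v \<Rightarrow>\<^sub>0 nat) \<Rightarrow> 'b" where
  "mon_eval \<sigma> m = (\<Prod>v\<in>keys m. \<sigma> v ^ lookup m v)"

definition eval_mpoly :: "('a \<Rightarrow> 'b) \<Rightarrow> ('v \<Rightarrow> 'b::comm_semiring_1) \<Rightarrow> ('v, 'a::zero) mpoly \<Rightarrow> 'b" where
  "eval_mpoly h \<sigma> p = (\<Sum>m\<in>keys p. h (lookup p m) * mon_eval \<sigma> m)"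

lemma mon_eval_superset:
  "finite A \<Longrightarrow> keys m \<subseteq> A \<Longrightarrow> mon_eval \<sigma> m = (\<Prod>v\<in>A. \<sigma> v ^ lookup m v)"
  unfolding mon_eval_def by (rule prod.mono_neutral_left) (auto simp: in_keys_iff)

lemma mon_eval_0 [simp]: "mon_eval \<sigma> 0 = 1"
  by (simp add: mon_eval_def)

lemma mon_eval_add: "mon_eval \<sigma> (a + b) = mon_eval \<sigma> a * mon_eval \<sigma> b"
proof -
  have "mon_eval \<sigma> c = (\<Prod>v\<in>keys a \<union> keys b. \<sigma> v ^ lookup c v)" if "c \<in> {a, b, a + b}" for c
    using that by (intro mon_eval_superset) (auto simp: keys_nat_add)
  then show ?thesis
    by (simp add: lookup_add power_add prod.distrib)
qed

lemma mon_eval_single [simp]: "mon_eval \<sigma> (single v n) = \<sigma> v ^ n"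
  by (simp add: mon_eval_def)

context comm_ring_hom
begin

lemma eval_mpoly_superset:
  "finite A \<Longrightarrow> keys p \<subseteq> A \<Longrightarrow> eval_mpoly hom \<sigma> p = (\<Sum>m\<in>A. hom (lookup p m) * mon_eval \<sigma> m)"
  unfolding eval_mpoly_def by (rule sum.mono_neutral_left) (auto simp: in_keys_iff)

lemma eval_mpoly_single [simp]: "eval_mpoly hom \<sigma> (single m c) = hom c * mon_eval \<sigma> m"
  by (subst eval_mpoly_superset[of "{m}"]) auto

lemma eval_mpoly_0 [simp]: "eval_mpoly hom \<sigma> 0 = 0"
  by (simp add: eval_mpoly_def)

lemma eval_mpoly_1 [simp]: "eval_mpoly hom \<sigma> 1 = 1"
  using eval_mpoly_single[of \<sigma> 0 1] by simp

lemma eval_mpoly_add: "eval_mpoly hom \<sigma> (p + q) = eval_mpoly hom \<sigma> p + eval_mpoly hom \<sigma> q"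
proof -
  have "eval_mpoly hom \<sigma> r = (\<Sum>m\<in>keys p \<union> keys q. hom (lookup r m) * mon_eval \<sigma> m)"
    if "r \<in> {p, q, p + q}" for r
    using that keys_add[of p q] by (intro eval_mpoly_superset) auto
  then show ?thesis
    by (simp add: lookup_add hom_add distrib_right sum.distrib)
qed

lemma eval_mpoly_mult: "eval_mpoly hom \<sigma> (p * q) = eval_mpoly hom \<sigma> p * eval_mpoly hom \<sigma> q"
proof -
  have "p \<in> Pol UNIV" by simp
  then show ?thesis
  proof (induction p rule: Pol_induct)
    case (single m c)
    have "q \<in> Pol UNIV" by simp
    then show ?case
    proof (induction q rule: Pol_induct)
      case (single m' c')
      then show ?case by (simp add: mult_single hom_mult mon_eval_add ac_simps)
    qed (simp add: distrib_left eval_mpoly_add)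
  qed (simp add: distrib_right eval_mpoly_add)
qed

lemma comm_ring_hom_eval_mpoly: "comm_ring_hom (eval_mpoly hom \<sigma>)"
  by unfold_locales (auto simp: eval_mpoly_add eval_mpoly_mult)

end

lemma var_poly_in_Pol [simp]: "v \<in> V \<Longrightarrow> var_poly v \<in> Pol V"
  by (simp add: var_poly_def Pol_single)

lemma const_poly_in_Pol [simp]: "const_poly c \<in> Pol V"
  by (simp add: const_poly_def Pol_single)

interpretation const_poly: comm_ring_hom "const_poly :: 'k::field \<Rightarrow> 'k mpol"
  by unfold_locales (auto simp: const_poly_def single_add mult_single)

lemma const_poly_eq_0_iff [simp]: "const_poly c = 0 \<longleftrightarrow> c = 0"
  by (metis const_poly_def lookup_single_eq lookup_zero single_zero)

lemma lookup_const_mult: "lookup (const_poly c * p) m = c * lookup p m"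
proof -
  have "p \<in> Pol UNIV" by simp
  then show ?thesis
    by (induction p rule: Pol_induct)
      (auto simp: const_poly_def mult_single lookup_single when_def distrib_left lookup_add)
qed

interpretation mp: vector_space "\<lambda>(c :: 'k::field) (p :: 'k mpol). const_poly c * p"
  by unfold_locales (auto simp: algebra_simps const_poly.hom_add const_poly.hom_mult)

lemma single_eq_const_mult: "single m c = const_poly c * single m 1"
  by (simp add: const_poly_def mult_single)

lemma carrier_pol_ring [simp]: "carrier (pol_ring V) = Pol V"
  and mult_pol_ring [simp]: "monoid.mult (pol_ring V) = (*)"
  and one_pol_ring [simp]: "one (pol_ring V) = 1"
  and zero_pol_ring [simp]: "ring.zero (pol_ring V) = 0"
  and add_pol_ring [simp]: "ring.add (pol_ring V) = (+)"
  by (simp_all add: pol_ring_def Pol_def)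

lemma cring_pol_ring: "cring (pol_ring V :: 'k::field mpol ring)"
proof (rule cringI)
  show "abelian_group (pol_ring V :: 'k mpol ring)"
    by (rule abelian_groupI) (auto simp: Pol_add ac_simps intro: exI[of _ "- x" for x] Pol_uminus
        intro!: bexI[of _ "- x" for x])
  show "comm_monoid (pol_ring V :: 'k mpol ring)"
    by (rule comm_monoidI) (auto simp: Pol_mult ac_simps)
qed (auto simp: distrib_right)

lemma ideal_pol_ringI:
  fixes I :: "'k::field mpol set"
  assumes "I \<subseteq> Pol V" "0 \<in> I" "\<And>p q. p \<in> I \<Longrightarrow> q \<in> I \<Longrightarrow> p + q \<in> I"
    and "\<And>p a. p \<in> I \<Longrightarrow> a \<in> Pol V \<Longrightarrow> a * p \<in> I"
  shows "ideal I (pol_ring V)"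
proof -
  interpret cring "pol_ring V :: 'k mpol ring" by (rule cring_pol_ring)
  have neg: "\<ominus>\<^bsub>pol_ring V\<^esub> p = - p" if "p \<in> Pol V" for p :: "'k mpol"
    using that by (intro minus_equality) (auto simp: Pol_uminus)
  have "- p \<in> I" if "p \<in> I" for p
    using assms(4)[OF that, of "- 1"] by (simp add: Pol_uminus)
  then show ?thesis
    using assms neg
    by (intro idealI ring_axioms add.subgroupI) (auto simp: a_inv_def[symmetric] subset_iff mult.commute)
qed

lemma ideal_pol_ringD:
  fixes I :: "'k::field mpol set"
  assumes "ideal I (pol_ring V)"
  shows "I \<subseteq> Pol V" "0 \<in> I" "\<And>p q. p \<in> I \<Longrightarrow> q \<in> I \<Longrightarrow> p + q \<in> I"
    and "\<And>p a. p \<in> I \<Longrightarrow> a \<in> Pol V \<Longrightarrow> a * p \<in> I"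
    and "\<And>p q. p \<in> I \<Longrightarrow> q \<in> I \<Longrightarrow> p - q \<in> I"
proof -
  interpret ideal I "pol_ring V" by fact
  show sub: "I \<subseteq> Pol V" using a_subset by simp
  show "0 \<in> I" using additive_subgroup.zero_closed[OF is_additive_subgroup] by simp
  show add: "p + q \<in> I" if "p \<in> I" "q \<in> I" for p q using subgroup.m_closed[OF additive_subgroup.a_subgroup[OF is_additive_subgroup] that] by simp
  show mult: "a * p \<in> I" if "p \<in> I" "a \<in> Pol V" for p a using I_l_closed[of p a] that by simp
  show "p - q \<in> I" if "p \<in> I" "q \<in> I" for p q
    using add[OF that(1) mult[OF that(2), of "- 1"]] by (simp add: Pol_uminus)
qed

section \<open>Partial linear maps without invariant subspaces\<close>

text \<open>A pair \<open>(w, a)\<close> carries the block length \<open>a\<close>: the list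
  contains the \<open>a\<close> vectors on which T is applied again, and passing to
  \<open>(w, Suc a)\<close> adds the last vector of the chain. With \<open>a = 0\<close> the chain
  is a single vector outside the domain, which becomes a cone coordinate of the scroll.\<close>

definition chain_list :: "('b \<Rightarrow> 'b) \<Rightarrow> ('b \<times> nat) list \<Rightarrow> 'b list" where
  "chain_list T cs = concat (map (\<lambda>(w, a). map (\<lambda>j. (T ^^ j) w) [0..<a]) cs)"

lemma chain_list_append: "chain_list T (cs @ ds) = chain_list T cs @ chain_list T ds"
  by (simp add: chain_list_def)

text \<open>Distinctness and the underlying set depend on the multiset only, so the last vectors can
  be collected at the end although they are interspersed in the list.\<close>

lemma mset_chain_list_Suc:
  "mset (chain_list T (map (\<lambda>(w, a). (w, Suc a)) cs)) =
    mset (chain_list T cs) + mset (map (\<lambda>(w, a). (T ^^ a) w) cs)"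
  by (induction cs) (auto simp: chain_list_def)

context vector_space
begin

lemma independent_UnI:
  assumes "independent A" "independent B" "span A \<inter> span B \<subseteq> {0}"
  shows "independent (A \<union> B)"
proof -
  have *: False if "independent A" "a \<in> A" "a \<in> span (A \<union> B - {a})" "span A \<inter> span B \<subseteq> {0}" for a A B
  proof -
    have "a \<in> span ((A - {a}) \<union> B)"
      using that(3) span_mono[of "A \<union> B - {a}" "(A - {a}) \<union> B"] by blast
    then obtain x y where xy: "a = x + y" "x \<in> span (A - {a})" "y \<in> span B"
      unfolding span_Un by blast
    have "x \<in> span A" using xy(2) span_mono[OF Diff_subset[of A "{a}"]] by blast
    then have "a - x \<in> span A" using that(2) by (simp add: span_diff span_base)
    then have "y \<in> span A" using xy(1) by simp
    then have "y = 0" using that(4) xy(3) by blast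
    then have "a \<in> span (A - {a})" using xy by simp
    then show False using that(1,2) dependent_def by blast
  qed
  show ?thesis
  proof
    assume "dependent (A \<union> B)"
    then obtain a where a: "a \<in> A \<union> B" "a \<in> span (A \<union> B - {a})"
      unfolding dependent_def by blast
    show False
    proof (cases "a \<in> A")
      case True
      then show ?thesis using *[OF assms(1) _ a(2) assms(3)] by blast
    next
      case False
      then show ?thesis using *[OF assms(2), of a A] a assms(3) by (simp add: Un_commute Int_commute)
    qed
  qed
qed

lemma span_Int_independent_Un:
  assumes "independent (A \<union> B)" "A \<inter> B = {}"
  shows "span A \<inter> span B = {0}"
proof -
  interpret P: vector_space_pair scale scale
    by unfold_locales
  \<comment> \<open>The projection onto \<open>span A\<close> along \<open>span B\<close>: a common
    vector equals its own image and is also mapped to 0.\<close>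
  define p where "p = P.construct (A \<union> B) (\<lambda>v. if v \<in> A then v else 0)"
  have lin: "Vector_Spaces.linear scale scale p"
    unfolding p_def using assms(1) by (rule P.linear_construct)
  have p: "p v = (if v \<in> A then v else 0)" if "v \<in> A \<union> B" for v
    unfolding p_def using P.construct_basis[OF assms(1) that] .
  have "x = 0" if "x \<in> span A" "x \<in> span B" for x
  proof -
    have "p x = x"
      using P.linear_eq_on[OF lin linear_ident that(1)] p by auto
    moreover have "p x = 0"
      using P.linear_eq_on[OF lin P.linear_zero that(2)] p assms(2) by (metis Un_iff disjoint_iff)
    ultimately show ?thesis by simp
  qed
  then show ?thesis using span_zero by auto
qed

text \<open>
  The chains of \<open>U\<close>, regarded as the ambient space of the restriction of \<open>T\<close> to
  \<open>{x \<in> U. T x \<in> U}\<close>, are extended by one application of \<open>T\<close>; this works because \<open>T\<close> maps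
  \<open>U\<close> modulo \<open>{x \<in> U. T x \<in> U}\<close> injectively to \<open>W\<close> modulo \<open>U\<close>.
\<close>

lemma chain_basis_exists:
  assumes T: "Vector_Spaces.linear scale scale T"
    and "finite F" "W \<subseteq> span F" "subspace W" "subspace U" "U \<subseteq> W" "T ` U \<subseteq> W"
    and "\<And>Y. subspace Y \<Longrightarrow> Y \<subseteq> U \<Longrightarrow> T ` Y \<subseteq> Y \<Longrightarrow> Y = {0}"
  shows "\<exists>cs. distinct (chain_list T (map (\<lambda>(w, a). (w, Suc a)) cs)) \<and>
    independent (set (chain_list T (map (\<lambda>(w, a). (w, Suc a)) cs))) \<and>
    span (set (chain_list T (map (\<lambda>(w, a). (w, Suc a)) cs))) = W \<and>
    span (set (chain_list T cs)) = U"
  using assms(2-)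
proof (induction "dim W" arbitrary: W U rule: less_induct)
  case less
  interpret T: Vector_Spaces.linear scale scale T by (rule T)
  let ?S = "map (\<lambda>(w, a). (w :: 'b, Suc a))"
  show ?case
  proof (cases "U = W")
    case True
    \<comment> \<open>In this case U itself is T-invariant.\<close>
    then have "W = {0}" using less.prems by blast
    then show ?thesis
      using True by (intro exI[of _ "[]"]) (simp add: chain_list_def independent_empty)
  next
    case False
    define U' where "U' = {x \<in> U. T x \<in> U}"
    have subU': "subspace U'"
      using subspace_inter[OF less.prems(4) T.subspace_linear_preimage[OF less.prems(4)]]
      by (simp add: U'_def Int_def)
    have Xfin: "U \<subseteq> span F" using less.prems by blast
    have "dim U < dim W"
    proof -
      obtain B where B: "B \<subseteq> U" "independent B" "U \<subseteq> span B" "card B = dim U"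
        by (rule basis_exists)
      obtain w where w: "w \<in> W" "w \<notin> U" using False less.prems by blast
      have sB: "span B = U" using B less.prems span_minimal by blast
      have ind: "independent (insert w B)" using B(2) w sB by (intro independent_insertI) auto
      have "insert w B \<subseteq> W" using B(1) w less.prems(5) by blast
      from maximal_independent_subset_extend[OF this ind]
      obtain C where C: "insert w B \<subseteq> C" "C \<subseteq> W" "independent C" "W \<subseteq> span C" .
      have "finite C" using independent_span_bound[OF less.prems(1) C(3)] C(2) less.prems(2) by blast
      then have "card (insert w B) \<le> card C" using C by (intro card_mono)
      moreover have "w \<notin> B" using w sB span_base by blast
      moreover have "finite B" using \<open>finite C\<close> C(1) by (auto intro: finite_subset)
      ultimately show ?thesis using B(4) basis_card_eq_dim[OF C(2,4,3)] by simp
    qed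
    moreover have "U' \<subseteq> U" "T ` U' \<subseteq> U" by (auto simp: U'_def)
    moreover have "Y = {0}" if "subspace Y" "Y \<subseteq> U'" "T ` Y \<subseteq> Y" for Y
      using that \<open>U' \<subseteq> U\<close> by (intro less.prems(7)) auto
    ultimately obtain cs where cs: "distinct (chain_list T (?S cs))" "independent (set (chain_list T (?S cs)))"
      "span (set (chain_list T (?S cs))) = U" "span (set (chain_list T cs)) = U'"
      using less.hyps[OF _ less.prems(1) Xfin less.prems(4) subU'] by blast
    define E where "E = map (\<lambda>(w, a). (T ^^ a) w) cs"
    have ms: "mset (chain_list T (?S ds)) = mset (chain_list T ds) + mset (map (\<lambda>(w, a). (T ^^ a) w) ds)"
      for ds by (rule mset_chain_list_Suc)
    have dist: "distinct (chain_list T cs @ E)"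
      using cs(1) ms[of cs] unfolding E_def by (metis mset_append mset_eq_imp_distinct_iff)
    have set1: "set (chain_list T (?S cs)) = set (chain_list T cs) \<union> set E"
      using ms[of cs] unfolding E_def by (metis set_mset_mset set_mset_union)
    have indE: "independent (set E)" "independent (set (chain_list T cs))"
      using cs(2) set1 independent_mono by auto
    \<comment> \<open>Such a \<open>y\<close> lies in \<open>U'\<close>, which is spanned by the
      inner vectors of the chains, whereas the last vectors \<open>E\<close> span a complement of it
      in U.\<close>
    have key: "y = 0" if "y \<in> span (set E)" "T y \<in> U" for y
    proof -
      have "set E \<subseteq> U" using set1 cs(3) span_base by blast
      then have "y \<in> U" using that(1) span_minimal less.prems(4) by blast
      then have "y \<in> span (set (chain_list T cs))" using that cs(4) by (auto simp: U'_def)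
      moreover have "set E \<inter> set (chain_list T cs) = {}" using dist by auto
      then have "span (set E) \<inter> span (set (chain_list T cs)) = {0}"
        using cs(2) set1 by (intro span_Int_independent_Un) (auto simp: Un_commute)
      ultimately show ?thesis using that(1) by blast
    qed
    have injE: "inj_on T (span (set E))"
      unfolding T.inj_on_iff_eq_0[OF subspace_span] using key subspace_0[OF less.prems(4)] by simp
    have ind2: "independent (set (chain_list T (?S cs)) \<union> T ` set E)"
    proof (rule independent_UnI)
      show "independent (T ` set E)" using T.independent_injective_image[OF indE(1) injE] .
      show "span (set (chain_list T (?S cs))) \<inter> span (T ` set E) \<subseteq> {0}"
        unfolding cs(3) T.span_image
      proof
        fix x assume "x \<in> U \<inter> T ` span (set E)"
        then obtain y where "x = T y" "y \<in> span (set E)" "T y \<in> U" by blast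
        then show "x \<in> {0}" using key[of y] T.zero by simp
      qed
    qed fact
    have "set (chain_list T (?S cs)) \<union> T ` set E \<subseteq> W"
    proof -
      have "set (chain_list T (?S cs)) \<subseteq> U" using cs(3) span_superset by blast
      then show ?thesis using less.prems set1 by blast
    qed
    from maximal_independent_subset_extend[OF this ind2]
    obtain B where B: "set (chain_list T (?S cs)) \<union> T ` set E \<subseteq> B" "B \<subseteq> W" "independent B" "W \<subseteq> span B" .
    have finB: "finite B" using independent_span_bound[OF less.prems(1) B(3)] B(2) less.prems(2) by blast
    obtain ns where ns: "set ns = B - (set (chain_list T (?S cs)) \<union> T ` set E)" "distinct ns"
      using finite_distinct_list[of "B - (set (chain_list T (?S cs)) \<union> T ` set E)"] finB by auto
    \<comment> \<open>Every chain of U grows by one vector, and the basis vectors of W not reached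
      in this way start chains with \<open>a = 0\<close>.\<close>
    define cs' where "cs' = ?S cs @ map (\<lambda>w. (w, 0)) ns"
    have new: "chain_list T (map (\<lambda>w. (w, 0)) ns) = []" "map (\<lambda>(w, a). (T ^^ a) w) (map (\<lambda>w. (w, 0)) ns) = ns"
      by (induction ns) (auto simp: chain_list_def)
    have tails: "map (\<lambda>(w, a). (T ^^ a) w) (?S cs) = map T E"
      by (auto simp: E_def)
    have c1: "chain_list T cs' = chain_list T (?S cs)"
      by (simp add: cs'_def chain_list_append new)
    have m2: "mset (chain_list T (?S cs')) = mset (chain_list T (?S cs) @ map T E @ ns)"
      unfolding ms[of cs'] c1 unfolding cs'_def map_append tails new(2) by simp
    have disj: "set (chain_list T (?S cs)) \<inter> T ` set E = {}"
    proof -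
      have "T e \<notin> U" if "e \<in> set E" for e
        using key[OF span_base[OF that]] that indE(1) dependent_zero by blast
      then show ?thesis using cs(3) span_base by blast
    qed
    have "inj_on T (set E)" using injE span_superset inj_on_subset by blast
    then have "distinct (chain_list T (?S cs) @ map T E @ ns)"
      using cs(1) dist ns disj by (auto simp: distinct_map)
    then have "distinct (chain_list T (?S cs'))"
      using m2 by (metis mset_eq_imp_distinct_iff)
    moreover have "set (chain_list T (?S cs')) = B"
      using mset_eq_setD[OF m2] ns B(1) by auto
    moreover have "span B = W" using B less.prems(3) span_minimal by blast
    ultimately show ?thesis using B(3) c1 cs(3) by (intro exI[of _ cs']) simp
  qed
qed

end

section \<open>Leading monomials\<close>

lemma monomial_eq_add_diff:
  fixes a b :: "'v \<Rightarrow>\<^sub>0 nat"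
  assumes "\<And>v. lookup a v \<le> lookup b v"
  shows "b = a + (b - a)"
  using assms by (intro poly_mapping_eqI) (simp add: lookup_add lookup_minus)

lemma nat_seq_mono_subseq:
  fixes g :: "nat \<Rightarrow> nat"
  shows "\<exists>r :: nat \<Rightarrow> nat. strict_mono r \<and> (\<forall>i j. i \<le> j \<longrightarrow> g (r i) \<le> g (r j))"
proof -
  obtain r :: "nat \<Rightarrow> nat" where r: "strict_mono r" "monoseq (\<lambda>n. g (r n))"
    using seq_monosub[of g] by blast
  show ?thesis
  proof (cases "\<forall>m n. m \<le> n \<longrightarrow> g (r m) \<le> g (r n)")
    case True
    then show ?thesis using r(1) by (intro exI[of _ r]) simp
  next
    case False
    then have dec: "g (r n) \<le> g (r m)" if "m \<le> n" for m n
      using r(2) that unfolding monoseq_def by blast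
    \<comment> \<open>A decreasing sequence of natural numbers is constant from the index of its
      minimum on.\<close>
    define N where "N = (ARG_MIN (\<lambda>n. g (r n)) n. True)"
    have min: "g (r N) \<le> g (r n)" for n
      unfolding N_def by (rule arg_min_nat_le) simp
    have "g (r (N + i)) = g (r N)" for i
      using min[of "N + i"] dec[of N "N + i"] by simp
    moreover have "strict_mono (\<lambda>i. r (N + i))"
      using r(1) by (simp add: strict_mono_def)
    ultimately show ?thesis by (intro exI[of _ "\<lambda>i. r (N + i)"]) simp
  qed
qed

lemma dickson_subseq:
  fixes f :: "nat \<Rightarrow> ('v \<Rightarrow>\<^sub>0 nat)"
  assumes "finite V"
  shows "\<exists>r :: nat \<Rightarrow> nat. strict_mono r \<and> (\<forall>v\<in>V. \<forall>i j. i \<le> j \<longrightarrow> lookup (f (r i)) v \<le> lookup (f (r j)) v)"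
  using assms
proof (induction V)
  case empty
  show ?case by (intro exI[of _ id]) (simp add: strict_mono_def)
next
  case (insert v V)
  then obtain r :: "nat \<Rightarrow> nat" where r: "strict_mono r" "\<forall>v\<in>V. \<forall>i j. i \<le> j \<longrightarrow> lookup (f (r i)) v \<le> lookup (f (r j)) v"
    by (elim exE conjE)
  from nat_seq_mono_subseq[of "\<lambda>i. lookup (f (r i)) v"]
  obtain r' :: "nat \<Rightarrow> nat" where r': "strict_mono r'" "\<forall>i j. i \<le> j \<longrightarrow> lookup (f (r (r' i))) v \<le> lookup (f (r (r' j))) v"
    by (elim exE conjE)
  have "strict_mono (\<lambda>i. r (r' i))"
    using r(1) r'(1) by (simp add: strict_mono_def)
  moreover have "r' i \<le> r' j" if "i \<le> j" for i j
    using r'(1) that by (simp add: strict_mono_less_eq)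
  ultimately show ?case
    using r(2) r'(2) by (intro exI[of _ "\<lambda>i. r (r' i)"]) simp
qed

lemma dickson:
  fixes f :: "nat \<Rightarrow> ('v \<Rightarrow>\<^sub>0 nat)"
  assumes "finite V" "\<And>i. keys (f i) \<subseteq> V"
  obtains i j c where "i < j" "f j = f i + c"
proof -
  obtain r :: "nat \<Rightarrow> nat" where r: "strict_mono r" "\<forall>v\<in>V. \<forall>i j. i \<le> j \<longrightarrow> lookup (f (r i)) v \<le> lookup (f (r j)) v"
    using dickson_subseq[OF assms(1), of f] by (elim exE conjE)
  have "lookup (f (r 0)) v \<le> lookup (f (r 1)) v" for v
  proof (cases "v \<in> V")
    case False
    then have "lookup (f (r 0)) v = 0" using assms(2)[of "r 0"] by (auto simp: in_keys_iff)
    then show ?thesis by simp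
  qed (use r(2) in auto)
  then have "f (r 1) = f (r 0) + (f (r 1) - f (r 0))" by (rule monomial_eq_add_diff)
  moreover have "r 0 < r 1" using r(1) by (simp add: strict_mono_def)
  ultimately show ?thesis using that by blast
qed

lemma monomial_ge_0: "0 \<le> (m :: 'v::linorder \<Rightarrow>\<^sub>0 nat)"
proof (rule ccontr)
  assume "\<not> 0 \<le> m"
  then have "m < 0" by simp
  then show False by (simp add: less_poly_mapping.rep_eq less_fun_def)
qed

lemma monomial_le_add: "a \<le> a + (c :: 'v::linorder \<Rightarrow>\<^sub>0 nat)"
  using add_left_mono[OF monomial_ge_0[of c], of a] by simp

text \<open>By Dickson's lemma a descending sequence would contain a monomial that is a multiple of
  an earlier one, hence not smaller. In infinitely many variables this fails: the variables t_1,
  t_2, ... themselves descend.\<close>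

lemma wf_monomials:
  assumes "finite V"
  shows "wf {(a, b :: 'v::linorder \<Rightarrow>\<^sub>0 nat). keys a \<subseteq> V \<and> keys b \<subseteq> V \<and> a < b}"
  unfolding wf_iff_no_infinite_down_chain
proof
  assume "\<exists>f. \<forall>i. (f (Suc i), f i) \<in> {(a, b :: 'v \<Rightarrow>\<^sub>0 nat). keys a \<subseteq> V \<and> keys b \<subseteq> V \<and> a < b}"
  then obtain f :: "nat \<Rightarrow> ('v \<Rightarrow>\<^sub>0 nat)" where f: "\<And>i. keys (f i) \<subseteq> V" "\<And>i. f (Suc i) < f i" by blast
  from dickson[OF assms f(1)] obtain i j c where "i < j" "f j = f i + c" .
  moreover have "f j < f i" if "i < j" for i j
    using that by (induction j) (use f(2) in \<open>auto simp: less_Suc_eq intro: order.strict_trans\<close>)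
  ultimately show False using monomial_le_add[of "f i" c] by fastforce
qed

text \<open>The members of S minimal for divisibility do the job: infinitely many of them would
  contradict Dickson's lemma, and well-foundedness provides one below every member.\<close>

lemma dickson_basis:
  fixes S :: "('v::linorder \<Rightarrow>\<^sub>0 nat) set"
  assumes "finite V" "\<And>m. m \<in> S \<Longrightarrow> keys m \<subseteq> V"
  obtains F where "finite F" "F \<subseteq> S" "\<And>m. m \<in> S \<Longrightarrow> \<exists>f\<in>F. \<exists>c. m = f + c"
proof -
  define F where "F = {m \<in> S. \<forall>f\<in>S. \<forall>c. m = f + c \<longrightarrow> f = m}"
  have "finite F"
  proof (rule ccontr)
    assume "infinite F"
    then obtain f :: "nat \<Rightarrow> ('v \<Rightarrow>\<^sub>0 nat)" where f: "inj f" "range f \<subseteq> F"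
      using infinite_countable_subset by blast
    then have "keys (f i) \<subseteq> V" for i using assms(2)[of "f i"] unfolding F_def by blast
    from dickson[OF assms(1) this] obtain i j c where "i < j" "f j = f i + c" .
    moreover have "f j \<in> F" "f i \<in> S" using f(2) by (auto simp: F_def)
    ultimately have "f i = f j" by (auto simp: F_def)
    then show False using f(1) \<open>i < j\<close> by (simp add: inj_eq)
  qed
  moreover have "\<exists>f\<in>F. \<exists>c. m = f + c" if "m \<in> S" for m
    using that
  proof (induction m rule: wf_induct_rule[OF wf_monomials[OF assms(1)]])
    case (1 m)
    show ?case
    proof (cases "m \<in> F")
      case True
      then show ?thesis by (intro bexI[of _ m] exI[of _ 0]) auto
    next
      case False
      then obtain f c where fc: "f \<in> S" "m = f + c" "f \<noteq> m" using 1(2) by (auto simp: F_def)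
      then have "f < m" using monomial_le_add[of f c] by (metis order_le_less)
      then have "\<exists>g\<in>F. \<exists>d. f = g + d" using 1 fc(1) assms(2) by simp
      then obtain g d where "g \<in> F" "f = g + d" by blast
      then show ?thesis using fc by (intro bexI[of _ g] exI[of _ "d + c"]) (auto simp: add.assoc)
    qed
  qed
  moreover have "F \<subseteq> S" by (auto simp: F_def)
  ultimately show ?thesis by (intro that[of F])
qed

section \<open>Leading monomials and division in monoid algebras\<close>

definition lead_mon :: "('v::linorder, 'a::zero) mpoly \<Rightarrow> ('v \<Rightarrow>\<^sub>0 nat)" where
  "lead_mon p = Max (keys p)"

abbreviation lead_co :: "('v::linorder, 'a::zero) mpoly \<Rightarrow> 'a" where
  "lead_co p \<equiv> lookup p (lead_mon p)"

lemma lead_mon_in_keys: "p \<noteq> 0 \<Longrightarrow> lead_mon p \<in> keys p"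
  unfolding lead_mon_def by (intro Max_in) auto

lemma lead_co_nonzero [simp]: "lead_co p = 0 \<longleftrightarrow> p = 0"
  using lead_mon_in_keys[of p] by (auto simp: in_keys_iff)

lemma lead_mon_ge: "m \<in> keys p \<Longrightarrow> m \<le> lead_mon p"
  unfolding lead_mon_def by simp

lemma lead_mon_keys: "p \<in> Pol V \<Longrightarrow> p \<noteq> 0 \<Longrightarrow> keys (lead_mon p) \<subseteq> V"
  using lead_mon_in_keys[of p] by (auto simp: Pol_def)

text \<open>Addition of monomials is strictly monotone, so a single pair of terms contributes to
  this coefficient.\<close>

lemma lookup_mult_lead:
  fixes p q :: "('v::linorder, 'a::comm_ring_1) mpoly"
  shows "lookup (p * q) (lead_mon p + lead_mon q) = lead_co p * lead_co q"
proof (cases "p = 0 \<or> q = 0")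
  case False
  then have nz: "p \<noteq> 0" "q \<noteq> 0" by auto
  have eq: "p * q = (\<Sum>a\<in>keys p. \<Sum>b\<in>keys q. single (a + b) (lookup p a * lookup q b))"
    using sum_product[of "\<lambda>a. single a (lookup p a)" "keys p" "\<lambda>b. single b (lookup q b)" "keys q"]
    by (simp add: sum_single_lookup mult_single)
  have "lookup (p * q) (lead_mon p + lead_mon q) =
      (\<Sum>a\<in>keys p. \<Sum>b\<in>keys q. if a = lead_mon p \<and> b = lead_mon q then lookup p a * lookup q b else 0)"
    unfolding eq lookup_sum
  proof (intro sum.cong refl)
    fix a b assume ab: "a \<in> keys p" "b \<in> keys q"
    have "a + b \<noteq> lead_mon p + lead_mon q" if "\<not> (a = lead_mon p \<and> b = lead_mon q)"
    proof (cases "a = lead_mon p")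
      case True
      then show ?thesis using that by simp
    next
      case False
      then have "a < lead_mon p" using lead_mon_ge[OF ab(1)] by simp
      then show ?thesis using lead_mon_ge[OF ab(2)] add_less_le_mono by fastforce
    qed
    then show "lookup (single (a + b) (lookup p a * lookup q b)) (lead_mon p + lead_mon q) =
      (if a = lead_mon p \<and> b = lead_mon q then lookup p a * lookup q b else 0)"
      by (auto simp: lookup_single when_def)
  qed
  also have "\<dots> = (\<Sum>a\<in>keys p. if a = lead_mon p then lookup p a * lead_co q else 0)"
    using lead_mon_in_keys[OF nz(2)] by (intro sum.cong) auto
  also have "\<dots> = lead_co p * lead_co q"
    using lead_mon_in_keys[OF nz(1)] by simp
  finally show ?thesis .
qed auto

lemma lead_mon_mult:
  fixes p q :: "('v::linorder, 'a::idom) mpoly"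
  assumes "p \<noteq> 0" "q \<noteq> 0"
  shows "lead_mon (p * q) = lead_mon p + lead_mon q"
proof (rule antisym)
  have "lookup (p * q) (lead_mon p + lead_mon q) \<noteq> 0"
    using assms by (simp add: lookup_mult_lead)
  then show "lead_mon p + lead_mon q \<le> lead_mon (p * q)"
    by (intro lead_mon_ge) (simp add: in_keys_iff)
  have "lead_mon (p * q) \<in> keys (p * q)" using assms by (intro lead_mon_in_keys) simp
  then obtain a b where "a \<in> keys p" "b \<in> keys q" "lead_mon (p * q) = a + b"
    using keys_mult[of p q] by blast
  then show "lead_mon (p * q) \<le> lead_mon p + lead_mon q"
    by (simp add: add_mono lead_mon_ge)
qed

lemma lookup_lead_mon_power:
  fixes p :: "('v::linorder, 'a::idom) mpoly"
  assumes "p \<noteq> 0"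
  shows "lookup (lead_mon (p ^ n)) v = n * lookup (lead_mon p) v"
proof (induction n)
  case 0
  have "lead_mon (1 :: ('v, 'a) mpoly) = 0" by (simp add: lead_mon_def)
  then show ?case by simp
qed (use assms in \<open>simp add: lead_mon_mult lookup_add\<close>)

lemma lead_mon_cancel:
  fixes p q :: "('v::linorder, 'a::ab_group_add) mpoly"
  assumes "p \<noteq> 0" "lookup q (lead_mon p) = lead_co p" "\<And>m. m \<in> keys q \<Longrightarrow> m \<le> lead_mon p" "p - q \<noteq> 0"
  shows "lead_mon (p - q) < lead_mon p"
proof -
  have in_keys: "lead_mon (p - q) \<in> keys (p - q)" by (rule lead_mon_in_keys) fact
  then have "lead_mon (p - q) \<in> keys p \<union> keys q" by (auto simp: in_keys_iff lookup_minus)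
  then have "lead_mon (p - q) \<le> lead_mon p" using assms(3) lead_mon_ge by blast
  moreover have "lead_mon (p - q) \<noteq> lead_mon p"
    using in_keys assms(2) by (auto simp: in_keys_iff lookup_minus)
  ultimately show ?thesis by simp
qed

lemma lookup_single_mult:
  fixes p :: "('v, 'a::comm_ring_1) mpoly"
  shows "lookup (single m c * p) (m + k) = c * lookup p k"
proof -
  have "p \<in> Pol UNIV" by simp
  then show ?thesis
    by (induction p rule: Pol_induct) (auto simp: mult_single lookup_single when_def lookup_add distrib_left)
qed

lemma keys_single_mult: "k \<in> keys (single m c * p) \<Longrightarrow> \<exists>l\<in>keys p. k = m + l"
  using keys_mult[of "single m c" p] by (auto split: if_splits)

text \<open>
  A monoid algebra over a saturated monoid of monomials is completely integrally closed: if \<open>a\<close> is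
  almost integral over \<open>b\<close>, then the leading monomial of \<open>b\<close> divides that of \<open>a\<close>, and one can divide
  with remainder.
\<close>

lemma monoid_algebra_dvd:
  fixes b c :: "('v::linorder, 'k::field) mpoly"
  assumes V: "finite V" "\<And>m. m \<in> M \<Longrightarrow> keys m \<subseteq> V"
    and M: "\<And>m m'. m \<in> M \<Longrightarrow> m' \<in> M \<Longrightarrow> m + m' \<in> M"
    and sat: "\<And>\<alpha> \<beta> \<gamma>. \<alpha> \<in> M \<Longrightarrow> \<beta> \<in> M \<Longrightarrow> \<gamma> \<in> M \<Longrightarrow>
      (\<And>n. \<exists>\<mu>\<in>M. \<forall>v. lookup \<gamma> v + n * lookup \<alpha> v = lookup \<mu> v + n * lookup \<beta> v) \<Longrightarrow> \<exists>\<delta>\<in>M. \<alpha> = \<beta> + \<delta>"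
    and b: "b \<noteq> 0" "keys b \<subseteq> M" and c: "c \<noteq> 0" "keys c \<subseteq> M"
    and a: "keys a \<subseteq> M" "\<And>n. \<exists>p. keys p \<subseteq> M \<and> c * a ^ n = b ^ n * p"
  shows "\<exists>q. keys q \<subseteq> M \<and> a = b * q"
proof -
  have "keys a \<subseteq> M \<longrightarrow> (\<forall>n. \<exists>p. keys p \<subseteq> M \<and> c * a ^ n = b ^ n * p) \<longrightarrow> (\<exists>q. keys q \<subseteq> M \<and> a = b * q)"
  proof (induction a rule: wf_induct_rule[OF wf_inv_image[OF wf_monomials[OF V(1)], of lead_mon]])
    case (1 a)
    show ?case
    proof (intro impI)
      assume prems: "keys a \<subseteq> M" "\<forall>n. \<exists>p. keys p \<subseteq> M \<and> c * a ^ n = b ^ n * p"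
      show "\<exists>q. keys q \<subseteq> M \<and> a = b * q"
      proof (cases "a = 0")
        case True
        then show ?thesis by (intro exI[of _ 0]) simp
      next
        case False
        have Mmult: "keys (p * q) \<subseteq> M" if "keys p \<subseteq> M" "keys q \<subseteq> M" for p q :: "('v, 'k) mpoly"
          using keys_mult[of p q] that M by blast
        have inM: "lead_mon a \<in> M" "lead_mon b \<in> M" "lead_mon c \<in> M"
          using lead_mon_in_keys False b c prems(1) by blast+
        \<comment> \<open>Comparing leading monomials in \<open>c * a ^ n = b ^ n * p\<close> yields
          exactly the hypothesis of \<open>sat\<close>, with the leading monomial of
          \<open>p\<close> as \<mu>.\<close>
        have "\<exists>\<mu>\<in>M. \<forall>v. lookup (lead_mon c) v + n * lookup (lead_mon a) v = lookup \<mu> v + n * lookup (lead_mon b) v" for n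
        proof -
          obtain p where p: "keys p \<subseteq> M" "c * a ^ n = b ^ n * p" using prems(2) by blast
          have "p \<noteq> 0" using p(2) c(1) False by auto
          have "lead_mon (c * a ^ n) = lead_mon (b ^ n * p)" using p(2) by simp
          then have "lead_mon c + lead_mon (a ^ n) = lead_mon (b ^ n) + lead_mon p"
            using c(1) b(1) False \<open>p \<noteq> 0\<close> by (simp add: lead_mon_mult)
          then have "lookup (lead_mon c + lead_mon (a ^ n)) v = lookup (lead_mon (b ^ n) + lead_mon p) v" for v by simp
          then show ?thesis
            using lead_mon_in_keys[OF \<open>p \<noteq> 0\<close>] p(1) False b(1)
            by (intro bexI[of _ "lead_mon p"]) (auto simp: lookup_add lookup_lead_mon_power add.commute)
        qed
        from sat[OF inM this] obtain \<delta> where \<delta>: "\<delta> \<in> M" "lead_mon a = lead_mon b + \<delta>" by blast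
        define t where "t = single \<delta> (lead_co a / lead_co b)"
        have tM: "keys t \<subseteq> M" using \<delta>(1) by (simp add: t_def)
        define a' where "a' = a - t * b"
        have a'M: "keys a' \<subseteq> M"
          using keys_diff[of a "t * b"] Mmult[OF tM b(2)] prems(1) unfolding a'_def by blast
        \<comment> \<open>Subtracting a multiple of \<open>b\<close> preserves almost integrality
          with the same \<open>c\<close>: in the binomial expansion each \<open>c * a ^ i\<close>
          becomes \<open>b ^ i * P i\<close>, and \<open>t * b\<close> supplies the missing factors
          \<open>b\<close>.\<close>
        have pow: "\<exists>p. keys p \<subseteq> M \<and> c * a' ^ n = b ^ n * p" for n
        proof -
          have "\<forall>i. \<exists>p. keys p \<subseteq> M \<and> c * a ^ i = b ^ i * p" using prems(2) by blast
          then obtain P where P: "\<And>i. keys (P i) \<subseteq> M" "\<And>i. c * a ^ i = b ^ i * P i" by metis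
          \<comment> \<open>The exponent 0 is excluded because M is not assumed to contain the
            monomial 0.\<close>
          have tp: "keys (t ^ i) \<subseteq> M" if "i > 0" for i
            using that by (induction i rule: nat_induct_non_zero) (auto simp: tM Mmult)
          define p where "p = (\<Sum>i\<le>n. of_nat (n choose i) * (P i * (- t) ^ (n - i)))"
          have "c * a' ^ n = (\<Sum>i\<le>n. of_nat (n choose i) * (c * a ^ i) * (- (t * b)) ^ (n - i))"
            using binomial_ring[of a "- (t * b)" n] by (simp add: a'_def sum_distrib_left mult_ac)
          also have "\<dots> = (\<Sum>i\<le>n. b ^ n * (of_nat (n choose i) * (P i * (- t) ^ (n - i))))"
          proof (intro sum.cong refl)
            fix i assume "i \<in> {..n}"
            then have "b ^ n = b ^ i * b ^ (n - i)" by (simp flip: power_add)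
            moreover have "(- (t * b)) ^ (n - i) = (- t) ^ (n - i) * b ^ (n - i)"
              by (simp flip: power_mult_distrib)
            ultimately show "of_nat (n choose i) * (c * a ^ i) * (- (t * b)) ^ (n - i) =
              b ^ n * (of_nat (n choose i) * (P i * (- t) ^ (n - i)))"
              unfolding P(2) by (simp add: mult_ac)
          qed
          finally have "c * a' ^ n = b ^ n * p" by (simp add: p_def sum_distrib_left)
          moreover have "keys p \<subseteq> M"
          proof -
            have "keys (of_nat (n choose i) * (P i * (- t) ^ (n - i))) \<subseteq> M" for i
            proof -
              have "keys (P i * (- t) ^ (n - i)) \<subseteq> M"
              proof (cases "n - i = 0")
                case False
                have "(- t) ^ (n - i) = t ^ (n - i) \<or> (- t) ^ (n - i) = - (t ^ (n - i))"
                  by (cases "even (n - i)") auto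
                then have "keys ((- t) ^ (n - i)) \<subseteq> M" using tp[of "n - i"] False
                  by (auto simp: in_keys_iff subset_iff)
                then show ?thesis using P(1) Mmult by blast
              qed (use P(1) in simp)
              moreover have "keys (of_nat k * q) \<subseteq> keys q" for k and q :: "('v, 'k) mpoly"
              proof -
                have "of_nat k * q = single 0 (of_nat k) * q" by (simp add: single_of_nat)
                then show ?thesis using keys_single_mult[of _ 0 "of_nat k" q] by auto
              qed
              ultimately show ?thesis by blast
            qed
            then show ?thesis unfolding p_def
              by (intro order_trans[OF keys_sum UN_least])
          qed
          ultimately show ?thesis by blast
        qed
        have "\<exists>q. keys q \<subseteq> M \<and> a' = b * q"
        proof (cases "a' = 0")
          case True
          then show ?thesis by (intro exI[of _ 0]) simp
        next
          case a': False
          have "lead_mon a' < lead_mon a"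
            unfolding a'_def
          proof (rule lead_mon_cancel)
            show "lookup (t * b) (lead_mon a) = lead_co a"
              using b(1) unfolding t_def \<delta>(2) add.commute[of "lead_mon b"] lookup_single_mult
              by simp
            show "m \<le> lead_mon a" if m: "m \<in> keys (t * b)" for m
            proof -
              obtain l where "l \<in> keys b" "m = \<delta> + l" using m keys_single_mult unfolding t_def by blast
              then show ?thesis using lead_mon_ge[of l b] unfolding \<delta>(2) by (simp add: add.commute)
            qed
          qed (use a' False in \<open>auto simp: a'_def\<close>)
          then show ?thesis
            using "1.IH"[of a'] a'M pow inM(1) V(2) lead_mon_in_keys[OF a'] by (auto simp: subset_iff)
        qed
        then obtain q where q: "keys q \<subseteq> M" "a' = b * q" by blast
        then have "a = b * (q + t)" by (simp add: a'_def algebra_simps)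
        moreover have "keys (q + t) \<subseteq> M" using keys_add[of q t] q(1) tM by blast
        ultimately show ?thesis by blast
      qed
    qed
  qed
  from mp[OF mp[OF this a(1)] allI[OF a(2)]] show ?thesis .
qed

text \<open>A division step without fractions: over a domain \<open>p\<close> is multiplied
  beforehand by a multiple \<open>s\<close> of the leading coefficient of \<open>g\<close>. Over a
  field one takes \<open>s = 1\<close> and the inverse coefficient as \<open>s'\<close>.\<close>

lemma reduce_lead_mon:
  fixes p g :: "('v::linorder, 'a::idom) mpoly"
  assumes "p \<noteq> 0" "g \<noteq> 0" "lead_mon p = lead_mon g + \<delta>" "s = lead_co g * s'"
    and p': "p' = single 0 s * p - single \<delta> (lead_co p * s') * g" "p' \<noteq> 0"
  shows "lead_mon p' < lead_mon p"
proof -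
  have key: "m \<le> lead_mon p" if "m \<in> keys (single 0 s * p) \<union> keys (single \<delta> (lead_co p * s') * g)" for m
    using that
  proof
    assume "m \<in> keys (single 0 s * p)"
    then have "m \<in> keys p" using keys_single_mult[of m 0 s p] by auto
    then show ?thesis by (rule lead_mon_ge)
  next
    assume "m \<in> keys (single \<delta> (lead_co p * s') * g)"
    then obtain l where "l \<in> keys g" "m = \<delta> + l" using keys_single_mult by blast
    then show ?thesis using lead_mon_ge[of l g] unfolding assms(3) by (simp add: add.commute)
  qed
  have in_keys: "lead_mon p' \<in> keys p'" by (rule lead_mon_in_keys) fact
  have "lookup (single \<delta> (lead_co p * s') * g) (lead_mon p) = lead_co p * s' * lead_co g"
    unfolding assms(3) add.commute[of "lead_mon g"] lookup_single_mult ..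
  moreover have "lookup (single 0 s * p) (lead_mon p) = s * lead_co p"
    using lookup_single_mult[of 0 s p "lead_mon p"] by simp
  ultimately have "lookup p' (lead_mon p) = 0"
    unfolding p'(1) lookup_minus assms(4) by simp
  then have "lead_mon p' \<noteq> lead_mon p" using p'(2) lead_co_nonzero[of p'] by force
  moreover have "lead_mon p' \<in> keys (single 0 s * p) \<union> keys (single \<delta> (lead_co p * s') * g)"
    using in_keys by (auto simp: p'(1) in_keys_iff lookup_minus)
  then have "lead_mon p' \<le> lead_mon p" by (rule key)
  ultimately show ?thesis by simp
qed

text \<open>Polynomials of I realizing the minimal leading monomials form a Groebner basis, since
  reduction by them lowers the leading monomial. Generation is expressed through all sets J with the
  closure properties of an ideal, which keeps the statement free of ring records.\<close>

lemma Pol_ideal_finitely_generated: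
  fixes I :: "('v::linorder, 'k::field) mpoly set"
  assumes V: "finite V" and I: "I \<subseteq> Pol V" "\<And>p q. p \<in> I \<Longrightarrow> q \<in> I \<Longrightarrow> p - q \<in> I"
    "\<And>p a. p \<in> I \<Longrightarrow> a \<in> Pol V \<Longrightarrow> a * p \<in> I"
  shows "\<exists>G. finite G \<and> G \<subseteq> I \<and> (\<forall>J. 0 \<in> J \<longrightarrow> (\<forall>p\<in>J. \<forall>q\<in>J. p + q \<in> J) \<longrightarrow>
    (\<forall>p\<in>J. \<forall>a\<in>Pol V. a * p \<in> J) \<longrightarrow> G \<subseteq> J \<longrightarrow> I \<subseteq> J)"
proof -
  define S where "S = lead_mon ` (I - {0})"
  have "keys m \<subseteq> V" if "m \<in> S" for m
    using that I(1) lead_mon_keys by (auto simp: S_def)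
  from dickson_basis[OF V this]
  obtain F where F: "finite F" "F \<subseteq> S" "\<And>m. m \<in> S \<Longrightarrow> \<exists>f\<in>F. \<exists>c. m = f + c" by metis
  have "\<forall>f\<in>F. \<exists>g. g \<in> I \<and> g \<noteq> 0 \<and> lead_mon g = f" using F(2) by (auto simp: S_def)
  then obtain g where g: "\<And>f. f \<in> F \<Longrightarrow> g f \<in> I \<and> g f \<noteq> 0 \<and> lead_mon (g f) = f" by metis
  have main: "I \<subseteq> J" if J: "0 \<in> J" "\<And>p q. p \<in> J \<Longrightarrow> q \<in> J \<Longrightarrow> p + q \<in> J"
    "\<And>p a. p \<in> J \<Longrightarrow> a \<in> Pol V \<Longrightarrow> a * p \<in> J" "g ` F \<subseteq> J" for J
  proof -
    have "p \<in> I \<longrightarrow> p \<in> J" for p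
    proof (induction p rule: wf_induct_rule[OF wf_inv_image[OF wf_monomials[OF V], of lead_mon]])
      case (1 p)
      show ?case
      proof (cases "p = 0")
        case False
        show ?thesis
        proof
          assume p: "p \<in> I"
          then have "lead_mon p \<in> S" using False by (simp add: S_def)
          then obtain f c where f: "f \<in> F" "lead_mon p = f + c" using F(3) by blast
          have lg: "lead_mon p = lead_mon (g f) + c" "g f \<noteq> 0" "g f \<in> I" using f g by auto
          have "keys c \<subseteq> V"
            using f(2) lead_mon_keys[of p V] I(1) p False by (auto simp: keys_nat_add)
          then have t: "single c a \<in> Pol V" for a :: 'k by (rule Pol_single)
          define p' where "p' = single 0 1 * p - single c (lead_co p * (1 / lead_co (g f))) * g f"
          have p'I: "p' \<in> I"
            unfolding p'_def using p lg(3) t I(2,3) by simp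
          have "p' \<in> J"
          proof (cases "p' = 0")
            case p': False
            have "lead_mon p' < lead_mon p"
              using False lg p' by (intro reduce_lead_mon[of p "g f" c 1 "1 / lead_co (g f)" p']) (simp_all add: p'_def)
            then have "(p', p) \<in> inv_image {(a, b). keys a \<subseteq> V \<and> keys b \<subseteq> V \<and> a < b} lead_mon"
              using lead_mon_keys[of p V] lead_mon_keys[of p' V] I(1) p p'I False p' by auto
            from "1.IH"[OF this] p'I show ?thesis by blast
          qed (use J(1) in simp)
          moreover have "single c (lead_co p * (1 / lead_co (g f))) * g f \<in> J"
            using J(3,4) f(1) t by blast
          ultimately have "p' + single c (lead_co p * (1 / lead_co (g f))) * g f \<in> J" by (rule J(2))
          then show "p \<in> J" by (simp add: p'_def)
        qed
      qed (use J(1) in simp)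
    qed
    then show ?thesis by blast
  qed
  have "finite (g ` F)" "g ` F \<subseteq> I" using F(1) g by auto
  then show ?thesis
    by (intro exI[of _ "g ` F"] conjI allI impI main) auto
qed

text \<open>Reduction modulo a Groebner basis over a domain of coefficients. By Dickson's lemma
  finitely many polynomials suffice, so the product \<open>s\<close> of their leading coefficients
  is a common denominator for all reductions.\<close>

lemma generic_normal_form:
  fixes P :: "('v::linorder, 'd::idom) mpoly set"
  assumes V: "finite V" and P: "P \<subseteq> Pol V" "0 \<in> P" "\<And>p q. p \<in> P \<Longrightarrow> q \<in> P \<Longrightarrow> p + q \<in> P"
    "\<And>p a. p \<in> P \<Longrightarrow> a \<in> Pol V \<Longrightarrow> a * p \<in> P"
  obtains s where "s \<noteq> 0"
    "\<And>f. f \<in> Pol V \<Longrightarrow> \<exists>N h. h \<in> Pol V \<and> keys h \<inter> lead_mon ` (P - {0}) = {} \<and> single 0 (s ^ N) * f - h \<in> P"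
proof -
  define S where "S = lead_mon ` (P - {0})"
  have "keys m \<subseteq> V" if "m \<in> S" for m
    using that P(1) lead_mon_keys by (auto simp: S_def)
  from dickson_basis[OF V this]
  obtain F where F: "finite F" "F \<subseteq> S" "\<And>m. m \<in> S \<Longrightarrow> \<exists>f\<in>F. \<exists>c. m = f + c" by metis
  have "\<forall>f\<in>F. \<exists>g. g \<in> P \<and> g \<noteq> 0 \<and> lead_mon g = f" using F(2) by (auto simp: S_def)
  then obtain g where g: "\<And>f. f \<in> F \<Longrightarrow> g f \<in> P \<and> g f \<noteq> 0 \<and> lead_mon (g f) = f" by metis
  define s where "s = (\<Prod>f\<in>F. lead_co (g f))"
  have "lead_co (g f) \<noteq> 0" if "f \<in> F" for f using g[OF that] lead_co_nonzero by blast
  then have "s \<noteq> 0" using F(1) by (simp add: s_def)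
  moreover have "f \<in> Pol V \<longrightarrow> (\<exists>N h. h \<in> Pol V \<and> keys h \<inter> S = {} \<and> single 0 (s ^ N) * f - h \<in> P)" for f
  proof (induction f rule: wf_induct_rule[OF wf_inv_image[OF wf_monomials[OF V], of lead_mon]])
    case (1 p)
    show ?case
    proof (intro impI)
      assume p: "p \<in> Pol V"
      have zero: "\<exists>N h. h \<in> Pol V \<and> keys h \<inter> S = {} \<and> single 0 (s ^ N) * 0 - h \<in> P"
        using P(2) by (intro exI[of _ 0]) simp
      show "\<exists>N h. h \<in> Pol V \<and> keys h \<inter> S = {} \<and> single 0 (s ^ N) * p - h \<in> P"
      proof (cases "p = 0")
        case True
        with zero show ?thesis by simp
      next
        case False
        have IH: "\<exists>N h. h \<in> Pol V \<and> keys h \<inter> S = {} \<and> single 0 (s ^ N) * p' - h \<in> P"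
          if "p' \<in> Pol V" "p' \<noteq> 0 \<Longrightarrow> lead_mon p' < lead_mon p" for p'
        proof (cases "p' = 0")
          case True
          with zero show ?thesis by simp
        next
          case p': False
          then have "(p', p) \<in> inv_image {(a, b). keys a \<subseteq> V \<and> keys b \<subseteq> V \<and> a < b} lead_mon"
            using lead_mon_keys[OF p False] lead_mon_keys[OF that(1) p'] that(2) by auto
          from "1.IH"[OF this] that(1) show ?thesis by blast
        qed
        show ?thesis
        proof (cases "lead_mon p \<in> S")
          case True
          then obtain f c where f: "f \<in> F" "lead_mon p = f + c" using F(3) by blast
          have lg: "lead_mon p = lead_mon (g f) + c" "g f \<noteq> 0" "g f \<in> P" using f g by auto
          have "keys c \<subseteq> V"
            using f(2) lead_mon_keys[OF p False] by (auto simp: keys_nat_add)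
          then have t: "single c a \<in> Pol V" for a :: 'd by (rule Pol_single)
          define s' where "s' = (\<Prod>f\<in>F - {f}. lead_co (g f))"
          have s': "s = lead_co (g f) * s'"
            using F(1) f(1) by (simp add: s_def s'_def prod.remove)
          define p' where "p' = single 0 s * p - single c (lead_co p * s') * g f"
          have "p' \<in> Pol V"
            unfolding p'_def using p t lg(3) P(1) by (intro Pol_diff Pol_mult) (auto intro: Pol_single)
          moreover have "lead_mon p' < lead_mon p" if "p' \<noteq> 0"
            using reduce_lead_mon[OF False lg(2,1) s' p'_def that] .
          ultimately obtain N h where h: "h \<in> Pol V" "keys h \<inter> S = {}" "single 0 (s ^ N) * p' - h \<in> P"
            using IH by blast
          have "single 0 (s ^ Suc N) * p - h = (single 0 (s ^ N) * p' - h) +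
              (single 0 (s ^ N) * single c (lead_co p * s')) * g f"
          proof -
            have "single 0 (s ^ Suc N) = single 0 (s ^ N) * single (0 :: 'v \<Rightarrow>\<^sub>0 nat) s"
              by (simp add: mult_single mult.commute)
            then show ?thesis by (simp add: p'_def algebra_simps)
          qed
          also have "\<dots> \<in> P"
            using h(3) lg(3) by (intro P(3,4)) (auto intro!: Pol_intros t)
          finally show ?thesis using h by blast
        next
          case S: False
          define t where "t = single (lead_mon p) (lead_co p)"
          have tV: "t \<in> Pol V" using lead_mon_keys[OF p False] by (simp add: t_def Pol_single)
          have "lead_mon (p - t) < lead_mon p" if "p - t \<noteq> 0"
            using that False by (intro lead_mon_cancel) (auto simp: t_def)
          then obtain N h where h: "h \<in> Pol V" "keys h \<inter> S = {}" "single 0 (s ^ N) * (p - t) - h \<in> P"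
            using IH[of "p - t"] Pol_diff[OF p tV] by blast
          have st: "single 0 (s ^ N) * t = single (lead_mon p) (s ^ N * lead_co p)"
            by (simp add: t_def mult_single)
          have "single 0 (s ^ N) * p - (h + single 0 (s ^ N) * t) \<in> P"
            using h(3) by (simp add: algebra_simps)
          moreover have "keys (h + single 0 (s ^ N) * t) \<inter> S = {}"
            using keys_add[of h "single 0 (s ^ N) * t"] h(2) S unfolding st by (auto split: if_splits)
          moreover have "h + single 0 (s ^ N) * t \<in> Pol V"
            using h(1) tV by (auto intro!: Pol_intros)
          ultimately show ?thesis by blast
        qed
      qed
    qed
  qed
  ultimately show ?thesis using that[of s] unfolding S_def by blast
qed

text \<open>Let \<open>h\<close> be the normal form of \<open>s ^ N * f\<close>. Then
  \<open>q * h - s ^ N\<close> lies in P, and apart from its constant term it involves only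
  monomials of \<open>h\<close>, none of which is leading in P. It is therefore a constant of P,
  hence 0, and \<open>q\<close> divides \<open>s ^ N\<close>.\<close>

lemma unit_const_dvd_power:
  fixes P :: "('v::linorder, 'd::idom) mpoly set"
  assumes V: "finite V" and P: "P \<subseteq> Pol V" "0 \<in> P" "\<And>p q. p \<in> P \<Longrightarrow> q \<in> P \<Longrightarrow> p + q \<in> P"
    "\<And>p a. p \<in> P \<Longrightarrow> a \<in> Pol V \<Longrightarrow> a * p \<in> P"
    and const: "\<And>d. single 0 d \<in> P \<Longrightarrow> d = 0"
  obtains s where "s \<noteq> 0" "\<And>q f. f \<in> Pol V \<Longrightarrow> single 0 q * f - 1 \<in> P \<Longrightarrow> \<exists>N. q dvd s ^ N"
proof -
  from generic_normal_form[OF V P]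
  obtain s where s: "s \<noteq> 0"
    "\<And>f. f \<in> Pol V \<Longrightarrow> \<exists>N h. h \<in> Pol V \<and> keys h \<inter> lead_mon ` (P - {0}) = {} \<and> single 0 (s ^ N) * f - h \<in> P"
    by metis
  have "\<exists>N. q dvd s ^ N" if f: "f \<in> Pol V" "single 0 q * f - 1 \<in> P" for q f
  proof -
    obtain N h where h: "h \<in> Pol V" "keys h \<inter> lead_mon ` (P - {0}) = {}" "single 0 (s ^ N) * f - h \<in> P"
      using s(2)[OF f(1)] by blast
    define r where "r = single 0 q * h - single 0 (s ^ N)"
    have "r = (- single 0 q) * (single 0 (s ^ N) * f - h) + single 0 (s ^ N) * (single 0 q * f - 1)"
      by (simp add: r_def algebra_simps)
    also have "\<dots> \<in> P"
      using h(3) f(2) by (intro P(3,4)) (auto intro!: Pol_intros)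
    finally have rP: "r \<in> P" .
    have keys_r: "keys r \<subseteq> keys h \<union> {0}"
    proof
      fix k assume "k \<in> keys r"
      then have "k \<in> keys (single 0 q * h) \<or> k = 0"
        using keys_diff[of "single 0 q * h" "single 0 (s ^ N)"] by (auto simp: r_def split: if_splits)
      then show "k \<in> keys h \<union> {0}"
        using keys_single_mult[of k 0 q h] by auto
    qed
    have "r = 0"
    proof (rule ccontr)
      assume "r \<noteq> 0"
      then have "lead_mon r \<notin> keys h" "lead_mon r \<in> keys r"
        using rP h(2) lead_mon_in_keys by auto
      then have lead: "lead_mon r = 0" using keys_r by blast
      have "keys r \<subseteq> {0}"
        using lead_mon_ge[of _ r] unfolding lead using monomial_ge_0 by (auto intro: antisym)
      then have "single 0 (lookup r 0) = r"
        using sum_single_lookup[of "{0}" r] by simp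
      then have "lookup r 0 = 0" using const rP by metis
      then show False using \<open>lead_mon r \<in> keys r\<close> lead by (simp add: in_keys_iff)
    qed
    then have "lookup (single 0 q * h) 0 = s ^ N" by (simp add: r_def)
    moreover have "lookup (single 0 q * h) 0 = q * lookup h 0"
      using lookup_single_mult[of 0 q h 0] by simp
    ultimately show ?thesis by (metis dvd_triv_left)
  qed
  with s(1) show ?thesis using that by blast
qed

section \<open>Univariate polynomials and the Nullstellensatz\<close>

lemma var_poly_power: "var_poly v ^ n = single (single v n) (1 :: 'k::field)"
  by (induction n) (auto simp: var_poly_def mult_single simp flip: single_add)

lemma prod_single: "(\<Prod>v\<in>A. single (f v) (1 :: 'k::field)) = single (\<Sum>v\<in>A. f v) 1"
  for f :: "_ \<Rightarrow> 'v \<Rightarrow>\<^sub>0 nat"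
  by (induction A rule: infinite_finite_induct) (auto simp: mult_single)

lemma mon_eval_var_poly: "mon_eval var_poly m = single m (1 :: 'k::field)"
proof -
  have "mon_eval var_poly m = single (\<Sum>v\<in>keys m. single v (lookup m v)) (1 :: 'k)"
    unfolding mon_eval_def by (simp add: var_poly_power prod_single)
  also have "(\<Sum>v\<in>keys m. single v (lookup m v)) = m"
    by (rule sum_single_lookup) auto
  finally show ?thesis .
qed

definition upoly_eval :: "'k mpol \<Rightarrow> 'k::field poly \<Rightarrow> 'k mpol" where
  "upoly_eval \<theta> f = (\<Sum>i\<le>degree f. const_poly (coeff f i) * \<theta> ^ i)"

lemma upoly_eval_superset: "degree f \<le> n \<Longrightarrow> upoly_eval \<theta> f = (\<Sum>i\<le>n. const_poly (coeff f i) * \<theta> ^ i)"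
  unfolding upoly_eval_def by (rule sum.mono_neutral_left) (auto simp: coeff_eq_0)

lemma upoly_eval_pCons: "upoly_eval \<theta> (pCons a p) = const_poly a + \<theta> * upoly_eval \<theta> p"
proof -
  have "upoly_eval \<theta> (pCons a p) = (\<Sum>i\<le>Suc (degree p). const_poly (coeff (pCons a p) i) * \<theta> ^ i)"
    by (rule upoly_eval_superset) (rule degree_pCons_le)
  also have "\<dots> = const_poly a + \<theta> * upoly_eval \<theta> p"
    by (simp add: sum.atMost_Suc_shift upoly_eval_def sum_distrib_left mult_ac del: sum.atMost_Suc)
  finally show ?thesis .
qed

lemma upoly_eval_const [simp]: "upoly_eval \<theta> [:c:] = const_poly c"
  by (simp add: upoly_eval_def)

lemma upoly_eval_add: "upoly_eval \<theta> (p + q) = upoly_eval \<theta> p + upoly_eval \<theta> q"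
proof -
  let ?n = "max (degree p) (degree q)"
  have "upoly_eval \<theta> r = (\<Sum>i\<le>?n. const_poly (coeff r i) * \<theta> ^ i)" if "r \<in> {p, q, p + q}" for r
    using that degree_add_le_max[of p q] by (intro upoly_eval_superset) auto
  then show ?thesis
    by (simp add: const_poly.hom_add distrib_right sum.distrib)
qed

lemma upoly_eval_smult: "upoly_eval \<theta> (smult c p) = const_poly c * upoly_eval \<theta> p"
  using upoly_eval_superset[of "smult c p" "degree p" \<theta>]
  by (simp add: upoly_eval_def const_poly.hom_mult sum_distrib_left mult_ac)

interpretation upoly_eval: comm_ring_hom "upoly_eval \<theta> :: 'k::field poly \<Rightarrow> 'k mpol" for \<theta>
proof
  show "upoly_eval \<theta> (p * q) = upoly_eval \<theta> p * upoly_eval \<theta> q" for p q :: "'k poly"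
    by (induction p) (auto simp: upoly_eval_add upoly_eval_smult upoly_eval_pCons algebra_simps upoly_eval_const[of _ 0, simplified])
qed (auto simp: upoly_eval_add upoly_eval_const[of _ 0, simplified] upoly_eval_const[of _ 1, unfolded one_pCons[symmetric]])

lemma upoly_eval_in_Pol: "\<theta> \<in> Pol V \<Longrightarrow> upoly_eval \<theta> f \<in> Pol V"
  unfolding upoly_eval_def by (intro Pol_sum Pol_mult Pol_power) auto

text \<open>
  The Nullstellensatz in the form: the residue field of a maximal ideal is algebraic over \<open>k\<close>. If
  \<open>\<theta>\<close> were transcendental modulo \<open>P\<close>, then \<open>1 + \<theta> s(\<theta>)\<close> would be invertible modulo \<open>P\<close>, although
  no power of \<open>s\<close> is divisible by \<open>1 + Y s\<close>.
\<close>

lemma maximal_ideal_algebraic: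
  fixes P :: "'k::field mpol set"
  assumes V: "finite V" and P: "P \<subseteq> Pol V" "0 \<in> P" "\<And>p q. p \<in> P \<Longrightarrow> q \<in> P \<Longrightarrow> p + q \<in> P"
    "\<And>p a. p \<in> P \<Longrightarrow> a \<in> Pol V \<Longrightarrow> a * p \<in> P"
    and max: "\<And>q. q \<in> Pol V \<Longrightarrow> q \<notin> P \<Longrightarrow> \<exists>f\<in>Pol V. q * f - 1 \<in> P"
    and \<theta>: "\<theta> \<in> Pol V"
  shows "\<exists>f. f \<noteq> 0 \<and> upoly_eval \<theta> f \<in> P"
proof (rule ccontr)
  assume no: "\<nexists>f. f \<noteq> 0 \<and> upoly_eval \<theta> f \<in> P"
  \<comment> \<open>The coefficient ring \<open>'k poly\<close> is k[Y], and \<rho> sends Y to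
    \<theta>. That \<theta> is transcendental modulo P then means that the preimage
    \<open>P'\<close> of P contains no nonzero constant from k[Y].\<close>
  define \<rho> where "\<rho> = eval_mpoly (upoly_eval \<theta>) (var_poly :: indet \<Rightarrow> 'k mpol)"
  interpret \<rho>: comm_ring_hom \<rho>
    unfolding \<rho>_def by (rule upoly_eval.comm_ring_hom_eval_mpoly)
  have \<rho>_single: "\<rho> (single m d) = upoly_eval \<theta> d * mon_eval var_poly m" for m d
    by (simp add: \<rho>_def)
  note me = mon_eval_var_poly[where 'k = 'k]
  have \<rho>_Pol: "\<rho> F \<in> Pol V" if "F \<in> Pol V" for F
    using that by (induction F rule: Pol_induct)
      (auto simp: \<rho>_single me \<rho>.hom_add intro!: Pol_add Pol_mult Pol_single upoly_eval_in_Pol[OF \<theta>])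
  have lift: "\<exists>F\<in>Pol V. \<rho> F = f" if "f \<in> Pol V" for f
    using that
  proof (induction f rule: Pol_induct)
    case (single m c)
    then show ?case
      by (intro bexI[of _ "single m [:c:]"]) (auto simp: \<rho>_single me const_poly_def mult_single intro: Pol_single)
  next
    case (add p q)
    then obtain F G where "F \<in> Pol V" "G \<in> Pol V" "\<rho> F = p" "\<rho> G = q" by blast
    then show ?case by (intro bexI[of _ "F + G"]) (auto simp: \<rho>.hom_add intro: Pol_add)
  qed
  define P' where "P' = {F \<in> Pol V. \<rho> F \<in> P}"
  have P': "P' \<subseteq> Pol V" "0 \<in> P'" "\<And>p q. p \<in> P' \<Longrightarrow> q \<in> P' \<Longrightarrow> p + q \<in> P'"
    "\<And>p a. p \<in> P' \<Longrightarrow> a \<in> Pol V \<Longrightarrow> a * p \<in> P'"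
    using P \<rho>_Pol by (auto simp: P'_def \<rho>.hom_add \<rho>.hom_mult intro: Pol_add Pol_mult)
  have "d = 0" if "single 0 d \<in> P'" for d
    using that no by (auto simp: P'_def \<rho>_single)
  from unit_const_dvd_power[OF V P' this]
  obtain s where s: "s \<noteq> 0" "\<And>q f. f \<in> Pol V \<Longrightarrow> single 0 q * f - 1 \<in> P' \<Longrightarrow> \<exists>N. q dvd s ^ N"
    by metis
  define q where "q = 1 + [:0, 1:] * s"
  have deg: "degree q \<noteq> 0"
  proof -
    have "degree ([:0, 1:] * s) = Suc (degree s)" using s(1) by (simp add: degree_mult_eq)
    then have "degree q = Suc (degree s)"
      unfolding q_def by (subst degree_add_eq_right) auto
    then show ?thesis by simp
  qed
  then have "q \<noteq> 0" by auto
  then have "upoly_eval \<theta> q \<notin> P" using no by blast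
  then obtain f where f: "f \<in> Pol V" "upoly_eval \<theta> q * f - 1 \<in> P"
    using max upoly_eval_in_Pol[OF \<theta>] by blast
  obtain F where F: "F \<in> Pol V" "\<rho> F = f" using lift[OF f(1)] by blast
  have "single 0 q * F - 1 \<in> P'"
    using F f(2) by (auto simp: P'_def \<rho>.hom_minus \<rho>.hom_mult \<rho>_single intro!: Pol_diff Pol_mult Pol_single)
  then obtain N where N: "q dvd s ^ N" using s(2) F(1) by blast
  \<comment> \<open>Since \<open>q - Y s = 1\<close>, the polynomial \<open>q\<close> is coprime to
    every power of \<open>s\<close>; dividing one of them, it would be a unit.\<close>
  have cop: "\<exists>a b. a * q + b * s ^ N = 1"
  proof (induction N)
    case (Suc N)
    then obtain a b where ab: "a * q + b * s ^ N = 1" by blast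
    have "1 = q - [:0, 1:] * s" by (simp add: q_def)
    then have "a * q + b * s ^ N * (q - [:0, 1:] * s) = 1" using ab by simp
    then have "(a + b * s ^ N) * q + (- (b * [:0, 1:])) * s ^ Suc N = 1"
      by (simp add: algebra_simps)
    then show ?case by blast
  qed (auto intro: exI[of _ 0] exI[of _ 1])
  then have "q dvd 1" using N by (metis dvd_add dvd_mult dvd_refl)
  then show False using deg by (simp add: is_unit_iff_degree \<open>q \<noteq> 0\<close>)
qed

section \<open>Algebraic dependence and chains of primes\<close>

definition box :: "'v set \<Rightarrow> nat \<Rightarrow> ('v \<Rightarrow>\<^sub>0 nat) set" where
  "box V M = {m. keys m \<subseteq> V \<and> (\<forall>v. lookup m v \<le> M)}"

lemma bij_betw_box:
  assumes "finite V"
  shows "bij_betw (\<lambda>m. restrict (lookup m) V) (box V M) (V \<rightarrow>\<^sub>E {..M})"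
proof (rule bij_betw_byWitness[where f' = "\<lambda>h. Abs_poly_mapping (\<lambda>v. if v \<in> V then h v else 0)"])
  have lk: "lookup (Abs_poly_mapping (\<lambda>v. if v \<in> V then h v else 0)) = (\<lambda>v. if v \<in> V then h v else 0)" for h :: "'a \<Rightarrow> nat"
    using assms by (intro lookup_Abs_poly_mapping) (rule finite_subset[of _ V], auto)
  show "\<forall>m\<in>box V M. Abs_poly_mapping (\<lambda>v. if v \<in> V then restrict (lookup m) V v else 0) = m"
  proof
    fix m :: "'a \<Rightarrow>\<^sub>0 nat" assume "m \<in> box V M"
    then have "lookup m v = 0" if "v \<notin> V" for v using that by (auto simp: box_def in_keys_iff)
    then show "Abs_poly_mapping (\<lambda>v. if v \<in> V then restrict (lookup m) V v else 0) = m"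
      by (intro poly_mapping_eqI) (auto simp: lk)
  qed
  show "\<forall>h\<in>V \<rightarrow>\<^sub>E {..M}. restrict (lookup (Abs_poly_mapping (\<lambda>v. if v \<in> V then h v else 0))) V = h"
    by (auto simp: lk fun_eq_iff PiE_def extensional_def)
  show "(\<lambda>m. restrict (lookup m) V) ` box V M \<subseteq> V \<rightarrow>\<^sub>E {..M}"
    by (auto simp: box_def)
  show "(\<lambda>h. Abs_poly_mapping (\<lambda>v. if v \<in> V then h v else 0)) ` (V \<rightarrow>\<^sub>E {..M}) \<subseteq> box V M"
    by (auto simp: box_def lk in_keys_iff split: if_splits)
qed

lemma finite_box: "finite V \<Longrightarrow> finite (box V M)"
  using bij_betw_finite[OF bij_betw_box, of V M] by (simp add: finite_PiE)

lemma card_box: "finite V \<Longrightarrow> card (box V M) = Suc M ^ card V"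
  using bij_betw_same_card[OF bij_betw_box, of V M] by (simp add: card_PiE)

text \<open>Bounding each exponent separately, instead of the total degree, makes the number of
  monomials a pure power (\<open>card_box\<close>), and the estimates below reduce to comparing
  powers.\<close>

definition exps_le :: "nat \<Rightarrow> ('v, 'a::zero) mpoly \<Rightarrow> bool" where
  "exps_le M p \<longleftrightarrow> (\<forall>m\<in>keys p. \<forall>v. lookup m v \<le> M)"

lemma exps_le_1 [simp]: "exps_le M (1 :: ('v, 'a::comm_ring_1) mpoly)"
  unfolding exps_le_def by simp

lemma exps_le_mult: "exps_le M p \<Longrightarrow> exps_le N q \<Longrightarrow> exps_le (M + N) (p * q)"
  for p q :: "('v, 'a::comm_ring_1) mpoly"
  unfolding exps_le_def using keys_mult[of p q] by (fastforce simp: lookup_add intro: add_mono)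

lemma exps_le_power: "exps_le M p \<Longrightarrow> exps_le (n * M) (p ^ n)" for p :: "('v, 'a::comm_ring_1) mpoly"
  by (induction n) (auto intro: exps_le_mult)

lemma exps_le_prod:
  fixes f :: "'i \<Rightarrow> ('v, 'a::comm_ring_1) mpoly"
  assumes "finite A" "\<And>i. i \<in> A \<Longrightarrow> exps_le M (f i)"
  shows "exps_le (card A * M) (prod f A)"
  using assms by (induction A rule: finite_induct) (auto intro!: exps_le_mult)

lemma exps_le_mono: "exps_le M p \<Longrightarrow> M \<le> N \<Longrightarrow> exps_le N p"
  unfolding exps_le_def using order_trans by blast

lemma exps_le_exists: "\<exists>M. exps_le M p"
proof -
  have "finite (\<Union>m\<in>keys p. lookup m ` keys m)" by simp
  then obtain M where M: "\<forall>k\<in>(\<Union>m\<in>keys p. lookup m ` keys m). k \<le> M"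
    unfolding finite_nat_set_iff_bounded_le by (elim exE)
  have "lookup m v \<le> M" if "m \<in> keys p" for m v
    using M that by (cases "v \<in> keys m") (blast, simp add: in_keys_iff)
  then show ?thesis unfolding exps_le_def by blast
qed

lemma in_span_monomials:
  assumes "finite A" "keys p \<subseteq> A"
  shows "p \<in> mp.span ((\<lambda>m. single m 1) ` A)"
proof -
  have "p = (\<Sum>m\<in>A. const_poly (lookup p m) * single m 1)"
    using sum_single_lookup[OF assms] by (simp add: single_eq_const_mult[symmetric])
  also have "\<dots> \<in> mp.span ((\<lambda>m. single m 1) ` A)"
    by (intro mp.span_sum mp.span_scale mp.span_base) auto
  finally show ?thesis .
qed

text \<open>There are about M^N monomials in the N elements with exponents up to M, but their values
  lie in a space whose dimension grows only like M to the power \<open>card W\<close>.\<close>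

lemma algebraically_dependent:
  fixes g :: "nat \<Rightarrow> 'k::field mpol"
  assumes W: "finite W" and N: "card W < N" and g: "\<And>i. i < N \<Longrightarrow> g i \<in> Pol W"
  shows "\<exists>A c. finite A \<and> A \<noteq> {} \<and> (\<forall>m\<in>A. keys m \<subseteq> {..<N} \<and> c m \<noteq> 0) \<and>
    (\<Sum>m\<in>A. const_poly (c m) * mon_eval g m) = 0"
proof -
  have "\<forall>i. \<exists>M. exps_le M (g i)" using exps_le_exists by blast
  then obtain Mf where Mf: "\<And>i. exps_le (Mf i) (g i)" by metis
  \<comment> \<open>Values of monomials with exponents up to M have exponents up to D M. As D \<ge>
    1, one has D M + 1 \<le> D (M + 1), and M = D^(card W) makes (D (M + 1))^(card W) equal to M (M
    + 1)^(card W), just below (M + 1)^(card W + 1).\<close>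
  define D where "D = Suc (N * (\<Sum>i<N. Mf i))"
  define M where "M = D ^ card W"
  define E where "E = box {..<N} M"
  have finE: "finite E" and cardE: "card E = Suc M ^ N"
    unfolding E_def by (auto simp: finite_box card_box)
  have img: "mon_eval g m \<in> mp.span ((\<lambda>m. single m 1) ` box W (D * M))" if m: "m \<in> E" for m
  proof (rule in_span_monomials[OF finite_box[OF W]])
    have eq: "mon_eval g m = (\<Prod>i<N. g i ^ lookup m i)"
      using m by (intro mon_eval_superset) (auto simp: E_def box_def)
    have le: "exps_le (M * (\<Sum>i<N. Mf i)) (g i ^ lookup m i)" if "i < N" for i
    proof (rule exps_le_mono[OF exps_le_power[OF Mf]])
      have "Mf i \<le> (\<Sum>i<N. Mf i)" using that by (intro member_le_sum) auto
      then show "lookup m i * Mf i \<le> M * (\<Sum>i<N. Mf i)"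
        using m by (intro mult_le_mono) (auto simp: E_def box_def)
    qed
    have "exps_le (card {..<N} * (M * (\<Sum>i<N. Mf i))) (mon_eval g m)"
      unfolding eq using le by (intro exps_le_prod) auto
    then have "exps_le (D * M) (mon_eval g m)"
      by (rule exps_le_mono) (simp add: D_def mult_ac)
    moreover have "mon_eval g m \<in> Pol W"
      unfolding eq by (intro Pol_prod Pol_power g) auto
    ultimately show "keys (mon_eval g m) \<subseteq> box W (D * M)"
      by (auto simp: box_def exps_le_def Pol_def)
  qed
  have inE: "keys m \<subseteq> {..<N}" if "m \<in> E" for m using that by (auto simp: E_def box_def)
  show ?thesis
  proof (cases "inj_on (mon_eval g) E")
    \<comment> \<open>Two monomials with the same value already give a relation; they have to be
      treated apart because they would coincide in the image of E.\<close>
    case False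
    then obtain a b where ab: "a \<in> E" "b \<in> E" "a \<noteq> b" "mon_eval g a = mon_eval g b"
      by (auto simp: inj_on_def)
    show ?thesis
      using ab inE
      by (intro exI[of _ "{a, b}"] exI[of _ "\<lambda>m. if m = a then 1 else - 1"]) (auto simp: const_poly.hom_uminus)
  next
    case inj: True
    let ?T = "(\<lambda>m. single m (1 :: 'k)) ` box W (D * M)"
    have "card ?T \<le> Suc (D * M) ^ card W"
      using card_image_le[OF finite_box[OF W]] card_box[OF W] by metis
    also have "\<dots> \<le> (D * Suc M) ^ card W"
      by (intro power_mono) (auto simp: D_def)
    also have "\<dots> = M * Suc M ^ card W" by (simp only: M_def power_mult_distrib)
    also have "\<dots> < Suc M * Suc M ^ card W" by simp
    also have "\<dots> = Suc M ^ Suc (card W)" by simp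
    also have "\<dots> \<le> Suc M ^ N" using N by (intro power_increasing) auto
    also have "\<dots> = card (mon_eval g ` E)" using card_image[OF inj] cardE by simp
    finally have "card ?T < card (mon_eval g ` E)" .
    then have "mp.dependent (mon_eval g ` E)"
      using mp.independent_span_bound[of ?T "mon_eval g ` E"] finite_box[OF W] img by fastforce
    then obtain t u where tu: "finite t" "t \<subseteq> mon_eval g ` E" "(\<Sum>v\<in>t. const_poly (u v) * v) = 0" "\<exists>v\<in>t. u v \<noteq> 0"
      unfolding mp.dependent_explicit by blast
    define A where "A = {m \<in> E. mon_eval g m \<in> t \<and> u (mon_eval g m) \<noteq> 0}"
    have "(\<Sum>m\<in>A. const_poly (u (mon_eval g m)) * mon_eval g m) = (\<Sum>v\<in>mon_eval g ` A. const_poly (u v) * v)"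
      using inj by (subst sum.reindex) (auto simp: A_def inj_on_def)
    also have "\<dots> = (\<Sum>v\<in>t. const_poly (u v) * v)"
      by (rule sum.mono_neutral_left) (use tu in \<open>auto simp: A_def\<close>)
    finally have "(\<Sum>m\<in>A. const_poly (u (mon_eval g m)) * mon_eval g m) = 0" using tu(3) by simp
    moreover have "finite A" using finE by (simp add: A_def)
    moreover have "A \<noteq> {}" using tu(2,4) by (auto simp: A_def)
    ultimately show ?thesis
      using inE by (intro exI[of _ A] exI[of _ "\<lambda>m. u (mon_eval g m)"]) (auto simp: A_def)
  qed
qed

section \<open>Relations along chains of primes\<close>

definition prime_set :: "'v set \<Rightarrow> ('v, 'k::comm_ring_1) mpoly set \<Rightarrow> bool" where
  "prime_set V Q \<longleftrightarrow> Q \<subseteq> Pol V \<and> 0 \<in> Q \<and> (\<forall>p\<in>Q. \<forall>q\<in>Q. p + q \<in> Q) \<and> (\<forall>p\<in>Q. \<forall>a\<in>Pol V. a * p \<in> Q) \<and>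
    1 \<notin> Q \<and> (\<forall>a\<in>Pol V. \<forall>b\<in>Pol V. a * b \<in> Q \<longrightarrow> a \<in> Q \<or> b \<in> Q)"

lemma prime_setD:
  assumes "prime_set V Q"
  shows "Q \<subseteq> Pol V" "0 \<in> Q" "\<And>p q. p \<in> Q \<Longrightarrow> q \<in> Q \<Longrightarrow> p + q \<in> Q"
    "\<And>p a. p \<in> Q \<Longrightarrow> a \<in> Pol V \<Longrightarrow> a * p \<in> Q" "1 \<notin> Q"
    "\<And>a b. a \<in> Pol V \<Longrightarrow> b \<in> Pol V \<Longrightarrow> a * b \<in> Q \<Longrightarrow> a \<in> Q \<or> b \<in> Q"
  using assms unfolding prime_set_def by blast+

lemma prime_set_sum:
  assumes "prime_set V Q" "\<And>i. i \<in> A \<Longrightarrow> f i \<in> Q"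
  shows "sum f A \<in> Q"
  using assms(2) by (induction A rule: infinite_finite_induct) (auto intro: prime_setD[OF assms(1)])

lemma prime_set_power:
  assumes "prime_set V Q" "x \<in> Pol V" "x ^ n * b \<in> Q" "b \<in> Pol V" "x \<notin> Q"
  shows "b \<in> Q"
  using assms(3)
proof (induction n)
  case (Suc n)
  then have "x * (x ^ n * b) \<in> Q" by (simp add: mult_ac)
  then show ?case
    using Suc.IH prime_setD(6)[OF assms(1,2), of "x ^ n * b"] assms(2,4,5) Pol_mult Pol_power by blast
qed simp

lemma mon_eval_in_Pol: "(\<And>v. v \<in> keys m \<Longrightarrow> x v \<in> Pol V) \<Longrightarrow> mon_eval x m \<in> Pol V"
  for x :: "_ \<Rightarrow> ('v, 'a::comm_ring_1) mpoly"
  unfolding mon_eval_def by (intro Pol_prod Pol_power)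

text \<open>
  A relation between \<open>x\<^sub>0, \<dots>, x\<^sub>N\<^sub>-\<^sub>1\<close> modulo \<open>Q\<^sub>0\<close> descends along the chain: one cancels the common
  power of \<open>x\<^sub>j \<notin> Q\<^sub>j\<close> and drops the terms divisible by \<open>x\<^sub>j \<in> Q\<^sub>j\<^sub>+\<^sub>1\<close>. What remains at the end
  is a nonzero constant.
\<close>

lemma no_prime_chain_of_relation:
  fixes Q :: "nat \<Rightarrow> 'k::field mpol set"
  assumes Q: "\<And>i. i \<le> N \<Longrightarrow> prime_set V (Q i)" "\<And>i. i < N \<Longrightarrow> Q i \<subseteq> Q (Suc i)"
    and x: "\<And>i. i < N \<Longrightarrow> x i \<in> Q (Suc i)" "\<And>i. i < N \<Longrightarrow> x i \<notin> Q i"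
    and A: "finite A" "A \<noteq> {}" "\<And>m. m \<in> A \<Longrightarrow> keys m \<subseteq> {..<N}" "\<And>m. m \<in> A \<Longrightarrow> c m \<noteq> 0"
    "(\<Sum>m\<in>A. const_poly (c m) * mon_eval x m) \<in> Q 0"
  shows False
proof -
  have xV: "x i \<in> Pol V" if "i < N" for i
    using x(1)[OF that] prime_setD(1)[OF Q(1), of "Suc i"] that by auto
  have "\<exists>A c. finite A \<and> A \<noteq> {} \<and> (\<forall>m\<in>A. keys m \<subseteq> {j..<N} \<and> c m \<noteq> 0) \<and>
    (\<Sum>m\<in>A. const_poly (c m) * mon_eval x m) \<in> Q j" if "j \<le> N" for j
    using that
  proof (induction j)
    case 0
    have "(\<forall>m\<in>A. keys m \<subseteq> {0..<N} \<and> c m \<noteq> 0)" using A(3,4) by (simp add: lessThan_atLeast0)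
    then show ?case using A(1,2,5) by blast
  next
    case (Suc j)
    then have "\<exists>A c. finite A \<and> A \<noteq> {} \<and> (\<forall>m\<in>A. keys m \<subseteq> {j..<N} \<and> c m \<noteq> 0) \<and>
      (\<Sum>m\<in>A. const_poly (c m) * mon_eval x m) \<in> Q j" by simp
    then obtain A c where A: "finite A" "A \<noteq> {}" "\<forall>m\<in>A. keys m \<subseteq> {j..<N} \<and> c m \<noteq> 0"
      "(\<Sum>m\<in>A. const_poly (c m) * mon_eval x m) \<in> Q j" by (elim exE conjE)
    have j: "j < N" using Suc.prems by simp
    define e where "e = Min ((\<lambda>m. lookup m j) ` A)"
    have e: "e \<le> lookup m j" if "m \<in> A" for m
      unfolding e_def using A(1) that by simp
    have "e \<in> (\<lambda>m. lookup m j) ` A" unfolding e_def using A(1,2) by (intro Min_in) auto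
    then obtain m0 where m0: "m0 \<in> A" "lookup m0 j = e" by auto
    define r where "r m = m - single j e" for m
    have r: "m = single j e + r m" if "m \<in> A" for m
      unfolding r_def using e[OF that] by (intro monomial_eq_add_diff) (auto simp: lookup_single when_def)
    have kr: "keys (r m) \<subseteq> {j..<N}" if "m \<in> A" for m
      using r[OF that] A(3) that keys_nat_add[of "single j e" "r m"] by (metis Un_subset_iff)
    define h where "h m = const_poly (c m) * mon_eval x (r m)" for m
    have hV: "h m \<in> Pol V" if "m \<in> A" for m
      unfolding h_def using kr[OF that] xV by (intro Pol_mult mon_eval_in_Pol) auto
    have "(\<Sum>m\<in>A. const_poly (c m) * mon_eval x m) = x j ^ e * (\<Sum>m\<in>A. h m)"
    proof -
      have "const_poly (c m) * mon_eval x m = x j ^ e * h m" if "m \<in> A" for m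
        using r[OF that] mon_eval_add[of x "single j e" "r m"] by (simp add: h_def mult_ac)
      then show ?thesis by (simp add: sum_distrib_left)
    qed
    then have "(\<Sum>m\<in>A. h m) \<in> Q j"
      using A(4) prime_set_power[OF Q(1)[of j] xV[OF j], of e "\<Sum>m\<in>A. h m"] x(2)[OF j] hV Pol_sum j by auto
    then have "(\<Sum>m\<in>A. h m) \<in> Q (Suc j)" using Q(2)[OF j] by blast
    have pQ: "prime_set V (Q (Suc j))" using Q(1) j by simp
    define A' where "A' = {m \<in> A. lookup m j = e}"
    have minus: "- h m \<in> Q (Suc j)" if m: "m \<in> A - A'" for m
    proof -
      have "lookup (r m) j \<noteq> 0" using m e[of m] by (auto simp: A'_def r_def lookup_minus)
      then have "lookup (single j 1) v \<le> lookup (r m) v" for v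
        by (auto simp: lookup_single when_def)
      then have eq: "r m = single j 1 + (r m - single j 1)" by (rule monomial_eq_add_diff)
      have "keys (r m - single j 1) \<subseteq> {j..<N}"
        using kr[of m] m eq keys_nat_add[of "single j 1" "r m - single j 1"] by (metis DiffD1 Un_subset_iff)
      then have "- (const_poly (c m) * mon_eval x (r m - single j 1)) \<in> Pol V"
        using xV by (intro Pol_uminus Pol_mult mon_eval_in_Pol) auto
      moreover have "h m = const_poly (c m) * mon_eval x (r m - single j 1) * x j"
        unfolding h_def by (subst eq) (simp add: mon_eval_add mult_ac del: One_nat_def)
      ultimately show ?thesis
        using prime_setD(4)[OF pQ x(1)[OF j], of "- (const_poly (c m) * mon_eval x (r m - single j 1))"] by simp
    qed
    have "(\<Sum>m\<in>A - A'. - h m) \<in> Q (Suc j)" by (rule prime_set_sum[OF pQ minus])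
    then have "(\<Sum>m\<in>A. h m) + (\<Sum>m\<in>A - A'. - h m) \<in> Q (Suc j)"
      using \<open>(\<Sum>m\<in>A. h m) \<in> Q (Suc j)\<close> by (intro prime_setD(3)[OF pQ])
    moreover have "(\<Sum>m\<in>A. h m) + (\<Sum>m\<in>A - A'. - h m) = (\<Sum>m\<in>A'. h m)"
      using sum.subset_diff[of A' A h] A(1) by (simp add: A'_def sum_negf)
    \<comment> \<open>No two terms merge after the division by the power of \<open>x j\<close>, so
      all coefficients remain nonzero.\<close>
    moreover have inj: "inj_on r A'"
    proof (rule inj_onI)
      fix m m' assume mm: "m \<in> A'" "m' \<in> A'" "r m = r m'"
      have "m = single j e + r m" using mm(1) by (intro r) (simp add: A'_def)
      also have "\<dots> = single j e + r m'" by (simp only: mm(3))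
      also have "\<dots> = m'" using mm(2) by (intro r[symmetric]) (simp add: A'_def)
      finally show "m = m'" .
    qed
    have "(\<Sum>m\<in>A'. h m) = (\<Sum>m\<in>r ` A'. const_poly (c (single j e + m)) * mon_eval x m)"
      unfolding sum.reindex[OF inj] using r by (intro sum.cong) (auto simp: h_def A'_def)
    ultimately have "(\<Sum>m\<in>r ` A'. const_poly (c (single j e + m)) * mon_eval x m) \<in> Q (Suc j)" by simp
    moreover have "keys m \<subseteq> {Suc j..<N}" "c (single j e + m) \<noteq> 0" if m: "m \<in> r ` A'" for m
    proof -
      obtain m' where m': "m = r m'" "m' \<in> A" "lookup m' j = e" using m unfolding A'_def by blast
      then have "lookup m j = 0" by (simp add: r_def lookup_minus)
      then have "j \<notin> keys m" by (simp add: in_keys_iff)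
      then show "keys m \<subseteq> {Suc j..<N}" using kr[of m'] m' by (auto simp: subset_iff Suc_le_eq order_le_less)
      show "c (single j e + m) \<noteq> 0" using m' A(3) r by metis
    qed
    ultimately show ?case
      using A(1) m0 by (intro exI[of _ "r ` A'"] exI[of _ "\<lambda>m. c (single j e + m)"]) (auto simp: A'_def)
  qed
  from this[of N] obtain A c where A: "finite A" "A \<noteq> {}" "\<forall>m\<in>A. keys m \<subseteq> {N..<N} \<and> c m \<noteq> 0"
    "(\<Sum>m\<in>A. const_poly (c m) * mon_eval x m) \<in> Q N" by blast
  \<comment> \<open>No variables are left, so the relation has become a nonzero constant, that is, a
    unit in \<open>Q N\<close>.\<close>
  have "\<forall>m\<in>A. m = 0" using A(3) by auto
  then have "A = {0}" using A(2) by auto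
  then have "const_poly (c 0) \<in> Q N" "c 0 \<noteq> 0" using A(3,4) by auto
  then have "const_poly (inverse (c 0)) * const_poly (c 0) \<in> Q N"
    using prime_setD(4)[OF Q(1)[of N]] by simp
  then have "1 \<in> Q N" using \<open>c 0 \<noteq> 0\<close> by (simp flip: const_poly.hom_mult)
  then show False using prime_setD(5)[OF Q(1)[of N]] by simp
qed

section \<open>Regular sequences and chains of primes\<close>

text \<open>An ideal maximal among those that contain I and avoid S is prime: if neither factor of a
  product belonged to it, adjoining either one would meet S, and the product of the two elements
  found would lie in S and in the ideal.\<close>

lemma (in noetherian_ring) prime_avoiding_exists:
  assumes "cring R" "ideal I R" "S \<subseteq> carrier R" "\<one> \<in> S" "\<And>a b. a \<in> S \<Longrightarrow> b \<in> S \<Longrightarrow> a \<otimes> b \<in> S" "I \<inter> S = {}"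
  shows "\<exists>Q. primeideal Q R \<and> I \<subseteq> Q \<and> Q \<inter> S = {}"
proof -
  interpret cring R by fact
  let ?C = "{J. ideal J R \<and> I \<subseteq> J \<and> J \<inter> S = {}}"
  \<comment> \<open>The chain condition gives the upper bounds for Zorn's lemma: the union of a
    nonempty chain of ideals is a member of the chain.\<close>
  have "\<exists>M\<in>?C. \<forall>J\<in>?C. M \<subseteq> J \<longrightarrow> J = M"
  proof (rule subset_Zorn_nonempty)
    show "?C \<noteq> {}" using assms by blast
    fix C assume C: "C \<noteq> {}" "subset.chain ?C C"
    then have "subset.chain {I. ideal I R} C" by (auto simp: subset.chain_def)
    then have "\<Union> C \<in> C" using ideal_chain_is_trivial[OF C(1)] by blast
    then show "\<Union> C \<in> ?C" using C(2) by (auto simp: subset.chain_def)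
  qed
  then obtain M where "M \<in> ?C" and M_max: "\<forall>J\<in>?C. M \<subseteq> J \<longrightarrow> J = M"
    by (elim bexE)
  then have M: "ideal M R" "I \<subseteq> M" "M \<inter> S = {}" by auto
  have max: "J = M" if "ideal J R" "M \<subseteq> J" "J \<inter> S = {}" for J
    using M_max M(2) that by blast
  interpret M: ideal M R by fact
  have meet: "\<exists>m\<in>M. \<exists>r\<in>carrier R. m \<oplus> r \<otimes> a \<in> S" if a: "a \<in> carrier R" "a \<notin> M" for a
  proof -
    have id: "ideal (M <+> PIdl a) R"
      using a(1) by (intro add_ideals cgenideal_ideal M)
    have "M \<subseteq> M <+> PIdl a"
    proof
      fix m assume "m \<in> M"
      moreover have "\<zero> \<in> PIdl a" using a(1) by (intro additive_subgroup.zero_closed ideal.axioms(1) cgenideal_ideal)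
      ultimately have "m \<oplus> \<zero> \<in> M <+> PIdl a" unfolding set_add_def' by blast
      then show "m \<in> M <+> PIdl a" using \<open>m \<in> M\<close> M.Icarr by simp
    qed
    moreover have "a \<in> M <+> PIdl a"
    proof -
      have "\<zero> \<oplus> a \<in> M <+> PIdl a"
        unfolding set_add_def' using cgenideal_self[OF a(1)] additive_subgroup.zero_closed[OF M.is_additive_subgroup] by blast
      then show ?thesis using a(1) by simp
    qed
    ultimately have "(M <+> PIdl a) \<inter> S \<noteq> {}" using max[OF id] a(2) by blast
    then show ?thesis unfolding set_add_def' cgenideal_def by blast
  qed
  have "primeideal M R"
  proof (rule primeidealI[OF M(1) is_cring])
    show "carrier R \<noteq> M" using M(3) assms(4) by auto
    fix a b assume ab: "a \<in> carrier R" "b \<in> carrier R" "a \<otimes> b \<in> M"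
    show "a \<in> M \<or> b \<in> M"
    proof (rule ccontr)
      assume "\<not> (a \<in> M \<or> b \<in> M)"
      then have "\<exists>m\<in>M. \<exists>r\<in>carrier R. m \<oplus> r \<otimes> a \<in> S" "\<exists>m\<in>M. \<exists>r\<in>carrier R. m \<oplus> r \<otimes> b \<in> S"
        using meet[OF ab(1)] meet[OF ab(2)] by auto
      then obtain m r m' r' where *: "m \<in> M" "r \<in> carrier R" "m \<oplus> r \<otimes> a \<in> S"
        "m' \<in> M" "r' \<in> carrier R" "m' \<oplus> r' \<otimes> b \<in> S" by (elim bexE)
      have mc: "m \<in> carrier R" "m' \<in> carrier R" using * M.Icarr by auto
      have "(m \<oplus> r \<otimes> a) \<otimes> (m' \<oplus> r' \<otimes> b) =
        ((m' \<oplus> r' \<otimes> b) \<otimes> m \<oplus> (r \<otimes> a) \<otimes> m') \<oplus> (r \<otimes> r') \<otimes> (a \<otimes> b)"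
        using ab mc * by algebra
      also have "\<dots> \<in> M"
      proof -
        have "(m' \<oplus> r' \<otimes> b) \<otimes> m \<in> M" "(r \<otimes> a) \<otimes> m' \<in> M" "(r \<otimes> r') \<otimes> (a \<otimes> b) \<in> M"
          using ab * mc by (simp_all add: M.I_l_closed)
        then show ?thesis by (intro additive_subgroup.a_closed[OF M.is_additive_subgroup])
      qed
      finally show False using assms(5)[OF *(3,6)] M(3) by blast
    qed
  qed
  then show ?thesis using M by blast
qed

lemma regular_sequence_snocD:
  assumes "regular_sequence R (xs @ [x])" "ring R"
  shows "regular_sequence R xs" "x \<in> carrier R"
    "\<And>a. a \<in> carrier R \<Longrightarrow> x \<otimes>\<^bsub>R\<^esub> a \<in> genideal R (set xs) \<Longrightarrow> a \<in> genideal R (set xs)"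
proof -
  interpret ring R by fact
  note r = assms(1)[unfolded regular_sequence_def]
  have "genideal R (set xs) \<noteq> carrier R"
  proof
    assume eq: "genideal R (set xs) = carrier R"
    have "genideal R (set xs) \<subseteq> genideal R (set (xs @ [x]))"
      using r genideal_self[of "set (xs @ [x])"] by (intro genideal_minimal genideal_ideal) auto
    moreover have "genideal R (set (xs @ [x])) \<subseteq> carrier R"
      using r by (intro genideal_minimal oneideal) auto
    ultimately show False using r eq by blast
  qed
  moreover have "\<forall>i<length xs. \<forall>a\<in>carrier R. xs ! i \<otimes>\<^bsub>R\<^esub> a \<in> genideal R (set (take i xs)) \<longrightarrow> a \<in> genideal R (set (take i xs))"
  proof (intro allI impI ballI)
    fix i a assume "i < length xs" "a \<in> carrier R" "xs ! i \<otimes>\<^bsub>R\<^esub> a \<in> genideal R (set (take i xs))"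
    then show "a \<in> genideal R (set (take i xs))"
      using r by (auto simp: nth_append dest!: spec[of _ i])
  qed
  ultimately show "regular_sequence R xs" using r by (auto simp: regular_sequence_def)
  show "x \<in> carrier R" using r by simp
  show "a \<in> genideal R (set xs)" if "a \<in> carrier R" "x \<otimes>\<^bsub>R\<^esub> a \<in> genideal R (set xs)" for a
    using r that by (auto dest!: spec[of _ "length xs"])
qed

text \<open>
  The last element \<open>x\<close> of a regular sequence in \<open>P\<close> is a non-zero-divisor modulo the ideal \<open>I\<close> of
  the others, hence \<open>I\<close> is disjoint from \<open>{a x\<^sup>n | a \<notin> P}\<close> and lies in a prime \<open>Q \<subset> P\<close> without \<open>x\<close>.
\<close>

lemma (in noetherian_ring) regular_sequence_chain:
  assumes "cring R"
  shows "regular_sequence R xs \<Longrightarrow> set xs \<subseteq> P \<Longrightarrow> primeideal P R \<Longrightarrow>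
    \<exists>Ps. length Ps = length xs \<and> (\<forall>Q\<in>set Ps. primeideal Q R) \<and> sorted_wrt (\<subset>) (Ps @ [P])"
proof (induction xs arbitrary: P rule: rev_induct)
  case Nil
  show ?case by (intro exI[of _ "[]"]) simp
next
  case (snoc x xs)
  interpret cring R by fact
  interpret P: primeideal P R by fact
  note reg = regular_sequence_snocD[OF snoc.prems(1) ring_axioms]
  have xsc: "set xs \<subseteq> carrier R" using snoc.prems(2) P.a_subset by auto
  define S where "S = {a \<otimes> x [^] n | a n. a \<in> carrier R - P \<and> (n :: nat) \<in> UNIV}"
  have one: "\<one> \<notin> P" using P.I_notcarr P.one_imp_carrier by blast
  have "\<exists>Q. primeideal Q R \<and> Idl (set xs) \<subseteq> Q \<and> Q \<inter> S = {}"
  proof (rule prime_avoiding_exists[OF assms genideal_ideal[OF xsc]])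
    show "S \<subseteq> carrier R" using reg(2) by (auto simp: S_def)
    have "\<one> \<otimes> x [^] (0 :: nat) \<in> S" unfolding S_def using one by blast
    then show "\<one> \<in> S" by simp
    show "s \<otimes> t \<in> S" if st: "s \<in> S" "t \<in> S" for s t
    proof -
      obtain a m b n where eq: "s = a \<otimes> x [^] (m :: nat)" "t = b \<otimes> x [^] (n :: nat)"
        and ab: "a \<in> carrier R - P" "b \<in> carrier R - P" using st by (auto simp: S_def)
      have "s \<otimes> t = (a \<otimes> b) \<otimes> x [^] (m + n)"
        using ab reg(2) by (simp add: eq nat_pow_mult[symmetric] m_ac)
      moreover have "a \<otimes> b \<in> carrier R - P" using ab P.I_prime by blast
      ultimately show ?thesis unfolding S_def by blast
    qed
    \<comment> \<open>Powers of \<open>x\<close> cancel modulo \<open>Idl (set xs)\<close>, which is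
      contained in P; an element \<open>a x^n\<close> with \<open>a\<close> outside P can thus not
      belong to it.\<close>
    have "a \<in> Idl (set xs)" if "a \<in> carrier R" "a \<otimes> x [^] n \<in> Idl (set xs)" for a and n :: nat
      using that
    proof (induction n arbitrary: a)
      case (Suc n)
      have "x \<otimes> (a \<otimes> x [^] n) \<in> Idl (set xs)"
        using Suc.prems reg(2) by (simp add: m_ac)
      then have "a \<otimes> x [^] n \<in> Idl (set xs)" using reg(2,3) Suc.prems(1) by simp
      then show ?case using Suc.IH Suc.prems(1) by blast
    qed simp
    moreover have "Idl (set xs) \<subseteq> P"
      using snoc.prems(2) by (intro genideal_minimal P.is_ideal) simp
    ultimately show "Idl (set xs) \<inter> S = {}" unfolding S_def by blast
  qed
  then obtain Q where Q: "primeideal Q R" "Idl (set xs) \<subseteq> Q" "Q \<inter> S = {}" by blast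
  have "\<one> \<otimes> x [^] (1 :: nat) \<in> S" unfolding S_def using one by blast
  then have "x \<in> S" using reg(2) by simp
  have "Q \<subset> P"
  proof
    show "Q \<subseteq> P"
    proof
      fix q assume q: "q \<in> Q"
      then have qc: "q \<in> carrier R" using Q(1) by (meson ideal.Icarr primeideal.axioms(1))
      have "q \<in> S" if "q \<notin> P"
      proof -
        have "q \<otimes> x [^] (0 :: nat) \<in> S" unfolding S_def using that qc by blast
        then show ?thesis using qc by simp
      qed
      then show "q \<in> P" using Q(3) q by blast
    qed
    show "Q \<noteq> P" using \<open>x \<in> S\<close> Q(3) snoc.prems(2) by auto
  qed
  have "set xs \<subseteq> Q" using Q(2) genideal_self[OF xsc] by blast
  from snoc.IH[OF reg(1) this Q(1)]
  obtain Ps where Ps: "length Ps = length xs" "\<forall>Q\<in>set Ps. primeideal Q R" "sorted_wrt (\<subset>) (Ps @ [Q])"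
    by blast
  have "sorted_wrt (\<subset>) ((Ps @ [Q]) @ [P])"
    unfolding sorted_wrt_append using Ps(3) \<open>Q \<subset> P\<close> by (auto simp: sorted_wrt_append)
  then show ?case using Ps Q(1) by (intro exI[of _ "Ps @ [Q]"]) auto
qed

lemma (in noetherian_ring) depth_le_prime_height:
  assumes "cring R" "primeideal P R"
  shows "depth R P \<le> prime_height R P"
  unfolding depth_def
proof (rule Sup_least)
  fix l assume "l \<in> {enat (length xs) | xs. regular_sequence R xs \<and> set xs \<subseteq> P}"
  then obtain xs where xs: "l = enat (length xs)" "regular_sequence R xs" "set xs \<subseteq> P" by blast
  from regular_sequence_chain[OF assms(1) xs(2,3) assms(2)]
  obtain Ps where Ps: "length Ps = length xs" "\<forall>Q\<in>set Ps. primeideal Q R" "sorted_wrt (\<subset>) (Ps @ [P])"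
    by (elim exE conjE)
  show "l \<le> prime_height R P"
    unfolding prime_height_def xs(1) using Ps by (intro Sup_upper) (auto intro!: exI[of _ Ps])
qed

section \<open>Completely integrally closed domains are normal\<close>

context "domain"
begin

lemma fraction_eq_iff:
  assumes "a \<in> carrier R" "b \<in> carrier R - {\<zero>}" "c \<in> carrier R" "d \<in> carrier R - {\<zero>}"
  shows "fraction R a b = fraction R c d \<longleftrightarrow> a \<otimes> d = c \<otimes> b"
proof
  assume "fraction R a b = fraction R c d"
  moreover have "(c, d) \<in> fraction R c d"
    using assms by (simp add: fraction_def frac_rel_def)
  ultimately have "(c, d) \<in> fraction R a b" by simp
  then show "a \<otimes> d = c \<otimes> b" by (simp add: fraction_def frac_rel_def)
next
  assume eq: "a \<otimes> d = c \<otimes> b"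
  have *: "a \<otimes> f = e \<otimes> b \<longleftrightarrow> c \<otimes> f = e \<otimes> d" if ef: "e \<in> carrier R" "f \<in> carrier R - {\<zero>}" for e f
  proof -
    have "a \<otimes> f = e \<otimes> b \<longleftrightarrow> d \<otimes> (a \<otimes> f) = d \<otimes> (e \<otimes> b)"
      using assms ef m_lcancel[of d] by auto
    also have "d \<otimes> (a \<otimes> f) = (a \<otimes> d) \<otimes> f" using assms ef by (simp add: m_ac)
    also have "\<dots> = b \<otimes> (c \<otimes> f)" unfolding eq using assms ef by (simp add: m_ac)
    also have "d \<otimes> (e \<otimes> b) = b \<otimes> (e \<otimes> d)" using assms ef by (simp add: m_ac)
    also have "b \<otimes> (c \<otimes> f) = b \<otimes> (e \<otimes> d) \<longleftrightarrow> c \<otimes> f = e \<otimes> d"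
      using assms ef m_lcancel[of b] by auto
    finally show ?thesis .
  qed
  have "p \<in> fraction R a b \<longleftrightarrow> p \<in> fraction R c d" for p
    using assms by (cases p) (simp add: fraction_def frac_rel_def * cong: conj_cong)
  then show "fraction R a b = fraction R c d" by blast
qed

lemma mem_fraction_iff:
  assumes "a \<in> carrier R" "b \<in> carrier R - {\<zero>}"
  shows "p \<in> fraction R a b \<longleftrightarrow> (\<exists>c d. p = (c, d) \<and> c \<in> carrier R \<and> d \<in> carrier R - {\<zero>} \<and>
    fraction R c d = fraction R a b)"
proof -
  have "p \<in> fraction R a b \<longleftrightarrow> (\<exists>c d. p = (c, d) \<and> c \<in> carrier R \<and> d \<in> carrier R - {\<zero>} \<and> a \<otimes> d = c \<otimes> b)"
    using assms by (cases p) (auto simp: fraction_def frac_rel_def)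
  also have "\<dots> \<longleftrightarrow> (\<exists>c d. p = (c, d) \<and> c \<in> carrier R \<and> d \<in> carrier R - {\<zero>} \<and>
    fraction R c d = fraction R a b)"
    using fraction_eq_iff[OF _ _ assms] by metis
  finally show ?thesis .
qed

lemma fraction_field_carrier:
  "carrier (fraction_field R) = {fraction R a b | a b. a \<in> carrier R \<and> b \<in> carrier R - {\<zero>}}"
  by (auto simp: fraction_field_def quotient_def fraction_def)

lemma prod_nonzero: "b \<in> carrier R - {\<zero>} \<Longrightarrow> d \<in> carrier R - {\<zero>} \<Longrightarrow> b \<otimes> d \<in> carrier R - {\<zero>}"
  using integral by auto

text \<open>The operations of \<open>fraction_field\<close> are unions over all representatives.
  Once the value is independent of them, the union collapses to this value.\<close>

lemma fraction_op:
  assumes ab: "a \<in> carrier R" "b \<in> carrier R - {\<zero>}" "c \<in> carrier R" "d \<in> carrier R - {\<zero>}"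
    and op: "\<And>a b c d a' b' c' d'. {a, c, a', c'} \<subseteq> carrier R \<Longrightarrow> {b, d, b', d'} \<subseteq> carrier R - {\<zero>} \<Longrightarrow>
      fraction R a b = fraction R a' b' \<Longrightarrow> fraction R c d = fraction R c' d' \<Longrightarrow> F a b c d = F a' b' c' d'"
  shows "(\<Union>(a, b)\<in>fraction R a b. \<Union>(c, d)\<in>fraction R c d. F a b c d) = F a b c d"
proof -
  have eq: "F a' b' c' d' = F a b c d" if "(a', b') \<in> fraction R a b" "(c', d') \<in> fraction R c d" for a' b' c' d'
    using that unfolding mem_fraction_iff[OF ab(1,2)] mem_fraction_iff[OF ab(3,4)]
    by (intro op) (use ab in auto)
  have mem: "(a, b) \<in> fraction R a b" "(c, d) \<in> fraction R c d"
    unfolding mem_fraction_iff[OF ab(1,2)] mem_fraction_iff[OF ab(3,4)] using ab by auto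
  show ?thesis
  proof (intro equalityI subsetI)
    fix z assume "z \<in> F a b c d"
    then have "z \<in> (\<Union>(c, d)\<in>fraction R c d. F a b c d)"
      using mem(2) by (intro UN_I[of "(c, d)"]) simp_all
    then show "z \<in> (\<Union>(a, b)\<in>fraction R a b. \<Union>(c, d)\<in>fraction R c d. F a b c d)"
      using mem(1) by (intro UN_I[of "(a, b)"]) simp_all
  qed (auto simp: eq)
qed

lemma fraction_mult:
  assumes "a \<in> carrier R" "b \<in> carrier R - {\<zero>}" "c \<in> carrier R" "d \<in> carrier R - {\<zero>}"
  shows "fraction R a b \<otimes>\<^bsub>fraction_field R\<^esub> fraction R c d = fraction R (a \<otimes> c) (b \<otimes> d)"
proof -
  have "(\<Union>(a, b)\<in>fraction R a b. \<Union>(c, d)\<in>fraction R c d. fraction R (a \<otimes> c) (b \<otimes> d)) = fraction R (a \<otimes> c) (b \<otimes> d)"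
  proof (rule fraction_op[OF assms, of "\<lambda>a b c d. fraction R (a \<otimes> c) (b \<otimes> d)"])
    fix a b c d a' b' c' d'
    assume *: "{a, c, a', c'} \<subseteq> carrier R" "{b, d, b', d'} \<subseteq> carrier R - {\<zero>}"
      "fraction R a b = fraction R a' b'" "fraction R c d = fraction R c' d'"
    then have eq: "a \<otimes> b' = a' \<otimes> b" "c \<otimes> d' = c' \<otimes> d" by (simp_all add: fraction_eq_iff)
    have "(a \<otimes> c) \<otimes> (b' \<otimes> d') = (a \<otimes> b') \<otimes> (c \<otimes> d')" using * by (simp add: m_ac)
    also have "\<dots> = (a' \<otimes> c') \<otimes> (b \<otimes> d)" unfolding eq using * by (simp add: m_ac)
    finally show "fraction R (a \<otimes> c) (b \<otimes> d) = fraction R (a' \<otimes> c') (b' \<otimes> d')"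
      using * prod_nonzero[of b d] prod_nonzero[of b' d'] by (subst fraction_eq_iff) auto
  qed
  then show ?thesis by (simp add: fraction_field_def)
qed

lemma fraction_add:
  assumes "a \<in> carrier R" "b \<in> carrier R - {\<zero>}" "c \<in> carrier R" "d \<in> carrier R - {\<zero>}"
  shows "fraction R a b \<oplus>\<^bsub>fraction_field R\<^esub> fraction R c d = fraction R (a \<otimes> d \<oplus> c \<otimes> b) (b \<otimes> d)"
proof -
  have "(\<Union>(a, b)\<in>fraction R a b. \<Union>(c, d)\<in>fraction R c d. fraction R (a \<otimes> d \<oplus> c \<otimes> b) (b \<otimes> d)) =
    fraction R (a \<otimes> d \<oplus> c \<otimes> b) (b \<otimes> d)"
  proof (rule fraction_op[OF assms, of "\<lambda>a b c d. fraction R (a \<otimes> d \<oplus> c \<otimes> b) (b \<otimes> d)"])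
    fix a b c d a' b' c' d'
    assume *: "{a, c, a', c'} \<subseteq> carrier R" "{b, d, b', d'} \<subseteq> carrier R - {\<zero>}"
      "fraction R a b = fraction R a' b'" "fraction R c d = fraction R c' d'"
    then have eq: "a \<otimes> b' = a' \<otimes> b" "c \<otimes> d' = c' \<otimes> d" by (simp_all add: fraction_eq_iff)
    have "(a \<otimes> d \<oplus> c \<otimes> b) \<otimes> (b' \<otimes> d') = (a \<otimes> b') \<otimes> (d \<otimes> d') \<oplus> (c \<otimes> d') \<otimes> (b \<otimes> b')"
      using * by (simp add: m_ac l_distr r_distr)
    also have "\<dots> = (a' \<otimes> d' \<oplus> c' \<otimes> b') \<otimes> (b \<otimes> d)" unfolding eq using * by (simp add: m_ac l_distr r_distr)
    finally show "fraction R (a \<otimes> d \<oplus> c \<otimes> b) (b \<otimes> d) = fraction R (a' \<otimes> d' \<oplus> c' \<otimes> b') (b' \<otimes> d')"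
      using * prod_nonzero[of b d] prod_nonzero[of b' d'] by (subst fraction_eq_iff) auto
  qed
  then show ?thesis by (simp add: fraction_field_def)
qed

lemma fraction_field_cring: "cring (fraction_field R)"
proof -
  let ?K = "fraction_field R"
  have zo: "\<zero>\<^bsub>?K\<^esub> = fraction R \<zero> \<one>" "\<one>\<^bsub>?K\<^esub> = fraction R \<one> \<one>" by (simp_all add: fraction_field_def)
  have one: "\<one> \<in> carrier R - {\<zero>}" by simp
  have zoc: "\<zero>\<^bsub>?K\<^esub> \<in> carrier ?K" "\<one>\<^bsub>?K\<^esub> \<in> carrier ?K"
    unfolding zo fraction_field_carrier using one by blast+
  have pr: "b \<in> carrier R \<Longrightarrow> b \<noteq> \<zero> \<Longrightarrow> d \<in> carrier R \<Longrightarrow> d \<noteq> \<zero> \<Longrightarrow> b \<otimes> d \<noteq> \<zero>" for b d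
    using prod_nonzero by simp
  note simps = fraction_mult fraction_add fraction_eq_iff pr m_ac l_distr r_distr a_ac
  have clos: "x \<oplus>\<^bsub>?K\<^esub> y \<in> carrier ?K" "x \<otimes>\<^bsub>?K\<^esub> y \<in> carrier ?K" if "x \<in> carrier ?K" "y \<in> carrier ?K" for x y
    using that unfolding fraction_field_carrier by (auto simp: fraction_mult fraction_add) (use pr in blast)+
  show ?thesis
  proof (rule cringI)
    show "abelian_group ?K"
    proof (rule abelian_groupI)
      fix x assume "x \<in> carrier ?K"
      then obtain a b where ab: "x = fraction R a b" "a \<in> carrier R" "b \<in> carrier R" "b \<noteq> \<zero>"
        unfolding fraction_field_carrier by blast
      show "\<zero>\<^bsub>?K\<^esub> \<oplus>\<^bsub>?K\<^esub> x = x" unfolding zo ab(1) using ab(2-) by (simp add: simps)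
      have "fraction R (\<ominus> a) b \<oplus>\<^bsub>?K\<^esub> x = \<zero>\<^bsub>?K\<^esub>"
        unfolding zo ab(1) using ab(2-) by (simp add: simps l_minus r_minus l_neg r_neg)
      moreover have "fraction R (\<ominus> a) b \<in> carrier ?K" unfolding fraction_field_carrier using ab by blast
      ultimately show "\<exists>y\<in>carrier ?K. y \<oplus>\<^bsub>?K\<^esub> x = \<zero>\<^bsub>?K\<^esub>" by blast
    next
      fix x y z assume "x \<in> carrier ?K" "y \<in> carrier ?K" "z \<in> carrier ?K"
      then obtain a b c d e f where *: "x = fraction R a b" "y = fraction R c d" "z = fraction R e f"
        "a \<in> carrier R" "b \<in> carrier R" "b \<noteq> \<zero>" "c \<in> carrier R" "d \<in> carrier R" "d \<noteq> \<zero>"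
        "e \<in> carrier R" "f \<in> carrier R" "f \<noteq> \<zero>"
        unfolding fraction_field_carrier by blast
      show "x \<oplus>\<^bsub>?K\<^esub> y \<oplus>\<^bsub>?K\<^esub> z = x \<oplus>\<^bsub>?K\<^esub> (y \<oplus>\<^bsub>?K\<^esub> z)"
        unfolding *(1-3) using *(4-) by (simp add: simps)
    next
      fix x y assume "x \<in> carrier ?K" "y \<in> carrier ?K"
      then obtain a b c d where *: "x = fraction R a b" "y = fraction R c d"
        "a \<in> carrier R" "b \<in> carrier R" "b \<noteq> \<zero>" "c \<in> carrier R" "d \<in> carrier R" "d \<noteq> \<zero>"
        unfolding fraction_field_carrier by blast
      show "x \<oplus>\<^bsub>?K\<^esub> y = y \<oplus>\<^bsub>?K\<^esub> x" unfolding *(1,2) using *(3-) by (simp add: simps)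
    qed (use clos zoc in auto)
    show "comm_monoid ?K"
    proof (rule comm_monoidI)
      fix x assume "x \<in> carrier ?K"
      then obtain a b where ab: "x = fraction R a b" "a \<in> carrier R" "b \<in> carrier R" "b \<noteq> \<zero>"
        unfolding fraction_field_carrier by blast
      show "\<one>\<^bsub>?K\<^esub> \<otimes>\<^bsub>?K\<^esub> x = x" unfolding zo ab(1) using ab(2-) by (simp add: simps)
    next
      fix x y z assume "x \<in> carrier ?K" "y \<in> carrier ?K" "z \<in> carrier ?K"
      then obtain a b c d e f where *: "x = fraction R a b" "y = fraction R c d" "z = fraction R e f"
        "a \<in> carrier R" "b \<in> carrier R" "b \<noteq> \<zero>" "c \<in> carrier R" "d \<in> carrier R" "d \<noteq> \<zero>"
        "e \<in> carrier R" "f \<in> carrier R" "f \<noteq> \<zero>"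
        unfolding fraction_field_carrier by blast
      show "x \<otimes>\<^bsub>?K\<^esub> y \<otimes>\<^bsub>?K\<^esub> z = x \<otimes>\<^bsub>?K\<^esub> (y \<otimes>\<^bsub>?K\<^esub> z)"
        unfolding *(1-3) using *(4-) by (simp add: simps)
    next
      fix x y assume "x \<in> carrier ?K" "y \<in> carrier ?K"
      then obtain a b c d where *: "x = fraction R a b" "y = fraction R c d"
        "a \<in> carrier R" "b \<in> carrier R" "b \<noteq> \<zero>" "c \<in> carrier R" "d \<in> carrier R" "d \<noteq> \<zero>"
        unfolding fraction_field_carrier by blast
      show "x \<otimes>\<^bsub>?K\<^esub> y = y \<otimes>\<^bsub>?K\<^esub> x" unfolding *(1,2) using *(3-) by (simp add: simps)
    qed (use clos zoc in auto)
    fix x y z assume "x \<in> carrier ?K" "y \<in> carrier ?K" "z \<in> carrier ?K"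
    then obtain a b c d e f where *: "x = fraction R a b" "y = fraction R c d" "z = fraction R e f"
      "a \<in> carrier R" "b \<in> carrier R" "b \<noteq> \<zero>" "c \<in> carrier R" "d \<in> carrier R" "d \<noteq> \<zero>"
      "e \<in> carrier R" "f \<in> carrier R" "f \<noteq> \<zero>"
      unfolding fraction_field_carrier by blast
    show "(x \<oplus>\<^bsub>?K\<^esub> y) \<otimes>\<^bsub>?K\<^esub> z = x \<otimes>\<^bsub>?K\<^esub> z \<oplus>\<^bsub>?K\<^esub> y \<otimes>\<^bsub>?K\<^esub> z"
      unfolding *(1-3) using *(4-) by (simp add: simps)
  qed
qed

text \<open>An integral fraction x = a/b has a common denominator for all its powers: a power of
  \<open>b\<close> clears those below the degree of the equation, and the equation expresses the
  others by them. Hence complete integral closedness implies normality, and only the former can be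
  read off from leading monomials.\<close>

lemma normal_domainI:
  assumes cic: "\<And>a b c. a \<in> carrier R \<Longrightarrow> b \<in> carrier R - {\<zero>} \<Longrightarrow> c \<in> carrier R - {\<zero>} \<Longrightarrow>
    (\<And>m :: nat. \<exists>p\<in>carrier R. c \<otimes> a [^] m = b [^] m \<otimes> p) \<Longrightarrow> \<exists>q\<in>carrier R. a = b \<otimes> q"
  shows "normal_domain R"
  unfolding normal_domain_def
proof (intro conjI ballI impI)
  show "domain R" by (rule domain_axioms)
  let ?K = "fraction_field R"
  let ?\<iota> = "\<lambda>a. fraction R a \<one>"
  interpret K: cring ?K by (rule fraction_field_cring)
  fix x assume "x \<in> carrier ?K" and int: "integral_over ?K (?\<iota> ` carrier R) x"
  then obtain a b where ab: "x = fraction R a b" "a \<in> carrier R" "b \<in> carrier R - {\<zero>}"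
    unfolding fraction_field_carrier by blast
  obtain cs where cs: "set cs \<subseteq> ?\<iota> ` carrier R" "K.eval (\<one>\<^bsub>?K\<^esub> # cs) x = \<zero>\<^bsub>?K\<^esub>"
    using int unfolding integral_over_def by blast
  have one: "\<one> \<in> carrier R - {\<zero>}" by simp
  have xK: "x \<in> carrier ?K" by fact
  have \<iota>K: "?\<iota> r \<in> carrier ?K" if "r \<in> carrier R" for r
    using that one unfolding fraction_field_carrier by blast
  have pw: "b [^] n \<in> carrier R - {\<zero>}" for n :: nat
  proof (induction n)
    case (Suc n)
    then show ?case using prod_nonzero[OF Suc ab(3)] by simp
  qed simp
  have xpow: "x [^]\<^bsub>?K\<^esub> n = fraction R (a [^] n) (b [^] n)" for n :: nat
  proof (induction n)
    case 0
    then show ?case by (simp add: fraction_field_def)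
  next
    case (Suc n)
    then show ?case using ab pw by (simp add: fraction_mult ab(1))
  qed
  \<comment> \<open>The coefficient list \<open>\<one> # cs\<close> belongs to a monic polynomial of
    degree \<open>length cs\<close>.\<close>
  define c where "c = b [^] length cs"
  have c: "c \<in> carrier R - {\<zero>}" using pw by (simp add: c_def)
  define D where "D = {y \<in> carrier ?K. \<exists>p\<in>carrier R. y \<otimes>\<^bsub>?K\<^esub> ?\<iota> c = ?\<iota> p}"
  have \<iota>add: "?\<iota> p \<oplus>\<^bsub>?K\<^esub> ?\<iota> q = ?\<iota> (p \<oplus> q)" and \<iota>mult: "?\<iota> p \<otimes>\<^bsub>?K\<^esub> ?\<iota> q = ?\<iota> (p \<otimes> q)"
    if "p \<in> carrier R" "q \<in> carrier R" for p q
    using that by (auto simp: fraction_add fraction_mult)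
  have Dadd: "y \<oplus>\<^bsub>?K\<^esub> z \<in> D" if yz: "y \<in> D" "z \<in> D" for y z
  proof -
    obtain p q where "p \<in> carrier R" "q \<in> carrier R" "y \<otimes>\<^bsub>?K\<^esub> ?\<iota> c = ?\<iota> p" "z \<otimes>\<^bsub>?K\<^esub> ?\<iota> c = ?\<iota> q"
      using yz by (auto simp: D_def)
    then have "(y \<oplus>\<^bsub>?K\<^esub> z) \<otimes>\<^bsub>?K\<^esub> ?\<iota> c = ?\<iota> (p \<oplus> q)"
      using yz c \<iota>K by (simp add: K.l_distr D_def \<iota>add)
    then show ?thesis using yz \<open>p \<in> carrier R\<close> \<open>q \<in> carrier R\<close> unfolding D_def by blast
  qed
  have Dmult: "?\<iota> r \<otimes>\<^bsub>?K\<^esub> y \<in> D" if r: "r \<in> carrier R" and y: "y \<in> D" for r y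
  proof -
    obtain p where p: "p \<in> carrier R" "y \<otimes>\<^bsub>?K\<^esub> ?\<iota> c = ?\<iota> p" using y by (auto simp: D_def)
    have "(?\<iota> r \<otimes>\<^bsub>?K\<^esub> y) \<otimes>\<^bsub>?K\<^esub> ?\<iota> c = ?\<iota> (r \<otimes> p)"
      using y r c \<iota>K p by (simp add: K.m_assoc D_def \<iota>mult)
    then show ?thesis using y r p \<iota>K unfolding D_def by blast
  qed
  have D0: "\<zero>\<^bsub>?K\<^esub> \<in> D"
  proof -
    have "\<zero>\<^bsub>?K\<^esub> = ?\<iota> \<zero>" by (simp add: fraction_field_def)
    then have "\<zero>\<^bsub>?K\<^esub> \<otimes>\<^bsub>?K\<^esub> ?\<iota> c = ?\<iota> \<zero>" using \<iota>mult[of \<zero> c] c by simp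
    then show ?thesis using zero_closed K.zero_closed unfolding D_def by blast
  qed
  have \<iota>neg: "\<ominus>\<^bsub>?K\<^esub> y \<in> D" if "y \<in> D" for y
  proof -
    have "?\<iota> (\<ominus> \<one>) \<oplus>\<^bsub>?K\<^esub> \<one>\<^bsub>?K\<^esub> = \<zero>\<^bsub>?K\<^esub>"
      using \<iota>add[of "\<ominus> \<one>" \<one>] by (simp add: l_neg fraction_field_def)
    then have "?\<iota> (\<ominus> \<one>) = \<ominus>\<^bsub>?K\<^esub> \<one>\<^bsub>?K\<^esub>" using \<iota>K[of "\<ominus> \<one>"] by (simp add: K.minus_equality)
    then have "\<ominus>\<^bsub>?K\<^esub> y = ?\<iota> (\<ominus> \<one>) \<otimes>\<^bsub>?K\<^esub> y" using that by (simp add: D_def K.l_minus)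
    then show ?thesis using Dmult[of "\<ominus> \<one>" y] that by simp
  qed
  \<comment> \<open>Multiplied by x^j, the equation expresses the power with exponent
    \<open>length cs + j\<close> by the preceding ones; \<open>D\<close> consists of the fractions
    with denominator \<open>c\<close>.\<close>
  have evalD: "K.eval ds x \<in> carrier ?K \<and> K.eval ds x \<otimes>\<^bsub>?K\<^esub> x [^]\<^bsub>?K\<^esub> j \<in> D"
    if "set ds \<subseteq> ?\<iota> ` carrier R" "\<And>i. i < length ds \<Longrightarrow> x [^]\<^bsub>?K\<^esub> (i + j) \<in> D" for ds and j :: nat
    using that
  proof (induction ds)
    case Nil
    then show ?case using D0 xK by simp
  next
    case (Cons d ds)
    obtain r where r: "d = ?\<iota> r" "r \<in> carrier R" using Cons.prems(1) by auto
    have IH: "K.eval ds x \<in> carrier ?K" "K.eval ds x \<otimes>\<^bsub>?K\<^esub> x [^]\<^bsub>?K\<^esub> j \<in> D" using Cons by auto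
    have "d \<otimes>\<^bsub>?K\<^esub> x [^]\<^bsub>?K\<^esub> (length ds + j) \<in> D" using Cons.prems(2) r Dmult by simp
    then have "(d \<otimes>\<^bsub>?K\<^esub> x [^]\<^bsub>?K\<^esub> length ds) \<otimes>\<^bsub>?K\<^esub> x [^]\<^bsub>?K\<^esub> j \<in> D"
      using r \<iota>K xK by (simp add: K.m_assoc K.nat_pow_mult)
    from Dadd[OF this IH(2)] show ?case
      using r \<iota>K xK IH(1) by (simp add: K.l_distr)
  qed
  have "x [^]\<^bsub>?K\<^esub> m \<in> D" for m :: nat
  proof (induction m rule: less_induct)
    case (less m)
    show ?case
    proof (cases "m < length cs")
      case True
      have "x [^]\<^bsub>?K\<^esub> m \<otimes>\<^bsub>?K\<^esub> ?\<iota> c = ?\<iota> (a [^] m \<otimes> b [^] (length cs - m))"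
      proof -
        have "c = b [^] m \<otimes> b [^] (length cs - m)"
          using ab True by (simp add: c_def nat_pow_mult)
        then show ?thesis
          unfolding xpow using ab c pw one by (simp add: fraction_mult fraction_eq_iff m_ac)
      qed
      then show ?thesis using ab xK unfolding D_def by blast
    next
      case False
      define j where "j = m - length cs"
      have "x [^]\<^bsub>?K\<^esub> (i + j) \<in> D" if "i < length cs" for i
        using less[of "i + j"] that False by (simp add: j_def)
      from evalD[OF cs(1) this]
      have ev: "K.eval cs x \<in> carrier ?K" "K.eval cs x \<otimes>\<^bsub>?K\<^esub> x [^]\<^bsub>?K\<^esub> j \<in> D" by auto
      have "x [^]\<^bsub>?K\<^esub> length cs \<oplus>\<^bsub>?K\<^esub> K.eval cs x = \<zero>\<^bsub>?K\<^esub>" using cs(2) xK by simp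
      then have "x [^]\<^bsub>?K\<^esub> length cs = \<ominus>\<^bsub>?K\<^esub> K.eval cs x"
        using ev(1) xK by (simp add: K.minus_equality)
      moreover have "x [^]\<^bsub>?K\<^esub> m = x [^]\<^bsub>?K\<^esub> length cs \<otimes>\<^bsub>?K\<^esub> x [^]\<^bsub>?K\<^esub> j"
        using False xK by (simp add: j_def K.nat_pow_mult)
      ultimately have "x [^]\<^bsub>?K\<^esub> m = \<ominus>\<^bsub>?K\<^esub> (K.eval cs x \<otimes>\<^bsub>?K\<^esub> x [^]\<^bsub>?K\<^esub> j)"
        using ev(1) xK by (simp add: K.l_minus)
      then show ?thesis using \<iota>neg[OF ev(2)] by simp
    qed
  qed
  then have "\<exists>p\<in>carrier R. c \<otimes> a [^] m = b [^] m \<otimes> p" for m :: nat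
  proof -
    obtain p where p: "p \<in> carrier R" "x [^]\<^bsub>?K\<^esub> m \<otimes>\<^bsub>?K\<^esub> ?\<iota> c = ?\<iota> p"
      using \<open>\<And>m. x [^]\<^bsub>?K\<^esub> m \<in> D\<close>[of m] by (auto simp: D_def)
    then have "a [^] m \<otimes> c = p \<otimes> b [^] m"
      unfolding xpow using ab c pw[of m] one by (simp add: fraction_mult fraction_eq_iff)
    then show ?thesis using p ab c pw[of m] by (metis DiffD1 m_comm nat_pow_closed)
  qed
  from cic[OF ab(2,3) c this] obtain q where q: "q \<in> carrier R" "a = b \<otimes> q" by blast
  then have "x = ?\<iota> q" unfolding ab(1) using ab by (simp add: fraction_eq_iff m_comm)
  then show "x \<in> ?\<iota> ` carrier R" using q by blast
qed

end

section \<open>Quotients of polynomial rings\<close>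

context ideal
begin

text \<open>Elements of the quotient ring are cosets, so the union of an ideal of cosets is its
  preimage in R. Ideals of the quotient are handled through this preimage from here on.\<close>

lemma mem_Union_quot_ideal_iff:
  assumes "ideal J (R Quot I)" "a \<in> carrier R"
  shows "a \<in> \<Union> J \<longleftrightarrow> I +> a \<in> J"
proof
  interpret J: ideal J "R Quot I" by fact
  assume "a \<in> \<Union> J"
  then obtain A where A: "A \<in> J" "a \<in> A" by blast
  then have "A \<in> a_rcosets I" using J.a_subset by (auto simp: FactRing_def)
  then obtain b where b: "b \<in> carrier R" "A = I +> b" unfolding A_RCOSETS_def' by blast
  have "I +> b = I +> a"
    using a_repr_independence[OF _ b(1) additive_subgroup.a_subgroup[OF is_additive_subgroup]] A(2) b(2) by blast
  then show "I +> a \<in> J" using A(1) b(2) by simp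
next
  assume "I +> a \<in> J"
  then show "a \<in> \<Union> J" using a_rcos_self[OF assms(2)] by blast
qed

lemma Union_quot_ideal_subset:
  assumes "ideal J (R Quot I)"
  shows "\<Union> J \<subseteq> carrier R" "I \<subseteq> \<Union> J" "J = (+>) I ` \<Union> J"
proof -
  interpret J: ideal J "R Quot I" by fact
  have "ideal (\<Union> J) R" using quot_ideal_imp_ring_ideal[OF is_ideal assms] .
  then show sub: "\<Union> J \<subseteq> carrier R" by (rule ideal.Icarr[THEN subsetI])
  have "I \<in> J" using additive_subgroup.zero_closed[OF J.is_additive_subgroup] by (simp add: FactRing_def)
  then show "I \<subseteq> \<Union> J" by blast
  show "J = (+>) I ` \<Union> J"
  proof
    show "J \<subseteq> (+>) I ` \<Union> J"
    proof
      fix A assume A: "A \<in> J"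
      then have "A \<in> a_rcosets I" using J.a_subset by (auto simp: FactRing_def)
      then obtain b where b: "b \<in> carrier R" "A = I +> b" unfolding A_RCOSETS_def' by blast
      then show "A \<in> (+>) I ` \<Union> J" using mem_Union_quot_ideal_iff[OF assms b(1)] A by blast
    qed
    show "(+>) I ` \<Union> J \<subseteq> J" using mem_Union_quot_ideal_iff[OF assms] sub by blast
  qed
qed

lemma genideal_quotient:
  assumes "A \<subseteq> carrier R"
  shows "genideal (R Quot I) ((+>) I ` A) = (+>) I ` (Idl A)"
proof
  interpret Q: ring "R Quot I" by (rule quotient_is_ring)
  have im: "(+>) I ` A \<subseteq> carrier (R Quot I)" using assms by (auto simp: FactRing_def A_RCOSETS_def')
  show "genideal (R Quot I) ((+>) I ` A) \<subseteq> (+>) I ` (Idl A)"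
    using ring_ideal_imp_quot_ideal[OF is_ideal genideal_ideal[OF assms]] genideal_self[OF assms]
    by (intro Q.genideal_minimal) auto
  let ?J = "genideal (R Quot I) ((+>) I ` A)"
  have J: "ideal ?J (R Quot I)" using im by (rule Q.genideal_ideal)
  have "A \<subseteq> \<Union> ?J"
    using mem_Union_quot_ideal_iff[OF J] Q.genideal_self[OF im] assms by blast
  then have "Idl A \<subseteq> \<Union> ?J"
    by (intro genideal_minimal quot_ideal_imp_ring_ideal[OF is_ideal J])
  then show "(+>) I ` (Idl A) \<subseteq> ?J"
    using mem_Union_quot_ideal_iff[OF J] Union_quot_ideal_subset(1)[OF J] by blast
qed

end

lemma (in noetherian_ring) noetherian_quotient:
  assumes "ideal I R"
  shows "noetherian_ring (R Quot I)"
proof -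
  interpret I: ideal I R by fact
  interpret Q: ring "R Quot I" by (rule I.quotient_is_ring)
  show ?thesis
  proof (rule Q.noetherian_ringI)
    fix J assume J: "ideal J (R Quot I)"
    then obtain A where A: "A \<subseteq> carrier R" "finite A" "\<Union> J = Idl A"
      using finetely_gen[OF quot_ideal_imp_ring_ideal[OF assms J]] by blast
    have "J = genideal (R Quot I) ((+>) I ` A)"
      using I.Union_quot_ideal_subset(3)[OF J] A I.genideal_quotient[OF A(1)] by simp
    moreover have "(+>) I ` A \<subseteq> carrier (R Quot I)" using A(1) by (auto simp: FactRing_def A_RCOSETS_def')
    ultimately show "\<exists>B\<subseteq>carrier (R Quot I). finite B \<and> J = genideal (R Quot I) B"
      using A(2) by blast
  qed
qed

lemma noetherian_pol_ring:
  assumes "finite V"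
  shows "noetherian_ring (pol_ring V :: 'k::field mpol ring)"
proof -
  interpret cring "pol_ring V :: 'k mpol ring" by (rule cring_pol_ring)
  show ?thesis
  proof (rule noetherian_ringI)
    fix I :: "'k mpol set" assume I: "ideal I (pol_ring V)"
    note D = ideal_pol_ringD[OF I]
    have "\<exists>G. finite G \<and> G \<subseteq> I \<and> (\<forall>J. 0 \<in> J \<longrightarrow> (\<forall>p\<in>J. \<forall>q\<in>J. p + q \<in> J) \<longrightarrow>
        (\<forall>p\<in>J. \<forall>a\<in>Pol V. a * p \<in> J) \<longrightarrow> G \<subseteq> J \<longrightarrow> I \<subseteq> J)"
      by (rule Pol_ideal_finitely_generated[OF assms]) (use D in auto)
    then obtain G where G: "finite G" "G \<subseteq> I" "\<forall>J. 0 \<in> J \<longrightarrow> (\<forall>p\<in>J. \<forall>q\<in>J. p + q \<in> J) \<longrightarrow>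
        (\<forall>p\<in>J. \<forall>a\<in>Pol V. a * p \<in> J) \<longrightarrow> G \<subseteq> J \<longrightarrow> I \<subseteq> J" by (elim exE conjE)
    have GV: "G \<subseteq> carrier (pol_ring V)" using G(2) D(1) by auto
    note DG = ideal_pol_ringD[OF genideal_ideal[OF GV]]
    have "I \<subseteq> genideal (pol_ring V) G"
      using DG(2-4) genideal_self[OF GV] by (intro G(3)[rule_format]) auto
    moreover have "genideal (pol_ring V) G \<subseteq> I" using G(2) I by (intro genideal_minimal)
    ultimately show "\<exists>A\<subseteq>carrier (pol_ring V). finite A \<and> I = genideal (pol_ring V) A"
      using G(1) GV by blast
  qed
qed

lemma coset_pol_ring_eq_iff:
  fixes I :: "'k::field mpol set"
  assumes "ideal I (pol_ring V)" "a \<in> Pol V" "b \<in> Pol V"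
  shows "I +>\<^bsub>pol_ring V\<^esub> a = I +>\<^bsub>pol_ring V\<^esub> b \<longleftrightarrow> a - b \<in> I"
proof -
  have "I +>\<^bsub>pol_ring V\<^esub> c = (\<lambda>i. i + c) ` I" for c
    by (auto simp: a_r_coset_def')
  note coset = this
  note D = ideal_pol_ringD[OF assms(1)]
  show ?thesis
  proof
    assume "I +>\<^bsub>pol_ring V\<^esub> a = I +>\<^bsub>pol_ring V\<^esub> b"
    moreover have "a \<in> I +>\<^bsub>pol_ring V\<^esub> a" unfolding coset using D(2) by (intro image_eqI[of _ _ 0]) auto
    ultimately show "a - b \<in> I" unfolding coset by auto
  next
    assume ab: "a - b \<in> I"
    have *: "(\<lambda>i. i + c) ` I \<subseteq> (\<lambda>i. i + d) ` I" if "c - d \<in> I" for c d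
    proof
      fix x assume "x \<in> (\<lambda>i. i + c) ` I"
      then obtain i where "i \<in> I" "x = i + c" by blast
      then show "x \<in> (\<lambda>i. i + d) ` I"
        using D(3)[OF \<open>i \<in> I\<close> that] by (intro image_eqI[of _ _ "i + (c - d)"]) simp_all
    qed
    have "b - a \<in> I" using D(5)[OF D(2) ab] by simp
    then show "I +>\<^bsub>pol_ring V\<^esub> a = I +>\<^bsub>pol_ring V\<^esub> b" unfolding coset using *[OF ab] *[of b a] by blast
  qed
qed

lemma prime_set_of_primeideal:
  fixes Q :: "'k::field mpol set"
  assumes "primeideal Q (pol_ring V)"
  shows "prime_set V Q"
proof -
  interpret primeideal Q "pol_ring V" by fact
  have "1 \<notin> Q" using I_notcarr one_imp_carrier by auto
  then show ?thesis
    using ideal_pol_ringD[OF is_ideal] I_prime by (auto simp: prime_set_def)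
qed

lemma primeideal_of_prime_set:
  fixes Q :: "'k::field mpol set"
  assumes "prime_set V Q"
  shows "primeideal Q (pol_ring V)"
proof (rule primeidealI[OF _ cring_pol_ring])
  show "ideal Q (pol_ring V)" using prime_setD[OF assms] by (intro ideal_pol_ringI) auto
  show "carrier (pol_ring V) \<noteq> Q" using prime_setD(5)[OF assms] by auto
qed (use prime_setD(6)[OF assms] in auto)

lemma quot_mult:
  assumes "ideal I (pol_ring V :: 'k::field mpol ring)" "a \<in> Pol V" "b \<in> Pol V"
  shows "(I +>\<^bsub>pol_ring V\<^esub> a) \<otimes>\<^bsub>pol_ring V Quot I\<^esub> (I +>\<^bsub>pol_ring V\<^esub> b) = I +>\<^bsub>pol_ring V\<^esub> (a * b)"
  using ring_hom_mult[OF ideal.rcos_ring_hom[OF assms(1)], of a b] assms(2,3) by simp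

lemma carrier_quot: "carrier (pol_ring V Quot I) = (\<lambda>a. I +>\<^bsub>pol_ring V\<^esub> a) ` Pol V" for I :: "'k::field mpol set"
  by (auto simp: FactRing_def A_RCOSETS_def')

lemma prime_set_Union:
  fixes I :: "'k::field mpol set"
  assumes I: "ideal I (pol_ring V)" and Q: "primeideal Q (pol_ring V Quot I)"
  shows "prime_set V (\<Union> Q)"
proof -
  interpret I: ideal I "pol_ring V" by fact
  interpret Q: primeideal Q "pol_ring V Quot I" by fact
  have id: "ideal (\<Union> Q) (pol_ring V)" using I.quot_ideal_imp_ring_ideal[OF I Q.is_ideal] .
  note mem = I.mem_Union_quot_ideal_iff[OF Q.is_ideal]
  have "primeideal (\<Union> Q) (pol_ring V)"
  proof (rule primeidealI[OF id cring_pol_ring])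
    show "carrier (pol_ring V) \<noteq> \<Union> Q"
    proof
      assume eq: "carrier (pol_ring V) = \<Union> Q"
      have "carrier (pol_ring V Quot I) \<subseteq> Q" unfolding carrier_quot using mem eq by auto
      then show False using Q.I_notcarr Q.a_subset by blast
    qed
    fix a b assume ab: "a \<in> carrier (pol_ring V)" "b \<in> carrier (pol_ring V)" "a \<otimes>\<^bsub>pol_ring V\<^esub> b \<in> \<Union> Q"
    then have "(I +>\<^bsub>pol_ring V\<^esub> a) \<otimes>\<^bsub>pol_ring V Quot I\<^esub> (I +>\<^bsub>pol_ring V\<^esub> b) \<in> Q"
      using mem[of "a * b"] quot_mult[OF I, of a b] Pol_mult by auto
    then show "a \<in> \<Union> Q \<or> b \<in> \<Union> Q"
      using Q.I_prime[of "I +>\<^bsub>pol_ring V\<^esub> a" "I +>\<^bsub>pol_ring V\<^esub> b"] ab mem by (auto simp: carrier_quot)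
  qed
  then show ?thesis by (rule prime_set_of_primeideal)
qed

text \<open>The ideal generated by the preimage of Q and by \<open>q\<close> is strictly larger than
  that preimage and therefore contains 1.\<close>

lemma maximal_Union_inverse:
  fixes I :: "'k::field mpol set"
  assumes I: "ideal I (pol_ring V)" and Q: "maximalideal Q (pol_ring V Quot I)"
    and q: "q \<in> Pol V" "q \<notin> \<Union> Q"
  shows "\<exists>f\<in>Pol V. q * f - 1 \<in> \<Union> Q"
proof -
  interpret I: ideal I "pol_ring V" by fact
  interpret Q: maximalideal Q "pol_ring V Quot I" by fact
  let ?h = "\<lambda>a. I +>\<^bsub>pol_ring V\<^esub> a"
  have idU: "ideal (\<Union> Q) (pol_ring V)" using I.quot_ideal_imp_ring_ideal[OF I Q.is_ideal] .
  note D = ideal_pol_ringD[OF idU]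
  define J where "J = {p + f * q | p f. p \<in> \<Union> Q \<and> f \<in> Pol V}"
  have JI: "p + f * q \<in> J" if "p \<in> \<Union> Q" "f \<in> Pol V" for p f using that unfolding J_def by blast
  have J: "ideal J (pol_ring V)"
  proof (rule ideal_pol_ringI)
    show "J \<subseteq> Pol V" using D(1) q(1) by (auto simp: J_def intro!: Pol_add Pol_mult)
    show "0 \<in> J" using JI[OF D(2) Pol_0] by simp
    fix p p' :: "'k mpol" assume "p \<in> J" "p' \<in> J"
    then obtain r s r' s' where *: "p = r + s * q" "p' = r' + s' * q" "r \<in> \<Union> Q" "r' \<in> \<Union> Q"
      "s \<in> Pol V" "s' \<in> Pol V" unfolding J_def by blast
    have "p + p' = (r + r') + (s + s') * q" by (simp add: * algebra_simps)
    then show "p + p' \<in> J" using JI[OF D(3)[OF *(3,4)] Pol_add[OF *(5,6)]] by simp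
  next
    fix p a :: "'k mpol" assume "p \<in> J" and a: "a \<in> Pol V"
    then obtain r s where *: "p = r + s * q" "r \<in> \<Union> Q" "s \<in> Pol V" unfolding J_def by blast
    have "a * p = a * r + (a * s) * q" by (simp add: * algebra_simps)
    then show "a * p \<in> J" using JI[OF D(4)[OF *(2) a] Pol_mult[OF a *(3)]] by simp
  qed
  have "ideal (?h ` J) (pol_ring V Quot I)" using I.ring_ideal_imp_quot_ideal[OF I J] .
  moreover have "Q \<subseteq> ?h ` J"
  proof -
    have "\<Union> Q \<subseteq> J" using JI[of _ 0] by auto
    then have "?h ` \<Union> Q \<subseteq> ?h ` J" by (rule image_mono)
    then show ?thesis using I.Union_quot_ideal_subset(3)[OF Q.is_ideal] by simp
  qed
  moreover have "?h ` J \<subseteq> carrier (pol_ring V Quot I)"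
    using ideal_pol_ringD(1)[OF J] by (auto simp: carrier_quot)
  ultimately have "?h ` J = Q \<or> ?h ` J = carrier (pol_ring V Quot I)" by (rule Q.I_maximal)
  moreover have "?h ` J \<noteq> Q"
  proof -
    have "q \<in> J" using JI[OF D(2) Pol_1] by simp
    moreover have "?h q \<notin> Q" using I.mem_Union_quot_ideal_iff[OF Q.is_ideal] q by simp
    ultimately show ?thesis by blast
  qed
  ultimately have "?h 1 \<in> ?h ` J" by (auto simp: carrier_quot)
  then obtain j where j: "j \<in> J" "?h 1 = ?h j" by blast
  then obtain p f where pf: "j = p + f * q" "p \<in> \<Union> Q" "f \<in> Pol V" unfolding J_def by blast
  have "1 - j \<in> I" using coset_pol_ring_eq_iff[OF I] j ideal_pol_ringD(1)[OF J] by auto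
  then have "1 - j \<in> \<Union> Q" using I.Union_quot_ideal_subset(2)[OF Q.is_ideal] by blast
  then have "0 - (1 - j) - p \<in> \<Union> Q" by (rule D(5)[OF D(5)[OF D(2)] pf(2)])
  moreover have "0 - (1 - j) - p = q * f - 1" by (simp add: pf(1) algebra_simps)
  ultimately have "q * f - 1 \<in> \<Union> Q" by (simp only:)
  then show ?thesis using pf(3) by blast
qed

text \<open>Choose \<open>x i\<close> in \<open>Q (Suc i)\<close> but not in \<open>Q i\<close>.
  Their images under \<pi> are more polynomials than there are variables in W, so they satisfy a
  relation; pulled back, it lies in the kernel and hence in \<open>Q 0\<close>.\<close>

lemma no_long_prime_chain:
  fixes Q :: "nat \<Rightarrow> 'k::field mpol set" and \<pi> :: "'k mpol \<Rightarrow> 'k mpol"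
  assumes \<pi>: "comm_ring_hom \<pi>" "\<And>c. \<pi> (const_poly c) = const_poly c" "\<And>p. p \<in> Pol V \<Longrightarrow> \<pi> p \<in> Pol W"
    and W: "finite W" "card W < N"
    and Q: "\<And>i. i \<le> N \<Longrightarrow> prime_set V (Q i)" "\<And>i. i < N \<Longrightarrow> Q i \<subset> Q (Suc i)"
    and ker: "\<And>p. p \<in> Pol V \<Longrightarrow> \<pi> p = 0 \<Longrightarrow> p \<in> Q 0"
  shows False
proof -
  interpret \<pi>: comm_ring_hom \<pi> by fact
  have "\<forall>i<N. \<exists>x. x \<in> Q (Suc i) \<and> x \<notin> Q i" using Q(2) by blast
  then obtain x where x: "\<And>i. i < N \<Longrightarrow> x i \<in> Q (Suc i)" "\<And>i. i < N \<Longrightarrow> x i \<notin> Q i" by metis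
  have xV: "x i \<in> Pol V" if "i < N" for i
    using x(1)[OF that] prime_setD(1)[OF Q(1), of "Suc i"] that by auto
  have "\<exists>A c. finite A \<and> A \<noteq> {} \<and> (\<forall>m\<in>A. keys m \<subseteq> {..<N} \<and> c m \<noteq> 0) \<and>
    (\<Sum>m\<in>A. const_poly (c m) * mon_eval (\<lambda>i. \<pi> (x i)) m) = 0"
    by (rule algebraically_dependent[OF W]) (use \<pi>(3) xV in auto)
  then obtain A c where A: "finite A" "A \<noteq> {}" "\<forall>m\<in>A. keys m \<subseteq> {..<N} \<and> c m \<noteq> 0"
    "(\<Sum>m\<in>A. const_poly (c m) * mon_eval (\<lambda>i. \<pi> (x i)) m) = 0" by (elim exE conjE)
  have "mon_eval (\<lambda>i. \<pi> (x i)) m = \<pi> (mon_eval x m)" for m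
    by (simp add: mon_eval_def \<pi>.hom_prod \<pi>.hom_power)
  then have "\<pi> (\<Sum>m\<in>A. const_poly (c m) * mon_eval x m) = 0"
    using A(4) by (simp add: \<pi>.hom_sum \<pi>.hom_mult \<pi>(2))
  then have "(\<Sum>m\<in>A. const_poly (c m) * mon_eval x m) \<in> Q 0"
    using A(3) xV by (intro ker Pol_sum Pol_mult mon_eval_in_Pol) (auto dest!: bspec)
  note rel = this
  show False
    by (rule no_prime_chain_of_relation[where N = N and V = V and Q = Q and x = x and A = A and c = c])
      (use Q x A(1-3) rel in auto)
qed

lemma prime_height_quot_le:
  fixes I :: "'k::field mpol set" and \<pi> :: "'k mpol \<Rightarrow> 'k mpol"
  assumes I: "ideal I (pol_ring V)"
    and \<pi>: "comm_ring_hom \<pi>" "\<And>c. \<pi> (const_poly c) = const_poly c" "\<And>p. p \<in> Pol V \<Longrightarrow> \<pi> p \<in> Pol W"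
    and ker: "\<And>p. p \<in> Pol V \<Longrightarrow> \<pi> p = 0 \<Longrightarrow> p \<in> I"
    and W: "finite W" and P: "primeideal P (pol_ring V Quot I)"
  shows "prime_height (pol_ring V Quot I) P \<le> enat (card W)"
  unfolding prime_height_def
proof (rule Sup_least)
  interpret I: ideal I "pol_ring V" by fact
  fix l assume "l \<in> {enat (length Ps) |Ps. (\<forall>Q\<in>set Ps. primeideal Q (pol_ring V Quot I)) \<and> sorted_wrt (\<subset>) (Ps @ [P])}"
  then obtain Ps where Ps: "l = enat (length Ps)" "\<forall>Q\<in>set Ps. primeideal Q (pol_ring V Quot I)"
    "sorted_wrt (\<subset>) (Ps @ [P])" by blast
  show "l \<le> enat (card W)"
  proof (rule ccontr)
    assume "\<not> l \<le> enat (card W)"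
    then have N: "card W < length Ps" by (simp add: Ps(1))
    let ?L = "Ps @ [P]"
    have prime: "primeideal (?L ! i) (pol_ring V Quot I)" if "i \<le> length Ps" for i
      using Ps(2) P that by (cases "i = length Ps") (auto simp: nth_append)
    have ideal: "ideal (?L ! i) (pol_ring V Quot I)" if "i \<le> length Ps" for i
      using prime[OF that] by (rule primeideal.axioms(1))
    have "\<Union> (?L ! i) \<subset> \<Union> (?L ! Suc i)" if i: "i < length Ps" for i
    proof -
      have ss: "?L ! i \<subset> ?L ! Suc i" using sorted_wrt_nth_less[OF Ps(3), of i "Suc i"] i by simp
      moreover have "\<Union> (?L ! i) \<noteq> \<Union> (?L ! Suc i)"
      proof
        assume "\<Union> (?L ! i) = \<Union> (?L ! Suc i)"
        then have "?L ! i = ?L ! Suc i"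
          using I.Union_quot_ideal_subset(3)[OF ideal, of i] I.Union_quot_ideal_subset(3)[OF ideal, of "Suc i"] i
          by simp
        then show False using ss by simp
      qed
      ultimately show ?thesis by blast
    qed
    moreover have "prime_set V (\<Union> (?L ! i))" if "i \<le> length Ps" for i
      using prime_set_Union[OF I prime[OF that]] .
    moreover have "p \<in> \<Union> (?L ! 0)" if "p \<in> Pol V" "\<pi> p = 0" for p
      using ker[OF that] I.Union_quot_ideal_subset(2)[OF ideal, of 0] by blast
    ultimately show False
      using no_long_prime_chain[OF \<pi> W N, where Q = "\<lambda>i. \<Union> (?L ! i)"] by blast
  qed
qed

lemma regular_sequence_quotI:
  fixes I :: "'k::field mpol set"
  assumes I: "ideal I (pol_ring V)" and Fs: "set Fs \<subseteq> Pol V"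
    and P: "ideal P (pol_ring V Quot I)" "P \<noteq> carrier (pol_ring V Quot I)" "\<And>f. f \<in> set Fs \<Longrightarrow> f \<in> \<Union> P"
    and reg: "\<And>i a b. i < length Fs \<Longrightarrow> a \<in> Pol V \<Longrightarrow> b \<in> genideal (pol_ring V) (set (take i Fs)) \<Longrightarrow>
      Fs ! i * a - b \<in> I \<Longrightarrow> \<exists>b\<in>genideal (pol_ring V) (set (take i Fs)). a - b \<in> I"
  shows "regular_sequence (pol_ring V Quot I) (map (\<lambda>a. I +>\<^bsub>pol_ring V\<^esub> a) Fs) \<and>
    set (map (\<lambda>a. I +>\<^bsub>pol_ring V\<^esub> a) Fs) \<subseteq> P"
proof -
  interpret I: ideal I "pol_ring V" by fact
  let ?h = "\<lambda>a. I +>\<^bsub>pol_ring V\<^esub> a"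
  let ?R = "pol_ring V Quot I"
  interpret R: ring ?R by (rule I.quotient_is_ring)
  interpret P: ideal P ?R by fact
  have gen: "genideal ?R (?h ` S) = ?h ` genideal (pol_ring V) S" if "S \<subseteq> Pol V" for S :: "'k mpol set"
    using I.genideal_quotient[of S] that by simp
  have gV: "genideal (pol_ring V) S \<subseteq> Pol V" if "S \<subseteq> Pol V" for S :: "'k mpol set"
    using I.genideal_minimal[OF I.oneideal, of S] that by simp
  have mem: "?h a \<in> genideal ?R (?h ` S) \<longleftrightarrow> (\<exists>b\<in>genideal (pol_ring V) S. a - b \<in> I)"
    if "a \<in> Pol V" "S \<subseteq> Pol V" for a :: "'k mpol" and S
    unfolding gen[OF that(2)] using coset_pol_ring_eq_iff[OF I that(1)] gV[OF that(2)] by blast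
  have sub: "set (map ?h Fs) \<subseteq> P"
    using P(3) Fs I.mem_Union_quot_ideal_iff[OF P(1)] by (auto simp: subset_iff)
  have take_sub: "set (take i Fs) \<subseteq> Pol V" for i by (rule subset_trans[OF set_take_subset Fs])
  have "genideal ?R (set (map ?h Fs)) \<noteq> carrier ?R"
    using R.genideal_minimal[OF P(1) sub] P(2) P.a_subset by blast
  moreover have "A \<in> genideal ?R (set (take i (map ?h Fs)))"
    if i: "i < length Fs" and A: "A \<in> carrier ?R"
      "map ?h Fs ! i \<otimes>\<^bsub>?R\<^esub> A \<in> genideal ?R (set (take i (map ?h Fs)))" for i A
  proof -
    obtain a where a: "a \<in> Pol V" "A = ?h a" using A(1) by (auto simp: carrier_quot)
    have fi: "Fs ! i \<in> Pol V" using Fs i by auto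
    have eq: "set (take i (map ?h Fs)) = ?h ` set (take i Fs)" by (simp add: take_map)
    have "?h (Fs ! i * a) \<in> genideal ?R (?h ` set (take i Fs))"
      using A(2) i unfolding eq a(2) by (simp add: quot_mult[OF I fi a(1)])
    then obtain b where "b \<in> genideal (pol_ring V) (set (take i Fs))" "Fs ! i * a - b \<in> I"
      using mem[OF Pol_mult[OF fi a(1)] take_sub] by blast
    from reg[OF i a(1) this] show ?thesis unfolding eq a(2) using mem[OF a(1) take_sub] by blast
  qed
  moreover have "set (map ?h Fs) \<subseteq> carrier ?R" using Fs by (auto simp: carrier_quot)
  ultimately show ?thesis using sub unfolding regular_sequence_def by simp
qed

section \<open>A basis of the coordinate ring of a scroll\<close>

text \<open>If a member were repeated or redundant, fewer than \<open>card E\<close> vectors would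
  span the independent set E.\<close>

lemma (in vector_space) spanning_family_independent:
  assumes "finite K" "independent E" "E \<subseteq> span (b ` K)" "card K \<le> card E"
  shows "inj_on b K \<and> independent (b ` K)"
proof
  have fb: "finite (b ` K)" using assms(1) by simp
  have *: "card E \<le> card (b ` K)" using independent_span_bound[OF fb assms(2,3)] by simp
  then have "card (b ` K) = card K" using card_image_le[OF assms(1), of b] assms(4) by simp
  then show "inj_on b K" using assms(1) by (intro eq_card_imp_inj_on)
  show "independent (b ` K)"
  proof
    assume "dependent (b ` K)"
    then obtain a where a: "a \<in> b ` K" "a \<in> span (b ` K - {a})" unfolding dependent_def by blast
    have "span (b ` K) = span (b ` K - {a})"
      using span_redundant[OF a(2)] a(1) by (simp add: insert_absorb)
    then have "E \<subseteq> span (b ` K - {a})" using assms(3) by simp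
    then have "card E \<le> card (b ` K - {a})" using independent_span_bound[of "b ` K - {a}" E] fb assms(2) by simp
    also have "\<dots> < card (b ` K)" using a(1) fb by (intro psubset_card_mono) auto
    finally show False using card_image_le[OF assms(1), of b] assms(4) by simp
  qed
qed

lemma span_induct_mp [consumes 1, case_names zero add scale base]:
  assumes "p \<in> mp.span S" "P 0" "\<And>p q. P p \<Longrightarrow> P q \<Longrightarrow> P (p + q)" "\<And>c p. P p \<Longrightarrow> P (const_poly c * p)"
    and "\<And>p. p \<in> S \<Longrightarrow> P p"
  shows "P p"
  using assms(1)
proof (induction rule: mp.span_induct_alt)
  case base
  show ?case by fact
next
  case (step c x y)
  then show ?case using assms(3-5) by blast
qed

definition mon_deg :: "('v \<Rightarrow>\<^sub>0 nat) \<Rightarrow> nat" where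
  "mon_deg m = (\<Sum>v\<in>keys m. lookup m v)"

lemma mon_deg_superset: "finite A \<Longrightarrow> keys m \<subseteq> A \<Longrightarrow> mon_deg m = (\<Sum>v\<in>A. lookup m v)"
  unfolding mon_deg_def by (rule sum.mono_neutral_left) (auto simp: in_keys_iff)

lemma mon_deg_add: "mon_deg (a + b) = mon_deg a + mon_deg b"
proof -
  have "mon_deg c = (\<Sum>v\<in>keys a \<union> keys b. lookup c v)" if "c \<in> {a, b, a + b}" for c
    using that by (intro mon_deg_superset) (auto simp: keys_nat_add)
  then show ?thesis by (simp add: lookup_add sum.distrib)
qed

lemma mon_deg_single [simp]: "mon_deg (single v k) = k"
  by (simp add: mon_deg_def)

text \<open>The \<open>\<theta> i\<close> are the candidate parameters and the \<open>y j\<close>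
  with 1 \<le> j < r the remaining coordinates; the index 0 is kept for the basis element 1. By
  \<open>rel\<close> the elements 1 and \<open>y j\<close> generate the ring as a module over
  k[\<theta>], and no degree is gained in the reduction. The monic \<open>f i\<close> are free, to
  be adapted later to a maximal ideal.\<close>

locale scroll_basis =
  fixes V :: "indet set" and I :: "'k::field mpol set" and \<theta> y :: "nat \<Rightarrow> 'k mpol" and d r :: nat
    and f :: "nat \<Rightarrow> 'k poly"
  assumes V: "finite V" and I: "ideal I (pol_ring V)" and r: "0 < r"
    and \<theta>: "\<And>i. i < d \<Longrightarrow> \<theta> i \<in> Pol V" and y: "\<And>j. y j \<in> Pol V"
    and vars: "\<And>v. v \<in> V \<Longrightarrow> var_poly v \<in> mp.span (\<theta> ` {..<d} \<union> y ` {1..<r})"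
    and rel: "\<And>j k. j \<in> {1..<r} \<Longrightarrow> k \<in> {1..<r} \<Longrightarrow>
      \<exists>l. (\<forall>i<d. l i \<in> mp.span (\<theta> ` {..<d} \<union> y ` {1..<r})) \<and> y j * y k - (\<Sum>i<d. \<theta> i * l i) \<in> I"
    and monic: "\<And>i. i < d \<Longrightarrow> lead_coeff (f i) = 1" and deg: "\<And>i. i < d \<Longrightarrow> 0 < degree (f i)"
begin

abbreviation "L \<equiv> mp.span (\<theta> ` {..<d} \<union> y ` {1..<r})"

definition F :: "nat \<Rightarrow> 'k mpol" where
  "F i = upoly_eval (\<theta> i) (f i)"

text \<open>The expansion of the exponent in base \<open>degree (f i)\<close> replaces the powers of
  \<open>\<theta> i\<close> by a basis of k[\<open>\<theta> i\<close>] in which multiplication by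
  \<open>F i\<close> merely raises the index by \<open>degree (f i)\<close>.\<close>

definition G1 :: "nat \<Rightarrow> nat \<Rightarrow> 'k mpol" where
  "G1 i b = F i ^ (b div degree (f i)) * \<theta> i ^ (b mod degree (f i))"

definition G :: "(nat \<Rightarrow>\<^sub>0 nat) \<times> nat \<Rightarrow> 'k mpol" where
  "G k = (\<Prod>i<d. G1 i (lookup (fst k) i)) * (if snd k = 0 then 1 else y (snd k))"

definition idx :: "((nat \<Rightarrow>\<^sub>0 nat) \<times> nat) set" where
  "idx = {(\<beta>, j). keys \<beta> \<subseteq> {..<d} \<and> j < r}"

definition siz :: "(nat \<Rightarrow>\<^sub>0 nat) \<times> nat \<Rightarrow> nat" where
  "siz k = mon_deg (fst k) + (if snd k = 0 then 0 else 1)"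

definition idxN :: "nat \<Rightarrow> ((nat \<Rightarrow>\<^sub>0 nat) \<times> nat) set" where
  "idxN N = {k \<in> idx. siz k \<le> N}"

text \<open>A filtration modulo I, not a grading: reducing powers of \<open>\<theta> i\<close> by
  the inhomogeneous \<open>f i\<close> produces terms of lower degree.\<close>

definition U :: "nat \<Rightarrow> 'k mpol set" where
  "U N = {p. \<exists>q\<in>mp.span (G ` idxN N). p - q \<in> I}"

lemmas ID = ideal_pol_ringD[OF I]

lemma U_base: "k \<in> idxN N \<Longrightarrow> G k \<in> U N"
  unfolding U_def using ID(2) by (intro CollectI bexI[of _ "G k"] mp.span_base) auto

lemma U_I: "p \<in> I \<Longrightarrow> p \<in> U N"
  unfolding U_def by (intro CollectI bexI[of _ 0] mp.span_zero) auto

lemma U_0: "0 \<in> U N"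
  by (rule U_I[OF ID(2)])

lemma U_add: "p \<in> U N \<Longrightarrow> q \<in> U N \<Longrightarrow> p + q \<in> U N"
proof -
  assume "p \<in> U N" "q \<in> U N"
  then obtain p' q' where *: "p' \<in> mp.span (G ` idxN N)" "q' \<in> mp.span (G ` idxN N)" "p - p' \<in> I" "q - q' \<in> I"
    by (auto simp: U_def)
  have "p + q - (p' + q') = (p - p') + (q - q')" by simp
  also have "\<dots> \<in> I" using ID(3)[OF *(3,4)] .
  finally show ?thesis using mp.span_add[OF *(1,2)] by (auto simp: U_def)
qed

lemma U_scale: "p \<in> U N \<Longrightarrow> const_poly c * p \<in> U N"
proof -
  assume "p \<in> U N"
  then obtain p' where *: "p' \<in> mp.span (G ` idxN N)" "p - p' \<in> I" by (auto simp: U_def)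
  have "const_poly c * p - const_poly c * p' \<in> I"
    using ID(4)[OF *(2), of "const_poly c"] by (simp add: algebra_simps)
  then show ?thesis using mp.span_scale[OF *(1)] by (auto simp: U_def)
qed

lemma U_sum: "(\<And>i. i \<in> A \<Longrightarrow> g i \<in> U N) \<Longrightarrow> sum g A \<in> U N"
  by (induction A rule: infinite_finite_induct) (auto intro: U_0 U_add)

lemma U_span: "p \<in> mp.span S \<Longrightarrow> (\<And>s. s \<in> S \<Longrightarrow> s * q \<in> U N) \<Longrightarrow> p * q \<in> U N"
  by (induction rule: span_induct_mp) (auto simp: U_0 distrib_right mult.assoc intro: U_add U_scale)

lemma U_mod: "p - q \<in> I \<Longrightarrow> q \<in> U N \<Longrightarrow> p \<in> U N"
  using U_add[of "p - q" N q] U_I by simp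

lemma U_mono: "M \<le> N \<Longrightarrow> U M \<subseteq> U N"
proof -
  assume "M \<le> N"
  then have "idxN M \<subseteq> idxN N" by (auto simp: idxN_def)
  then have "mp.span (G ` idxN M) \<subseteq> mp.span (G ` idxN N)" by (intro mp.span_mono image_mono)
  then show ?thesis by (auto simp: U_def)
qed

lemma U_cases:
  assumes "p \<in> U N" "a \<in> Pol V" "\<And>k. k \<in> idxN N \<Longrightarrow> a * G k \<in> U M"
  shows "a * p \<in> U M"
proof -
  obtain q where q: "q \<in> mp.span (G ` idxN N)" "p - q \<in> I" using assms(1) by (auto simp: U_def)
  have "q * a \<in> U M"
    using q(1) by (rule U_span) (use assms(3) in \<open>auto simp: mult.commute\<close>)
  then show ?thesis
    using U_mod[of "a * p" "a * q" M] ID(4)[OF q(2) assms(2)] by (simp add: algebra_simps)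
qed

lemma F_in_Pol: "i < d \<Longrightarrow> F i \<in> Pol V"
  unfolding F_def by (intro upoly_eval_in_Pol \<theta>)

lemma G_in_Pol: "G k \<in> Pol V"
  unfolding G_def G1_def using F_in_Pol \<theta> y by (auto intro!: Pol_mult Pol_prod Pol_power)

lemma U_in_Pol: "p \<in> U N \<Longrightarrow> p \<in> Pol V"
proof -
  assume "p \<in> U N"
  then obtain q where q: "q \<in> mp.span (G ` idxN N)" "p - q \<in> I" by (auto simp: U_def)
  have "q \<in> Pol V"
    using q(1) by (induction rule: span_induct_mp) (auto intro: Pol_add Pol_mult G_in_Pol)
  then have "(p - q) + q \<in> Pol V" using q(2) ID(1) by (intro Pol_add) auto
  then show ?thesis by simp
qed

lemma \<theta>_G1: "i < d \<Longrightarrow> \<theta> i * G1 i b \<in> mp.span (G1 i ` {..Suc b})"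
proof -
  assume i: "i < d"
  let ?m = "degree (f i)"
  have m: "0 < ?m" using deg[OF i] .
  show ?thesis
  proof (cases "Suc (b mod ?m) < ?m")
    case True
    then have "Suc b div ?m = b div ?m" "Suc b mod ?m = Suc (b mod ?m)"
      by (simp_all add: div_Suc mod_Suc)
    then have "\<theta> i * G1 i b = G1 i (Suc b)" by (simp add: G1_def mult_ac)
    then show ?thesis using mp.span_base[of "G1 i (Suc b)" "G1 i ` {..Suc b}"] by simp
  next
    case False
    \<comment> \<open>A carry occurs in the base expansion: the power of \<open>\<theta> i\<close>
      with exponent \<open>degree (f i)\<close> appears, and as \<open>f i\<close> is monic it is
      \<open>F i\<close> minus lower powers.\<close>
    then have eq: "Suc (b mod ?m) = ?m" using m mod_less_divisor[of ?m b] by linarith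
    define q where "q = b div ?m"
    have b: "Suc b = Suc q * ?m"
      using eq div_mult_mod_eq[of b ?m] unfolding q_def by (metis add_Suc_right add.commute mult_Suc)
    have "F i = (\<Sum>l<?m. const_poly (coeff (f i) l) * \<theta> i ^ l) + \<theta> i ^ ?m"
      using monic[OF i] by (simp add: F_def upoly_eval_def lessThan_Suc_atMost[symmetric])
    then have "\<theta> i ^ ?m = F i - (\<Sum>l<?m. const_poly (coeff (f i) l) * \<theta> i ^ l)" by simp
    moreover have "\<theta> i * G1 i b = F i ^ q * \<theta> i ^ Suc (b mod ?m)" by (simp add: G1_def q_def mult_ac)
    ultimately have "\<theta> i * G1 i b = F i ^ q * (F i - (\<Sum>l<?m. const_poly (coeff (f i) l) * \<theta> i ^ l))"
      unfolding eq by simp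
    then have "\<theta> i * G1 i b = F i ^ Suc q - (\<Sum>l<?m. const_poly (coeff (f i) l) * (F i ^ q * \<theta> i ^ l))"
      by (simp add: algebra_simps sum_distrib_left)
    also have "F i ^ Suc q = G1 i (Suc b)" unfolding b using m by (simp add: G1_def)
    also have "(\<Sum>l<?m. const_poly (coeff (f i) l) * (F i ^ q * \<theta> i ^ l)) =
      (\<Sum>l<?m. const_poly (coeff (f i) l) * G1 i (q * ?m + l))"
      by (intro sum.cong refl) (simp add: G1_def)
    also have "G1 i (Suc b) - \<dots> \<in> mp.span (G1 i ` {..Suc b})"
      unfolding b by (intro mp.span_diff mp.span_sum mp.span_scale mp.span_base imageI) auto
    finally show ?thesis .
  qed
qed

lemma \<theta>_G: "i < d \<Longrightarrow> k \<in> idxN N \<Longrightarrow> \<theta> i * G k \<in> U (Suc N)"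
proof -
  assume i: "i < d" and k: "k \<in> idxN N"
  obtain \<beta> j where kk: "k = (\<beta>, j)" by (cases k)
  have \<beta>: "keys \<beta> \<subseteq> {..<d}" "j < r" "mon_deg \<beta> + (if j = 0 then 0 else 1) \<le> N"
    using k by (auto simp: kk idxN_def idx_def siz_def)
  define b where "b = lookup \<beta> i"
  define \<beta>' where "\<beta>' = \<beta> - single i b"
  define H where "H = (\<Prod>i'\<in>{..<d} - {i}. G1 i' (lookup \<beta> i')) * (if j = 0 then 1 else y j)"
  have split: "\<beta> = \<beta>' + single i b"
    unfolding \<beta>'_def b_def by (subst add.commute, rule monomial_eq_add_diff) (simp add: lookup_single when_def)
  have look: "lookup (\<beta>' + single i c) i' = (if i' = i then c else lookup \<beta> i')" for c i'
    by (auto simp: \<beta>'_def b_def lookup_add lookup_minus lookup_single when_def)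
  have G: "G (\<beta>' + single i c, j) = G1 i c * H" for c
  proof -
    have "(\<Prod>i'<d. G1 i' (lookup (\<beta>' + single i c) i')) =
      G1 i c * (\<Prod>i'\<in>{..<d} - {i}. G1 i' (lookup \<beta> i'))"
      using i by (subst prod.remove[of _ i]) (auto simp: look intro!: prod.cong)
    then show ?thesis by (simp add: G_def H_def mult_ac)
  qed
  have inU: "G1 i c * H \<in> U (Suc N)" if "c \<le> Suc b" for c
  proof -
    have "keys (\<beta>' + single i c) \<subseteq> {..<d}"
      using \<beta>(1) i look[of c] by (auto simp: in_keys_iff subset_iff split: if_splits)
    moreover have "mon_deg (\<beta>' + single i c) \<le> Suc (mon_deg \<beta>)"
      using that unfolding split mon_deg_add by simp
    ultimately have "(\<beta>' + single i c, j) \<in> idxN (Suc N)"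
      using \<beta>(2,3) by (auto simp: idxN_def idx_def siz_def split: if_splits)
    from U_base[OF this] show ?thesis unfolding G .
  qed
  have "(\<theta> i * G1 i b) * H \<in> U (Suc N)"
    using \<theta>_G1[OF i] by (rule U_span) (use inU in auto)
  moreover have "G k = G1 i b * H" using G[of b] split kk by simp
  ultimately show ?thesis by (simp add: mult.assoc)
qed

lemma \<theta>_U: "i < d \<Longrightarrow> p \<in> U N \<Longrightarrow> \<theta> i * p \<in> U (Suc N)"
  by (rule U_cases) (auto intro: \<theta> \<theta>_G)

lemma L_G0:
  assumes "keys \<beta> \<subseteq> {..<d}" "l \<in> L"
  shows "l * G (\<beta>, 0) \<in> U (Suc (mon_deg \<beta>))"
  using assms(2)
proof (rule U_span)
  fix s assume "s \<in> \<theta> ` {..<d} \<union> y ` {1..<r}"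
  then consider i where "s = \<theta> i" "i < d" | j where "s = y j" "1 \<le> j" "j < r" by auto
  then show "s * G (\<beta>, 0) \<in> U (Suc (mon_deg \<beta>))"
  proof cases
    case 1
    then show ?thesis using \<theta>_G[of i "(\<beta>, 0)" "mon_deg \<beta>"] assms(1) r by (simp add: idxN_def idx_def siz_def)
  next
    case 2
    then have "(\<beta>, j) \<in> idxN (Suc (mon_deg \<beta>))" using assms(1) by (simp add: idxN_def idx_def siz_def)
    from U_base[OF this] show ?thesis using 2 by (simp add: G_def mult_ac)
  qed
qed

lemma y_G: "j \<in> {1..<r} \<Longrightarrow> k \<in> idxN N \<Longrightarrow> y j * G k \<in> U (Suc N)"
proof -
  assume j: "j \<in> {1..<r}" and k: "k \<in> idxN N"
  obtain \<beta> j' where kk: "k = (\<beta>, j')" by (cases k)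
  have \<beta>: "keys \<beta> \<subseteq> {..<d}" "j' < r" "mon_deg \<beta> + (if j' = 0 then 0 else 1) \<le> N"
    using k by (auto simp: kk idxN_def idx_def siz_def)
  show ?thesis
  proof (cases "j' = 0")
    case True
    have "(\<beta>, j) \<in> idxN (Suc N)" using j \<beta> True by (auto simp: idxN_def idx_def siz_def)
    from U_base[OF this] show ?thesis using j True kk by (simp add: G_def mult_ac)
  next
    case False
    then have j': "j' \<in> {1..<r}" using \<beta>(2) by simp
    obtain l where l: "\<forall>i<d. l i \<in> L" "y j * y j' - (\<Sum>i<d. \<theta> i * l i) \<in> I" using rel[OF j j'] by blast
    have Gk: "G k = y j' * G (\<beta>, 0)" using False kk by (simp add: G_def mult_ac)
    \<comment> \<open>The factor \<open>y j'\<close> accounts for 1 in the size of \<open>k\<close>.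
      So \<open>l i * G (\<beta>, 0)\<close> has size at most N, and the factor
      \<open>\<theta> i\<close> brings it to \<open>Suc N\<close>, as required.\<close>
    have N: "N = Suc (N - 1)" "mon_deg \<beta> \<le> N - 1" using \<beta>(3) False by auto
    have "(\<Sum>i<d. \<theta> i * (l i * G (\<beta>, 0))) \<in> U (Suc N)"
    proof (rule U_sum)
      fix i assume i: "i \<in> {..<d}"
      have "l i * G (\<beta>, 0) \<in> U N" using L_G0[OF \<beta>(1), of "l i"] l(1) i U_mono[of "Suc (mon_deg \<beta>)" N] N by auto
      then show "\<theta> i * (l i * G (\<beta>, 0)) \<in> U (Suc N)" using i by (intro \<theta>_U) auto
    qed
    moreover have "y j * G k - (\<Sum>i<d. \<theta> i * (l i * G (\<beta>, 0))) \<in> I"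
    proof -
      have "y j * G k - (\<Sum>i<d. \<theta> i * (l i * G (\<beta>, 0))) = G (\<beta>, 0) * (y j * y j' - (\<Sum>i<d. \<theta> i * l i))"
        unfolding Gk by (simp add: algebra_simps sum_distrib_left)
      then show ?thesis using ID(4)[OF l(2) G_in_Pol] by simp
    qed
    ultimately show ?thesis by (rule U_mod[rotated])
  qed
qed

lemma L_U: "l \<in> L \<Longrightarrow> p \<in> U N \<Longrightarrow> l * p \<in> U (Suc N)"
proof -
  assume l: "l \<in> L" and p: "p \<in> U N"
  show ?thesis
    using l
  proof (rule U_span)
    fix s assume "s \<in> \<theta> ` {..<d} \<union> y ` {1..<r}"
    then consider i where "s = \<theta> i" "i < d" | j where "s = y j" "j \<in> {1..<r}" by auto
    then show "s * p \<in> U (Suc N)"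
    proof cases
      case 1
      then show ?thesis using \<theta>_U p by simp
    next
      case 2
      then show ?thesis using U_cases[OF p y[of j] y_G[OF 2(2)]] by simp
    qed
  qed
qed

lemma one_in_U: "1 \<in> U 0"
proof -
  have "(0, 0) \<in> idxN 0" using r by (simp add: idxN_def idx_def siz_def mon_deg_def)
  from U_base[OF this] show ?thesis by (simp add: G_def G1_def)
qed

lemma mon_eval_in_U:
  fixes m :: "'i \<Rightarrow>\<^sub>0 nat"
  assumes "\<And>v. v \<in> keys m \<Longrightarrow> g v \<in> L"
  shows "mon_eval g m \<in> U (mon_deg m)"
proof -
  have *: "p ^ n * q \<in> U (n + N)" if "p \<in> L" "q \<in> U N" for p q n N
    using that(2) by (induction n) (auto simp: mult.assoc intro: L_U[OF that(1)])
  have "(\<Prod>v\<in>A. g v ^ lookup m v) \<in> U (\<Sum>v\<in>A. lookup m v)" if "finite A" "A \<subseteq> keys m" for A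
    using that by (induction A) (auto intro!: * one_in_U assms)
  from this[of "keys m"] show ?thesis by (simp add: mon_eval_def mon_deg_def)
qed

lemma Pol_in_U: "p \<in> Pol V \<Longrightarrow> \<exists>N. p \<in> U N"
proof (induction p rule: Pol_induct)
  case (single m c)
  have "mon_eval var_poly m \<in> U (mon_deg m)" using single vars by (intro mon_eval_in_U) blast
  then have "const_poly c * mon_eval var_poly m \<in> U (mon_deg m)" by (rule U_scale)
  then show ?case unfolding mon_eval_var_poly single_eq_const_mult[symmetric] by blast
next
  case (add p q)
  then obtain M N where "p \<in> U M" "q \<in> U N" by blast
  then have "p \<in> U (max M N)" "q \<in> U (max M N)"
    using U_mono[of M "max M N"] U_mono[of N "max M N"] by auto
  then show ?case using U_add by blast
qed

lemma Pol_span: "p \<in> Pol V \<Longrightarrow> \<exists>q\<in>mp.span (G ` idx). p - q \<in> I"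
proof -
  assume "p \<in> Pol V"
  then obtain N where "p \<in> U N" using Pol_in_U by blast
  then obtain q where "q \<in> mp.span (G ` idxN N)" "p - q \<in> I" by (auto simp: U_def)
  moreover have "mp.span (G ` idxN N) \<subseteq> mp.span (G ` idx)"
    by (intro mp.span_mono image_mono) (auto simp: idxN_def)
  ultimately show ?thesis by blast
qed

lemma finite_idxN: "finite (idxN N)"
proof (rule finite_subset)
  show "idxN N \<subseteq> box {..<d} N \<times> {..<r}"
  proof
    fix k assume k: "k \<in> idxN N"
    have "lookup (fst k) v \<le> mon_deg (fst k)" for v
    proof (cases "v \<in> keys (fst k)")
      case True
      then show ?thesis unfolding mon_deg_def by (intro member_le_sum) auto
    qed (simp add: in_keys_iff)
    moreover have "mon_deg (fst k) \<le> N" using k by (auto simp: idxN_def siz_def)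
    ultimately have "lookup (fst k) v \<le> N" for v using order_trans by blast
    then show "k \<in> box {..<d} N \<times> {..<r}"
      using k by (cases k) (auto simp: idxN_def idx_def box_def)
  qed
  show "finite (box {..<d} N \<times> {..<r})" by (simp add: finite_box)
qed

end

text \<open>
  Linear independence of the spanning set comes from a dimension count: \<open>\<pi>\<close> maps the polynomials of
  degree at most \<open>N\<close> onto a space of dimension at least the number of elements of the spanning set.
\<close>

locale scroll_basis_indep = scroll_basis +
  fixes \<pi> :: "'a mpol \<Rightarrow> 'a mpol" and E :: "nat \<Rightarrow> 'a mpol set"
  assumes \<pi>: "comm_ring_hom \<pi>" "\<And>c. \<pi> (const_poly c) = const_poly c"
    and \<pi>_I: "\<And>p. p \<in> I \<Longrightarrow> \<pi> p = 0"
    and E: "\<And>N. mp.independent (E N)" "\<And>N. E N \<subseteq> \<pi> ` U N" "\<And>N. card (idxN N) \<le> card (E N)"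
begin

sublocale \<pi>: comm_ring_hom \<pi> by (rule \<pi>)

lemma \<pi>_span: "p \<in> mp.span S \<Longrightarrow> \<pi> p \<in> mp.span (\<pi> ` S)"
  by (induction rule: span_induct_mp)
    (auto simp: \<pi>.hom_add \<pi>.hom_mult \<pi>(2) intro: mp.span_zero mp.span_add mp.span_scale mp.span_base)

lemma indep_N: "inj_on (\<lambda>k. \<pi> (G k)) (idxN N) \<and> mp.independent ((\<lambda>k. \<pi> (G k)) ` idxN N)"
proof (rule mp.spanning_family_independent[OF finite_idxN E(1) _ E(3)])
  show "E N \<subseteq> mp.span ((\<lambda>k. \<pi> (G k)) ` idxN N)"
  proof
    fix e assume "e \<in> E N"
    then obtain p where "e = \<pi> p" "p \<in> U N" using E(2)[of N] by blast
    then obtain q where p: "e = \<pi> p" "q \<in> mp.span (G ` idxN N)" "p - q \<in> I" by (auto simp: U_def)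
    have "\<pi> p = \<pi> q" using \<pi>_I[OF p(3)] by (simp add: \<pi>.hom_minus)
    then show "e \<in> mp.span ((\<lambda>k. \<pi> (G k)) ` idxN N)" using \<pi>_span[OF p(2)] p(1) by (simp add: image_image)
  qed
qed

lemma indep: "inj_on (\<lambda>k. \<pi> (G k)) idx" "mp.independent ((\<lambda>k. \<pi> (G k)) ` idx)"
proof -
  have in_N: "k \<in> idx \<Longrightarrow> siz k \<le> N \<Longrightarrow> k \<in> idxN N" for k N by (simp add: idxN_def)
  show "inj_on (\<lambda>k. \<pi> (G k)) idx"
  proof (rule inj_onI)
    fix k k' assume k: "k \<in> idx" "k' \<in> idx" "\<pi> (G k) = \<pi> (G k')"
    show "k = k'"
      using inj_onD[OF conjunct1[OF indep_N[of "max (siz k) (siz k')"]] k(3)] k(1,2) in_N by simp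
  qed
  show "mp.independent ((\<lambda>k. \<pi> (G k)) ` idx)"
    unfolding mp.independent_explicit_finite_subsets
  proof (intro allI impI)
    fix S u assume S: "S \<subseteq> (\<lambda>k. \<pi> (G k)) ` idx" "finite S" "(\<Sum>v\<in>S. const_poly (u v) * v) = 0"
    obtain K where K: "K \<subseteq> idx" "finite K" "S = (\<lambda>k. \<pi> (G k)) ` K"
      using finite_subset_image[OF S(2,1)] by blast
    have "K \<subseteq> idxN (Max (insert 0 (siz ` K)))" using K in_N by auto
    then have "S \<subseteq> (\<lambda>k. \<pi> (G k)) ` idxN (Max (insert 0 (siz ` K)))" using K(3) by blast
    then have "mp.independent S" using indep_N mp.independent_mono by blast
    then show "\<forall>v\<in>S. u v = 0" using mp.independentD[OF _ S(2) subset_refl S(3)] by blast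
  qed
qed

lemma span_idx_obtain:
  assumes "q \<in> mp.span (G ` A)" "A \<subseteq> idx"
  obtains K c where "finite K" "K \<subseteq> A" "q = (\<Sum>k\<in>K. const_poly (c k) * G k)"
proof -
  obtain t u where t: "finite t" "t \<subseteq> G ` A" "q = (\<Sum>v\<in>t. const_poly (u v) * v)"
    using assms(1) unfolding mp.span_explicit by blast
  obtain K where K: "K \<subseteq> A" "finite K" "t = G ` K" using finite_subset_image[OF t(1,2)] by blast
  have "inj_on G K"
  proof (rule inj_onI)
    fix k k' assume k: "k \<in> K" "k' \<in> K" "G k = G k'"
    then have "k \<in> idx" "k' \<in> idx" using K(1) assms(2) by blast+
    then show "k = k'" using inj_onD[OF indep(1), of k k'] k(3) by simp
  qed
  then have "q = (\<Sum>k\<in>K. const_poly (u (G k)) * G k)" unfolding t(3) K(3) by (simp add: sum.reindex)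
  then show ?thesis by (rule that[OF K(2,1)])
qed

text \<open>Comparison of coefficients in the basis. The map \<sigma> is the identity for computing
  the kernel of \<pi>, and \<open>shift i\<close> for multiplication by \<open>F i\<close>.\<close>

lemma indep_coeff:
  assumes K: "finite K" "K \<subseteq> idx" "inj_on \<sigma> K" "\<sigma> ` K \<subseteq> idx" and A: "A \<subseteq> idx"
    and s: "(\<Sum>k\<in>K. const_poly (c k) * \<pi> (G (\<sigma> k))) \<in> mp.span ((\<lambda>k. \<pi> (G k)) ` A)"
    and k0: "k0 \<in> K" "c k0 \<noteq> 0"
  shows "\<sigma> k0 \<in> A"
proof (rule ccontr)
  let ?D = "\<lambda>k. \<pi> (G k)"
  assume notA: "\<sigma> k0 \<notin> A"
  let ?T = "?D ` idx - {?D (\<sigma> k0)}"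
  have ne: "?D k \<in> ?T" if "k \<in> idx" "k \<noteq> \<sigma> k0" for k
    using that inj_onD[OF indep(1), of k "\<sigma> k0"] K(4) k0(1) by auto
  have "?D ` A \<subseteq> ?T"
  proof (intro image_subsetI ne)
    fix k assume "k \<in> A"
    then show "k \<in> idx" "k \<noteq> \<sigma> k0" using A notA by blast+
  qed
  then have 1: "(\<Sum>k\<in>K. const_poly (c k) * ?D (\<sigma> k)) \<in> mp.span ?T" using s mp.span_mono by blast
  have 2: "(\<Sum>k\<in>K - {k0}. const_poly (c k) * ?D (\<sigma> k)) \<in> mp.span ?T"
  proof (intro mp.span_sum mp.span_scale mp.span_base ne)
    fix k assume "k \<in> K - {k0}"
    then show "\<sigma> k \<in> idx" "\<sigma> k \<noteq> \<sigma> k0" using K(3,4) k0(1) by (auto dest: inj_onD)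
  qed
  have "const_poly (c k0) * ?D (\<sigma> k0) \<in> mp.span ?T"
    using mp.span_diff[OF 1 2] K(1) k0(1) by (simp add: sum.remove)
  then have "const_poly (inverse (c k0)) * (const_poly (c k0) * ?D (\<sigma> k0)) \<in> mp.span ?T" by (rule mp.span_scale)
  then have "?D (\<sigma> k0) \<in> mp.span ?T"
    using k0(2) by (simp flip: mult.assoc const_poly.hom_mult)
  then show False using indep(2) K(4) k0(1) mp.dependent_def by blast
qed

lemma ker_\<pi>: "p \<in> Pol V \<Longrightarrow> \<pi> p = 0 \<Longrightarrow> p \<in> I"
proof -
  assume p: "p \<in> Pol V" "\<pi> p = 0"
  obtain q where q: "q \<in> mp.span (G ` idx)" "p - q \<in> I" using Pol_span[OF p(1)] by blast
  from span_idx_obtain[OF q(1) subset_refl]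
  obtain K c where K: "finite K" "K \<subseteq> idx" "q = (\<Sum>k\<in>K. const_poly (c k) * G k)" .
  have "\<pi> q = 0" using \<pi>_I[OF q(2)] p(2) by (simp add: \<pi>.hom_minus)
  then have "(\<Sum>k\<in>K. const_poly (c k) * \<pi> (G (id k))) \<in> mp.span ((\<lambda>k. \<pi> (G k)) ` {})"
    by (simp add: K(3) \<pi>.hom_sum \<pi>.hom_mult \<pi>(2))
  note sp = this
  have "c k = 0" if "k \<in> K" for k
  proof (rule ccontr)
    assume "c k \<noteq> 0"
    from indep_coeff[OF K(1,2) _ _ _ sp that this] K(2) show False by simp
  qed
  then have "q = 0" unfolding K(3) by simp
  then show "p \<in> I" using q(2) by simp
qed

definition shift :: "nat \<Rightarrow> (nat \<Rightarrow>\<^sub>0 nat) \<times> nat \<Rightarrow> (nat \<Rightarrow>\<^sub>0 nat) \<times> nat" where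
  "shift i k = (fst k + single i (degree (f i)), snd k)"

lemma F_mult_G: "i < d \<Longrightarrow> F i * G k = G (shift i k)"
proof -
  assume i: "i < d"
  have "(\<Prod>i'<d. G1 i' (lookup (fst k + single i (degree (f i))) i')) = F i * (\<Prod>i'<d. G1 i' (lookup (fst k) i'))"
  proof -
    have "G1 i' (lookup (fst k + single i (degree (f i))) i') = (if i' = i then F i else 1) * G1 i' (lookup (fst k) i')" for i'
      using deg[OF i] by (auto simp: G1_def lookup_add lookup_single when_def)
    then show ?thesis using i by (simp add: prod.distrib)
  qed
  then show ?thesis by (simp add: G_def shift_def mult_ac)
qed

lemma shift_idx: "i < d \<Longrightarrow> k \<in> idx \<Longrightarrow> shift i k \<in> idx"
  by (auto simp: idx_def shift_def keys_nat_add split: if_splits)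

lemma inj_shift: "inj_on (shift i) A"
  by (auto simp: inj_on_def shift_def prod_eq_iff)

text \<open>The indices of basis elements visibly divisible by one of \<open>F 0\<close>, ...,
  \<open>F (i - 1)\<close>; modulo I these elements span the ideal generated by those
  \<open>F\<close>.\<close>

definition bad :: "nat \<Rightarrow> ((nat \<Rightarrow>\<^sub>0 nat) \<times> nat) set" where
  "bad i = {k \<in> idx. \<exists>i'<i. degree (f i') \<le> lookup (fst k) i'}"

lemma bad_unshift:
  assumes "k \<in> bad i" "i \<le> d"
  obtains i' k' where "i' < i" "k' \<in> idx" "k = shift i' k'"
proof -
  obtain i' where i': "i' < i" "degree (f i') \<le> lookup (fst k) i'" using assms(1) by (auto simp: bad_def)
  define k' where "k' = (fst k - single i' (degree (f i')), snd k)"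
  have "fst k = single i' (degree (f i')) + (fst k - single i' (degree (f i')))"
    using i'(2) by (intro monomial_eq_add_diff) (auto simp: lookup_single when_def)
  then have "k = shift i' k'" by (simp add: shift_def k'_def prod_eq_iff add.commute)
  moreover have "k' \<in> idx"
    using assms(1) by (auto simp: bad_def idx_def k'_def in_keys_iff lookup_minus subset_iff)
  ultimately show ?thesis using that i'(1) by blast
qed

text \<open>Multiplication by \<open>F i\<close> is an injective shift of the basis that changes
  only the exponent number \<open>i\<close>, while being bad concerns only smaller exponents. Hence
  if all indices occurring in \<open>F i * a\<close> are bad, so are those occurring in
  \<open>a\<close>.\<close>

lemma regular:
  assumes i: "i < d" and a: "a \<in> Pol V" and b: "b \<in> genideal (pol_ring V) (F ` {..<i})" and ab: "F i * a - b \<in> I"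
  shows "\<exists>b\<in>genideal (pol_ring V) (F ` {..<i}). a - b \<in> I"
proof -
  interpret R: cring "pol_ring V :: 'a mpol ring" by (rule cring_pol_ring)
  have FV: "F ` {..<i} \<subseteq> carrier (pol_ring V)" using F_in_Pol i by auto
  note gen = ideal_pol_ringD[OF R.genideal_ideal[OF FV]]
  \<comment> \<open>The polynomials spanned modulo I by bad basis elements. Z is shown to be an
    ideal containing the given \<open>F\<close>, so it contains the ideal that they
    generate.\<close>
  define Z where "Z = {p \<in> Pol V. \<exists>q\<in>mp.span (G ` bad i). p - q \<in> I}"
  have bad_idx: "bad i \<subseteq> idx" by (auto simp: bad_def)
  have F_span: "F i' * q \<in> mp.span (G ` bad i)" if i': "i' < i" and q: "q \<in> mp.span (G ` idx)" for i' q
    using q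
  proof (induction rule: span_induct_mp)
    case (base p)
    then obtain k where k: "p = G k" "k \<in> idx" by blast
    have "shift i' k \<in> bad i"
      using shift_idx[of i' k] k i' i by (auto simp: bad_def shift_def lookup_add)
    then show ?case using F_mult_G[of i' k] k i' i by (auto intro: mp.span_base)
  qed (auto simp: distrib_left mult.left_commute[of "F i'"] intro: mp.span_zero mp.span_add mp.span_scale)
  have FZ: "F i' * p \<in> Z" if i': "i' < i" and p: "p \<in> Pol V" for i' p
  proof -
    obtain q where q: "q \<in> mp.span (G ` idx)" "p - q \<in> I" using Pol_span[OF p] by blast
    have "F i' * p - F i' * q \<in> I"
      using ID(4)[OF q(2), of "F i'"] F_in_Pol i' i by (simp add: algebra_simps)
    then show ?thesis
      unfolding Z_def using F_span[OF i' q(1)] F_in_Pol i' p i by (auto intro: Pol_mult)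
  qed
  have Z_add: "p + q \<in> Z" if pq: "p \<in> Z" "q \<in> Z" for p q
  proof -
    obtain p' q' where *: "p' \<in> mp.span (G ` bad i)" "q' \<in> mp.span (G ` bad i)" "p - p' \<in> I" "q - q' \<in> I"
      using pq by (auto simp: Z_def)
    have "p + q - (p' + q') = (p - p') + (q - q')" by simp
    also have "\<dots> \<in> I" using ID(3)[OF *(3,4)] .
    finally show ?thesis using mp.span_add[OF *(1,2)] that by (auto simp: Z_def intro: Pol_add)
  qed
  have Z_I: "p \<in> Z" if "p \<in> I" for p
    using that ID(1) mp.span_zero[of "G ` bad i"] by (auto simp: Z_def intro!: bexI[of _ 0])
  have "ideal Z (pol_ring V)"
  proof (rule ideal_pol_ringI)
    show "Z \<subseteq> Pol V" "0 \<in> Z" using Z_I[OF ID(2)] by (auto simp: Z_def)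
    fix p c :: "'a mpol" assume p: "p \<in> Z" and c: "c \<in> Pol V"
    then obtain q where q: "q \<in> mp.span (G ` bad i)" "p - q \<in> I" by (auto simp: Z_def)
    have "c * q \<in> Z"
      using q(1)
    proof (induction rule: span_induct_mp)
      case (base s)
      then obtain k where k: "s = G k" "k \<in> bad i" by blast
      from bad_unshift[OF k(2)] i obtain i' k' where k': "i' < i" "k' \<in> idx" "k = shift i' k'" by auto
      have "c * s = F i' * (c * G k')" using F_mult_G[of i' k'] k' i k(1) by (simp add: mult_ac)
      then show ?case using FZ[OF k'(1) Pol_mult[OF c G_in_Pol]] by (simp only:)
    next
      case (scale e s)
      then obtain t where t: "t \<in> mp.span (G ` bad i)" "c * s - t \<in> I" "c * s \<in> Pol V" by (auto simp: Z_def)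
      have "const_poly e * (c * s) - const_poly e * t \<in> I"
        using ID(4)[OF t(2), of "const_poly e"] by (simp add: right_diff_distrib)
      then have "const_poly e * (c * s) \<in> Z"
        unfolding Z_def using mp.span_scale[OF t(1)] Pol_mult[OF const_poly_in_Pol t(3)] by blast
      then show ?case by (simp add: mult_ac)
    qed (use Z_add Z_I[OF ID(2)] in \<open>auto simp: distrib_left\<close>)
    moreover have "c * (p - q) \<in> Z" using Z_I ID(4)[OF q(2) c] by blast
    ultimately have "c * q + c * (p - q) \<in> Z" by (rule Z_add)
    then show "c * p \<in> Z" by (simp add: algebra_simps)
  qed (rule Z_add)
  moreover have "F ` {..<i} \<subseteq> Z" using FZ[of _ 1] by auto
  ultimately have "b \<in> Z" using R.genideal_minimal b by blast
  then obtain q where q: "q \<in> mp.span (G ` bad i)" "b - q \<in> I" by (auto simp: Z_def)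
  obtain a' where a': "a' \<in> mp.span (G ` idx)" "a - a' \<in> I" using Pol_span[OF a] by blast
  from span_idx_obtain[OF a'(1) subset_refl]
  obtain K c where K: "finite K" "K \<subseteq> idx" "a' = (\<Sum>k\<in>K. const_poly (c k) * G k)" .
  have "\<pi> (F i * a') = \<pi> q"
  proof -
    have "\<pi> a = \<pi> a'" "\<pi> (F i * a) = \<pi> b" "\<pi> b = \<pi> q"
      using \<pi>_I[OF a'(2)] \<pi>_I[OF ab] \<pi>_I[OF q(2)] by (simp_all add: \<pi>.hom_minus)
    then show ?thesis by (simp add: \<pi>.hom_mult)
  qed
  moreover have "F i * a' = (\<Sum>k\<in>K. const_poly (c k) * G (shift i k))"
    unfolding K(3) by (simp add: sum_distrib_left mult.left_commute[of "F i"] F_mult_G[OF i])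
  ultimately have "(\<Sum>k\<in>K. const_poly (c k) * \<pi> (G (shift i k))) = \<pi> q"
    by (simp add: \<pi>.hom_sum \<pi>.hom_mult \<pi>(2))
  then have sp: "(\<Sum>k\<in>K. const_poly (c k) * \<pi> (G (shift i k))) \<in> mp.span ((\<lambda>k. \<pi> (G k)) ` bad i)"
    using \<pi>_span[OF q(1)] by (simp add: image_image)
  have trm: "const_poly (c k) * G k \<in> genideal (pol_ring V) (F ` {..<i})" if k: "k \<in> K" for k
  proof (cases "c k = 0")
    case False
    have "shift i k \<in> bad i"
    proof (rule indep_coeff[OF K(1,2) inj_shift _ bad_idx sp k False])
      show "shift i ` K \<subseteq> idx" using K(2) shift_idx[OF i] by blast
    qed
    then have "k \<in> bad i" using K(2) k by (auto simp: bad_def shift_def lookup_add lookup_single when_def)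
    from bad_unshift[OF this] i obtain i' k' where k': "i' < i" "k' \<in> idx" "k = shift i' k'" by auto
    have "const_poly (c k) * G k = (const_poly (c k) * G k') * F i'"
      using F_mult_G[of i' k'] k' i by (simp add: mult_ac)
    also have "\<dots> \<in> genideal (pol_ring V) (F ` {..<i})"
      using R.genideal_self[OF FV] k'(1) by (intro gen(4) Pol_mult[OF const_poly_in_Pol G_in_Pol]) auto
    finally show ?thesis .
  qed (use gen(2) in simp)
  have sum: "sum e A \<in> genideal (pol_ring V) (F ` {..<i})"
    if "\<And>k. k \<in> A \<Longrightarrow> e k \<in> genideal (pol_ring V) (F ` {..<i})" for e :: "(nat \<Rightarrow>\<^sub>0 nat) \<times> nat \<Rightarrow> 'a mpol" and A
    using that by (induction A rule: infinite_finite_induct) (auto intro: gen(2,3))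
  have "a' \<in> genideal (pol_ring V) (F ` {..<i})" unfolding K(3) by (rule sum) (rule trm)
  then show ?thesis using a'(2) by blast
qed

end

section \<open>Scroll coordinates\<close>

text \<open>The entry number c is the pair of the block and the position within it of the coordinate
  numbered c in \<open>scroll_tops\<close>.\<close>

fun scroll_coords :: "nat \<Rightarrow> nat list \<Rightarrow> (nat \<times> nat) list" where
  "scroll_coords i [] = []"
| "scroll_coords i (a # as) = map (Pair i) [0..<Suc a] @ scroll_coords (Suc i) as"

lemma length_scroll_tops: "length (scroll_tops m as) = sum_list as"
  by (induction m as rule: scroll_tops.induct) auto

lemma length_scroll_coords: "length (scroll_coords i as) = sum_list as + length as"
  by (induction i as rule: scroll_coords.induct) auto

lemma scroll_tops_bounds:
  "c \<in> set (scroll_tops m as) \<Longrightarrow> m \<le> c \<and> Suc c < m + sum_list as + length as"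
  by (induction m as rule: scroll_tops.induct) fastforce+

lemma sorted_scroll_tops: "sorted_wrt (<) (scroll_tops m as)"
  by (induction m as rule: scroll_tops.induct)
    (auto simp: sorted_wrt_append dest!: scroll_tops_bounds)

lemma set_scroll_coords: "set (scroll_coords i as) = {(i + b, k) | b k. b < length as \<and> k \<le> as ! b}"
proof (induction i as rule: scroll_coords.induct)
  case (2 i a as)
  have "{(i + b, k) | b k. b < length (a # as) \<and> k \<le> (a # as) ! b} =
    {(i, k) | k. k \<le> a} \<union> {(Suc i + b, k) | b k. b < length as \<and> k \<le> as ! b}" (is "?A = ?B \<union> ?C")
  proof (intro equalityI subsetI)
    fix p assume "p \<in> ?A"
    then obtain b k where "p = (i + b, k)" "b < length (a # as)" "k \<le> (a # as) ! b" by blast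
    then show "p \<in> ?B \<union> ?C" by (cases b) auto
  next
    fix p assume "p \<in> ?B \<union> ?C"
    then show "p \<in> ?A"
    proof
      assume "p \<in> ?B"
      then obtain k where "p = (i, k)" "k \<le> a" by blast
      then have "p = (i + 0, k) \<and> 0 < length (a # as) \<and> k \<le> (a # as) ! 0" by simp
      then show ?thesis by blast
    next
      assume "p \<in> ?C"
      then obtain b k where "p = (Suc i + b, k)" "b < length as" "k \<le> as ! b" by blast
      then show ?thesis by (auto intro!: exI[of _ "Suc b"])
    qed
  qed
  moreover have "set (map (Pair i) [0..<Suc a]) = {(i, k) | k. k \<le> a}" by (auto simp: less_Suc_eq_le)
  ultimately show ?case unfolding scroll_coords.simps set_append 2 by (simp only:)
qed simp

lemma distinct_scroll_coords: "distinct (scroll_coords i as)"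
  by (induction i as rule: scroll_coords.induct)
    (auto simp: distinct_map inj_on_def set_scroll_coords)

lemma scroll_tops_coords:
  "c \<in> set (scroll_tops m as) \<Longrightarrow> \<exists>i k. scroll_coords i0 as ! (c - m) = (i, k) \<and>
    scroll_coords i0 as ! (Suc c - m) = (i, Suc k) \<and> k < as ! (i - i0)"
proof (induction m as arbitrary: i0 rule: scroll_tops.induct)
  case (2 m a as)
  show ?case
  proof (cases "c < m + a")
    case True
    then have "m \<le> c" using 2(2) scroll_tops_bounds[of c m "a # as"] by simp
    define e where "e = c - m"
    have e: "c - m = e" "Suc c - m = Suc e" "e < a" using True \<open>m \<le> c\<close> by (auto simp: e_def)
    show ?thesis
      unfolding e(1,2) using e(3) by (auto simp: nth_append simp del: upt_Suc)
  next
    case False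
    then have c: "c \<in> set (scroll_tops (m + a + 1) as)" using 2(2) by auto
    then have ge: "m + a + 1 \<le> c" using scroll_tops_bounds by blast
    from 2(1)[OF c, of "Suc i0"] obtain i k where
      ik: "scroll_coords (Suc i0) as ! (c - (m + a + 1)) = (i, k)"
      "scroll_coords (Suc i0) as ! (Suc c - (m + a + 1)) = (i, Suc k)" "k < as ! (i - Suc i0)" by blast
    have "c - (m + a + 1) < length (scroll_coords (Suc i0) as)"
      unfolding length_scroll_coords using scroll_tops_bounds[OF c] by linarith
    then have "(i, k) \<in> set (scroll_coords (Suc i0) as)" using ik(1) nth_mem by metis
    then have "Suc i0 \<le> i" by (auto simp: set_scroll_coords)
    have "i - i0 = Suc (i - Suc i0)" using \<open>Suc i0 \<le> i\<close> by simp
    then have "k < (a # as) ! (i - i0)" using ik(3) by simp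
    moreover have "scroll_coords i0 (a # as) ! e = scroll_coords (Suc i0) as ! (e - Suc a)" if "Suc a \<le> e" for e
      using that by (simp add: nth_append del: upt_Suc)
    then have "scroll_coords i0 (a # as) ! (e - m) = scroll_coords (Suc i0) as ! (e - (m + a + 1))" if "c \<le> e" for e
      using that ge by (simp del: scroll_coords.simps)
    then have "scroll_coords i0 (a # as) ! (c - m) = (i, k)" "scroll_coords i0 (a # as) ! (Suc c - m) = (i, Suc k)"
      using ik by (simp_all del: scroll_coords.simps)
    ultimately show ?thesis by blast
  qed
qed simp

lemma const_poly_mult_sum:
  "const_poly a * (\<Sum>l\<in>A. const_poly (f l) * q l) = (\<Sum>l\<in>A. const_poly (a * f l) * q l)"
  by (simp only: sum_distrib_left const_poly.hom_mult mult.assoc)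

text \<open>The matrices \<open>g\<close> and \<open>h\<close> are mutually inverse changes of
  coordinates. Two default values spare case distinctions: \<open>x c = 0\<close> beyond the last
  coordinate, and \<open>\<tau> j = n\<close> beyond the last column, so that the last block also
  has a zero successor.\<close>

locale scroll_ring =
  fixes as :: "nat list" and n :: nat and g h :: "nat \<Rightarrow> nat \<Rightarrow> 'k::field" and I :: "'k mpol set"
  assumes r_pos: "0 < sum_list as" and n: "sum_list as + length as = n"
    and gh: "\<And>c c'. c < n \<Longrightarrow> c' < n \<Longrightarrow> (\<Sum>l<n. g c l * h l c') = (if c = c' then 1 else 0)"
    and hg: "\<And>l l'. l < n \<Longrightarrow> l' < n \<Longrightarrow> (\<Sum>c<n. h l c * g c l') = (if l = l' then 1 else 0)"
  fixes x :: "nat \<Rightarrow> 'k mpol"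
  defines "x c \<equiv> (if c < n then \<Sum>l<n. const_poly (g c l) * var_poly (Vt l) else 0)"
  fixes \<tau> :: "nat \<Rightarrow> nat"
  defines "\<tau> j \<equiv> (if j < sum_list as then scroll_tops 0 as ! j else n)"
  assumes I: "I = genideal (kt n)
    {x (\<tau> j) * x (Suc (\<tau> k)) - x (Suc (\<tau> j)) * x (\<tau> k) | j k. j < k \<and> k < sum_list as}"
begin

abbreviation "s \<equiv> length as"
abbreviation "r \<equiv> sum_list as"

definition tops :: "nat set" where
  "tops = set (scroll_tops 0 as)"

lemma tops_eq: "tops = \<tau> ` {..<r}"
  unfolding tops_def \<tau>_def by (auto simp: set_conv_nth length_scroll_tops)

lemma \<tau>_bound: "j < r \<Longrightarrow> Suc (\<tau> j) < n"
  using scroll_tops_bounds[of "\<tau> j" 0 as] n nth_mem[of j "scroll_tops 0 as"]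
  by (simp add: \<tau>_def length_scroll_tops)

lemma \<tau>_mono: "j < k \<Longrightarrow> k \<le> r \<Longrightarrow> \<tau> j < \<tau> k"
  using sorted_wrt_nth_less[OF sorted_scroll_tops[of 0 as], of j k] \<tau>_bound[of j]
  by (auto simp: \<tau>_def length_scroll_tops)

lemma \<tau>_le_mono: "j \<le> k \<Longrightarrow> k \<le> r \<Longrightarrow> \<tau> j \<le> \<tau> k"
  using \<tau>_mono[of j k] by (cases "j = k") auto

lemma not_top_between:
  assumes "j < r" "\<tau> j < c" "c < \<tau> (Suc j)"
  shows "c \<notin> tops"
proof
  assume "c \<in> tops"
  then obtain k where k: "k < r" "c = \<tau> k" unfolding tops_eq by auto
  show False
  proof (cases "k \<le> j")
    case True
    then show ?thesis using \<tau>_le_mono[of k j] k assms by simp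
  next
    case False
    then show ?thesis using \<tau>_le_mono[of "Suc j" k] k assms by simp
  qed
qed

lemma not_top_before: "c < \<tau> 0 \<Longrightarrow> c \<notin> tops"
proof
  assume "c < \<tau> 0" "c \<in> tops"
  then obtain k where "k < r" "c = \<tau> k" unfolding tops_eq by auto
  then show False using \<tau>_le_mono[of 0 k] \<open>c < \<tau> 0\<close> by simp
qed

text \<open>A coordinate is missing in the top row exactly if it is the last one of its block; the
  sole coordinate of an empty block is included.\<close>

definition ends :: "nat list" where
  "ends = filter (\<lambda>c. c \<notin> tops) [0..<n]"

lemma length_ends: "length ends = s"
proof -
  have "distinct (scroll_tops 0 as)"
    using sorted_scroll_tops[of 0 as] strict_sorted_iff by blast
  then have "card tops = r" unfolding tops_def by (simp add: distinct_card length_scroll_tops)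
  moreover have "tops \<subseteq> {..<n}" using \<tau>_bound unfolding tops_eq by force
  moreover have "length ends = card ({..<n} - tops)"
    unfolding ends_def by (subst distinct_card[symmetric]) (auto intro!: arg_cong[of _ _ card])
  ultimately show ?thesis using n by (simp add: card_Diff_subset finite_subset)
qed

text \<open>The successor of an end is the first coordinate of the next block. The last end is
  \<open>n - 1\<close>, and \<open>x n = 0\<close> turns the last difference into the last
  coordinate itself.\<close>

definition \<theta> :: "nat \<Rightarrow> 'k mpol" where
  "\<theta> i = (if i = 0 then x 0 else x (ends ! (i - 1)) - x (Suc (ends ! (i - 1))))"

definition y :: "nat \<Rightarrow> 'k mpol" where
  "y j = x (\<tau> j)"

abbreviation "\<Theta> \<equiv> mp.span (\<theta> ` {..<Suc s})"
abbreviation "L \<equiv> mp.span (\<theta> ` {..<Suc s} \<union> y ` {1..<r})"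

lemma x_in_Pol: "x c \<in> Pol (tvars n)"
  unfolding x_def by (auto intro!: Pol_sum Pol_mult)

lemma x_step: "c < n \<Longrightarrow> c \<notin> tops \<Longrightarrow> x c - x (Suc c) \<in> \<Theta>"
proof -
  assume "c < n" "c \<notin> tops"
  then have "c \<in> set ends" by (auto simp: ends_def)
  then obtain i where i: "i < s" "ends ! i = c" by (auto simp: in_set_conv_nth length_ends)
  then have "\<theta> (Suc i) = x c - x (Suc c)" by (simp add: \<theta>_def)
  then show ?thesis using i(1) by (metis Suc_mono image_eqI lessThan_iff mp.span_base)
qed

lemma x_path: "c \<le> c' \<Longrightarrow> c' \<le> n \<Longrightarrow> (\<And>e. c \<le> e \<Longrightarrow> e < c' \<Longrightarrow> e \<notin> tops) \<Longrightarrow> x c - x c' \<in> \<Theta>"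
proof (induction c' rule: dec_induct)
  case base
  then show ?case using mp.span_zero by simp
next
  case (step c')
  have "(x c - x c') + (x c' - x (Suc c')) \<in> \<Theta>" using step by (intro mp.span_add x_step) auto
  then show ?case by simp
qed

lemma \<tau>_le_n: "\<tau> j \<le> n"
  using \<tau>_bound[of j] by (cases "j < r") (auto simp: \<tau>_def)

lemma y_r: "y r = 0"
  by (simp add: y_def \<tau>_def x_def)

lemma y_0: "y 0 \<in> \<Theta>"
proof -
  have "x 0 - x (\<tau> 0) \<in> \<Theta>" using not_top_before \<tau>_le_n by (intro x_path) auto
  moreover have "x 0 \<in> \<Theta>" using mp.span_base[of "\<theta> 0" "\<theta> ` {..<Suc s}"] by (simp add: \<theta>_def)
  ultimately have "x 0 - (x 0 - x (\<tau> 0)) \<in> \<Theta>" by (rule mp.span_diff[rotated])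
  then show ?thesis by (simp add: y_def)
qed

text \<open>Only ends lie between the coordinate below column \<open>j\<close> and the top of the
  next column, and each step across an end is one of the \<open>\<theta> i\<close>. Thus, modulo
  these, the matrix becomes one Hankel block with entries \<open>y 0\<close>, ...,
  \<open>y r\<close>.\<close>

lemma x_Suc_\<tau>: "j < r \<Longrightarrow> x (Suc (\<tau> j)) - y (Suc j) \<in> \<Theta>"
  unfolding y_def using not_top_between[of j] \<tau>_mono[of j "Suc j"] \<tau>_le_n by (intro x_path) auto

lemma \<Theta>_L: "\<Theta> \<subseteq> L"
  by (intro mp.span_mono) auto

lemma y_in_L: "j \<le> r \<Longrightarrow> y j \<in> L"
proof -
  assume "j \<le> r"
  then consider "j = 0" | "j = r" | "j \<in> {1..<r}" by force
  then show ?thesis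
    using y_0 \<Theta>_L y_r by cases (auto intro: mp.span_base mp.span_zero)
qed

lemma x_in_L: "c \<le> n \<Longrightarrow> x c \<in> L"
proof (induction c rule: inc_induct)
  case base
  then show ?case using mp.span_zero by (simp add: x_def)
next
  case (step c)
  show ?case
  proof (cases "c \<in> tops")
    case True
    then show ?thesis using y_in_L unfolding tops_eq y_def by auto
  next
    case False
    then have "(x c - x (Suc c)) + x (Suc c) \<in> L" using x_step step \<Theta>_L by (intro mp.span_add) auto
    then show ?thesis by simp
  qed
qed

lemma var_eq: "l < n \<Longrightarrow> var_poly (Vt l) = (\<Sum>c<n. const_poly (h l c) * x c)"
proof -
  assume l: "l < n"
  have "(\<Sum>c<n. const_poly (h l c) * x c) = (\<Sum>c<n. \<Sum>l'<n. const_poly (h l c * g c l') * var_poly (Vt l'))"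
    by (intro sum.cong refl) (simp add: x_def const_poly_mult_sum)
  also have "\<dots> = (\<Sum>l'<n. const_poly (\<Sum>c<n. h l c * g c l') * var_poly (Vt l'))"
    by (subst sum.swap) (simp add: const_poly.hom_sum sum_distrib_right)
  also have "\<dots> = (\<Sum>l'<n. if l = l' then var_poly (Vt l') else 0)"
    using l by (intro sum.cong refl) (simp add: hg)
  also have "\<dots> = var_poly (Vt l)" using l by simp
  finally show ?thesis ..
qed

lemma vars: "v \<in> tvars n \<Longrightarrow> var_poly v \<in> L"
  using var_eq x_in_L by (auto intro!: mp.span_sum mp.span_scale)

lemma minor_set_Pol:
  "{x (\<tau> j) * x (Suc (\<tau> k)) - x (Suc (\<tau> j)) * x (\<tau> k) | j k. j < k \<and> k < r} \<subseteq> carrier (kt n)"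
  using x_in_Pol by (auto intro!: Pol_diff Pol_mult)

lemma I_ideal: "ideal I (kt n)"
  unfolding I by (intro ring.genideal_ideal cring.axioms(1) cring_pol_ring minor_set_Pol)

lemma minor_in_I: "j < k \<Longrightarrow> k < r \<Longrightarrow> x (\<tau> j) * x (Suc (\<tau> k)) - x (Suc (\<tau> j)) * x (\<tau> k) \<in> I"
  unfolding I using ring.genideal_self[OF cring.axioms(1)[OF cring_pol_ring] minor_set_Pol] by blast

definition Rel :: "'k mpol set" where
  "Rel = {p. \<exists>l. (\<forall>i<Suc s. l i \<in> L) \<and> p - (\<Sum>i<Suc s. \<theta> i * l i) \<in> I}"

lemma Rel_I: "p \<in> I \<Longrightarrow> p \<in> Rel"
  unfolding Rel_def by (intro CollectI exI[of _ "\<lambda>_. 0"]) (auto intro: mp.span_zero)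

lemma Rel_add: "p \<in> Rel \<Longrightarrow> q \<in> Rel \<Longrightarrow> p + q \<in> Rel"
proof -
  assume "p \<in> Rel" "q \<in> Rel"
  then obtain l m where *: "\<forall>i<Suc s. l i \<in> L" "p - (\<Sum>i<Suc s. \<theta> i * l i) \<in> I"
    "\<forall>i<Suc s. m i \<in> L" "q - (\<Sum>i<Suc s. \<theta> i * m i) \<in> I" unfolding Rel_def by blast
  have "p + q - (\<Sum>i<Suc s. \<theta> i * (l i + m i)) = (p - (\<Sum>i<Suc s. \<theta> i * l i)) + (q - (\<Sum>i<Suc s. \<theta> i * m i))"
    by (simp add: distrib_left sum.distrib del: sum.lessThan_Suc)
  also have "\<dots> \<in> I" using ideal_pol_ringD(3)[OF I_ideal] * by blast
  finally show ?thesis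
    unfolding Rel_def using * by (intro CollectI exI[of _ "\<lambda>i. l i + m i"]) (auto intro: mp.span_add)
qed

lemma Rel_\<Theta>: "t \<in> \<Theta> \<Longrightarrow> l \<in> L \<Longrightarrow> t * l \<in> Rel"
proof (induction arbitrary: l rule: span_induct_mp)
  case zero
  then show ?case using Rel_I ideal_pol_ringD(2)[OF I_ideal] by simp
next
  case (add p q)
  then show ?case by (simp add: distrib_right Rel_add)
next
  case (scale c p)
  then have "p * (const_poly c * l) \<in> Rel" using mp.span_scale by blast
  then show ?case by (simp add: mult_ac)
next
  case (base t)
  then obtain i where i: "i < Suc s" "t = \<theta> i" by blast
  have "t * l = (\<Sum>i'<Suc s. \<theta> i' * (if i' = i then l else 0))"
    using i by (subst sum.remove[of _ i]) (auto simp: sum.neutral)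
  then show ?case
    unfolding Rel_def using base(2) mp.span_zero ideal_pol_ringD(2)[OF I_ideal]
    by (intro CollectI exI[of _ "\<lambda>i'. if i' = i then l else 0"]) (auto simp del: sum.lessThan_Suc)
qed

text \<open>
  Modulo \<open>I\<close> and \<open>\<theta>\<close> one has \<open>y\<^sub>j\<^sub>+\<^sub>1 y\<^sub>k = y\<^sub>j y\<^sub>k\<^sub>+\<^sub>1\<close>, so the indices of a product move apart until
  one of the factors is \<open>y\<^sub>0\<close> or \<open>y\<^sub>r\<close>, which vanish.
\<close>

lemma y_mult_Rel: "j \<le> k \<Longrightarrow> k \<le> r \<Longrightarrow> y j * y k \<in> Rel"
proof (induction j arbitrary: k)
  case 0
  then show ?case using Rel_\<Theta> y_0 y_in_L by simp
next
  case (Suc j)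
  show ?case
  proof (cases "k = r")
    case True
    then show ?thesis using y_r Rel_I ideal_pol_ringD(2)[OF I_ideal] by simp
  next
    case False
    then have k: "k < r" "j < k" using Suc.prems by auto
    define t where "t = x (Suc (\<tau> k)) - y (Suc k)"
    define t' where "t' = x (Suc (\<tau> j)) - y (Suc j)"
    define m where "m = x (\<tau> j) * x (Suc (\<tau> k)) - x (Suc (\<tau> j)) * x (\<tau> k)"
    have tt: "t \<in> \<Theta>" "- t' \<in> \<Theta>" 
      using x_Suc_\<tau>[of k] mp.span_neg[OF x_Suc_\<tau>[of j]] k unfolding t_def t'_def by simp_all
    have "- m \<in> Rel" using Rel_I ideal_pol_ringD(5)[OF I_ideal ideal_pol_ringD(2)[OF I_ideal] minor_in_I[OF k(2,1)]]
      by (simp add: m_def)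
    moreover have eq: "y (Suc j) * y k = y j * y (Suc k) + t * y j + (- t') * y k + (- m)"
      by (simp add: t_def t'_def m_def y_def algebra_simps)
    moreover have "y j * y (Suc k) \<in> Rel" using Suc.IH[of "Suc k"] k by simp
    moreover have "t * y j \<in> Rel" using k by (intro Rel_\<Theta>[OF tt(1)] y_in_L) simp
    moreover have "(- t') * y k \<in> Rel" using k by (intro Rel_\<Theta>[OF tt(2)] y_in_L) simp
    ultimately show ?thesis unfolding eq by (intro Rel_add)
  qed
qed

lemma scroll_basisI:
  assumes "\<And>i. i < Suc s \<Longrightarrow> lead_coeff (f i) = 1" "\<And>i. i < Suc s \<Longrightarrow> 0 < degree (f i)"
  shows "scroll_basis (tvars n) I \<theta> y (Suc s) r f"
proof (rule scroll_basis.intro)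
  show "\<exists>l. (\<forall>i<Suc s. l i \<in> L) \<and> y j * y k - (\<Sum>i<Suc s. \<theta> i * l i) \<in> I"
    if "j \<in> {1..<r}" "k \<in> {1..<r}" for j k
  proof -
    have "y j * y k \<in> Rel"
      using y_mult_Rel[of j k] y_mult_Rel[of k j] that by (cases "j \<le> k") (auto simp: mult.commute)
    then show ?thesis unfolding Rel_def by blast
  qed
  show "var_poly v \<in> L" if "v \<in> tvars n" for v by (rule vars[OF that])
  show "\<theta> i \<in> Pol (tvars n)" "y i \<in> Pol (tvars n)" for i
    using x_in_Pol by (auto simp: \<theta>_def y_def intro: Pol_diff)
qed (use assms I_ideal r_pos in auto)

section \<open>The monomial parametrization of the scroll\<close>

definition mono_coord :: "nat \<Rightarrow> (indet \<Rightarrow>\<^sub>0 nat)" where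
  "mono_coord c = single (Vt (fst (scroll_coords 0 as ! c))) 1 + single (Vt s) (snd (scroll_coords 0 as ! c))"

text \<open>In the target, \<open>Vt i\<close> with i < s plays the role of v_i and
  \<open>Vt s\<close> that of w. The inverse matrix \<open>h\<close> enters so that each coordinate
  \<open>x c\<close>, rather than each t_l, is sent to a monomial.\<close>

definition \<pi> :: "'k mpol \<Rightarrow> 'k mpol" where
  "\<pi> = eval_mpoly const_poly (\<lambda>v. case v of Vt l \<Rightarrow> \<Sum>c<n. const_poly (h l c) * single (mono_coord c) 1 | _ \<Rightarrow> 0)"

sublocale \<pi>: comm_ring_hom \<pi>
  unfolding \<pi>_def by (rule const_poly.comm_ring_hom_eval_mpoly)

lemma \<pi>_const: "\<pi> (const_poly c) = const_poly c"
  unfolding \<pi>_def by (subst const_poly_def) simp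

lemma \<pi>_var: "\<pi> (var_poly (Vt l)) = (\<Sum>c<n. const_poly (h l c) * single (mono_coord c) 1)"
  unfolding \<pi>_def var_poly_def by simp

lemma \<pi>_x: "c < n \<Longrightarrow> \<pi> (x c) = single (mono_coord c) 1"
proof -
  assume c: "c < n"
  have "\<pi> (x c) = (\<Sum>l<n. \<Sum>c'<n. const_poly (g c l * h l c') * single (mono_coord c') 1)"
    using c by (simp add: x_def \<pi>.hom_sum \<pi>.hom_mult \<pi>_const \<pi>_var const_poly_mult_sum)
  also have "\<dots> = (\<Sum>c'<n. const_poly (\<Sum>l<n. g c l * h l c') * single (mono_coord c') 1)"
    by (subst sum.swap) (simp add: const_poly.hom_sum sum_distrib_right)
  also have "\<dots> = (\<Sum>c'<n. if c = c' then single (mono_coord c') 1 else 0)"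
    using c by (intro sum.cong refl) (simp add: gh)
  also have "\<dots> = single (mono_coord c) 1" using c by simp
  finally show ?thesis .
qed

lemma coord_\<tau>:
  assumes "j < r"
  obtains i k where "scroll_coords 0 as ! \<tau> j = (i, k)" "scroll_coords 0 as ! Suc (\<tau> j) = (i, Suc k)" "i < s" "k < as ! i"
proof -
  have "\<tau> j \<in> tops" using assms unfolding tops_eq by auto
  from scroll_tops_coords[OF this[unfolded tops_def], of 0]
  obtain i k where ik: "scroll_coords 0 as ! \<tau> j = (i, k)" "scroll_coords 0 as ! Suc (\<tau> j) = (i, Suc k)" "k < as ! i"
    by auto
  have "(i, k) \<in> set (scroll_coords 0 as)"
    using ik(1) nth_mem[of "\<tau> j" "scroll_coords 0 as"] \<tau>_bound[OF assms] n by (simp add: length_scroll_coords)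
  then have "i < s" by (simp add: set_scroll_coords)
  then show ?thesis using that ik by blast
qed

lemma \<pi>_I: "p \<in> I \<Longrightarrow> \<pi> p = 0"
proof -
  have "ideal {p \<in> Pol (tvars n). \<pi> p = 0} (kt n)"
    by (rule ideal_pol_ringI) (auto simp: \<pi>.hom_add \<pi>.hom_mult intro: Pol_add Pol_mult)
  moreover have "{x (\<tau> j) * x (Suc (\<tau> k)) - x (Suc (\<tau> j)) * x (\<tau> k) | j k. j < k \<and> k < r} \<subseteq> {p \<in> Pol (tvars n). \<pi> p = 0}"
  proof -
    have "\<pi> (x (\<tau> j) * x (Suc (\<tau> k)) - x (Suc (\<tau> j)) * x (\<tau> k)) = 0" if jk: "j < k" "k < r" for j k
    proof -
      have "j < r" using jk by simp
      from coord_\<tau>[OF this] obtain i e where ie: "scroll_coords 0 as ! \<tau> j = (i, e)" "scroll_coords 0 as ! Suc (\<tau> j) = (i, Suc e)" .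
      from coord_\<tau>[OF jk(2)] obtain i' e' where ie': "scroll_coords 0 as ! \<tau> k = (i', e')" "scroll_coords 0 as ! Suc (\<tau> k) = (i', Suc e')" .
      have "mono_coord (\<tau> j) + mono_coord (Suc (\<tau> k)) = mono_coord (Suc (\<tau> j)) + mono_coord (\<tau> k)"
        unfolding mono_coord_def ie ie' by (rule poly_mapping_eqI) (simp add: lookup_add lookup_single when_def)
      then show ?thesis
        using \<tau>_bound[of j] \<tau>_bound[of k] jk by (simp add: \<pi>.hom_minus \<pi>.hom_mult \<pi>_x mult_single)
    qed
    moreover have "{x (\<tau> j) * x (Suc (\<tau> k)) - x (Suc (\<tau> j)) * x (\<tau> k) | j k. j < k \<and> k < r} \<subseteq> Pol (tvars n)"
      using minor_set_Pol by simp
    ultimately show ?thesis by blast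
  qed
  ultimately have "I \<subseteq> {p \<in> Pol (tvars n). \<pi> p = 0}"
    unfolding I by (intro ring.genideal_minimal cring.axioms(1) cring_pol_ring)
  then show "p \<in> I \<Longrightarrow> \<pi> p = 0" by blast
qed

end

lemma single_eq_iff: "c \<noteq> 0 \<Longrightarrow> single m c = single m' c \<longleftrightarrow> m = m'"
  by (metis keys_single singleton_inject)

lemma independent_monomials: "mp.independent ((\<lambda>m. single m (1 :: 'k::field)) ` A)"
  unfolding mp.independent_explicit_finite_subsets
proof (intro allI impI ballI)
  fix S :: "'k mpol set" and u v
  assume S: "S \<subseteq> (\<lambda>m. single m 1) ` A" "finite S" "(\<Sum>v\<in>S. const_poly (u v) * v) = 0" and v: "v \<in> S"
  obtain m where m: "v = single m 1" using S(1) v by blast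
  have "lookup (\<Sum>v\<in>S. const_poly (u v) * v) m = (\<Sum>v'\<in>S. if v' = v then u v else 0)"
    unfolding lookup_sum
  proof (intro sum.cong refl)
    fix v' assume "v' \<in> S"
    then obtain m' where "v' = single m' 1" using S(1) by blast
    then show "lookup (const_poly (u v') * v') m = (if v' = v then u v else 0)"
      by (auto simp: m lookup_const_mult lookup_single when_def single_eq_iff)
  qed
  then show "u v = 0" using S(2,3) v by simp
qed

lemma nat_le_of_multiples:
  fixes a b c :: int
  assumes "0 \<le> c" "\<And>n :: nat. 0 \<le> c + int n * a - int n * b"
  shows "b \<le> a"
proof (rule ccontr)
  assume "\<not> b \<le> a"
  then have "int (nat c + 1) * (a - b) \<le> int (nat c + 1) * (- 1)"
    by (intro mult_left_mono) auto
  then show False using assms(1) assms(2)[of "nat c + 1"] by (simp add: algebra_simps)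
qed

section \<open>Matching the basis with the monomials of the parametrization\<close>

context scroll_ring
begin

abbreviation "W \<equiv> tvars (Suc s)"

text \<open>The monoid generated by the exponents of the monomials v_i w^k with k \<le> a_i; its
  description by linear inequalities makes saturation evident.\<close>

definition Mset :: "(indet \<Rightarrow>\<^sub>0 nat) set" where
  "Mset = {m. keys m \<subseteq> W \<and> lookup m (Vt s) \<le> (\<Sum>i<s. as ! i * lookup m (Vt i))}"

definition MN :: "nat \<Rightarrow> (indet \<Rightarrow>\<^sub>0 nat) set" where
  "MN N = {m \<in> Mset. (\<Sum>i<s. lookup m (Vt i)) \<le> N}"

text \<open>This is \<open>idxN\<close> of the scroll basis, spelled out without reference to the
  polynomials \<open>f\<close>, so that the count is made once for all of them.\<close>

definition IN :: "nat \<Rightarrow> ((nat \<Rightarrow>\<^sub>0 nat) \<times> nat) set" where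
  "IN N = {(\<beta>, j). keys \<beta> \<subseteq> {..<Suc s} \<and> j < r \<and> mon_deg \<beta> + (if j = 0 then 0 else 1) \<le> N}"

definition mk :: "(nat \<Rightarrow> nat) \<Rightarrow> nat \<Rightarrow> (indet \<Rightarrow>\<^sub>0 nat)" where
  "mk \<alpha> w = (\<Sum>i<s. single (Vt i) (\<alpha> i)) + single (Vt s) w"

lemma lookup_mk: "i < s \<Longrightarrow> lookup (mk \<alpha> w) (Vt i) = \<alpha> i" "lookup (mk \<alpha> w) (Vt s) = w"
  by (auto simp: mk_def lookup_add lookup_sum lookup_single when_def)

lemma keys_mk: "keys (mk \<alpha> w) \<subseteq> W"
proof
  fix v assume "v \<in> keys (mk \<alpha> w)"
  then have "v \<in> (\<Union>i<s. keys (single (Vt i) (\<alpha> i))) \<or> v \<in> keys (single (Vt s) w)"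
    using keys_sum[of "\<lambda>i. single (Vt i) (\<alpha> i)" "{..<s}"] unfolding mk_def keys_nat_add by blast
  then show "v \<in> W" by (auto split: if_splits)
qed

definition blk :: "nat \<Rightarrow> nat" where "blk j = fst (scroll_coords 0 as ! \<tau> j)"
definition off :: "nat \<Rightarrow> nat" where "off j = snd (scroll_coords 0 as ! \<tau> j)"

lemma blk_off: "j < r \<Longrightarrow> blk j < s \<and> off j < as ! blk j"
  by (rule coord_\<tau>[of j]) (auto simp: blk_def off_def)

lemma blk_off_inj: "j < r \<Longrightarrow> k < r \<Longrightarrow> blk j = blk k \<Longrightarrow> off j = off k \<Longrightarrow> j = k"
proof -
  assume jk: "j < r" "k < r" "blk j = blk k" "off j = off k"
  then have "scroll_coords 0 as ! \<tau> j = scroll_coords 0 as ! \<tau> k" by (simp add: blk_def off_def prod_eq_iff)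
  then have "\<tau> j = \<tau> k"
    using distinct_scroll_coords[of 0 as] \<tau>_bound jk(1,2) n
    by (simp add: nth_eq_iff_index_eq length_scroll_coords Suc_lessD)
  then show "j = k" using \<tau>_mono[of j k] \<tau>_mono[of k j] jk(1,2) by (cases j k rule: linorder_cases) auto
qed

text \<open>The quotient of the division described below. In \<open>psi_a\<close> the exponent of
  the block in question is enlarged by \<open>Suc (psi_b \<beta> j)\<close>, which makes room for
  the position and makes the total v-degree equal to the size of \<open>(\<beta>, j)\<close>. For
  \<open>j = 0\<close> the value 0 of \<beta> at \<open>s\<close> is taken by monomials without w,
  so the quotient is shifted by 1.\<close>

definition psi_b :: "(nat \<Rightarrow>\<^sub>0 nat) \<Rightarrow> nat \<Rightarrow> nat" where
  "psi_b \<beta> j = lookup \<beta> s - (if j = 0 then 1 else 0)"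

definition psi_a :: "(nat \<Rightarrow>\<^sub>0 nat) \<Rightarrow> nat \<Rightarrow> nat \<Rightarrow> nat" where
  "psi_a \<beta> j i = lookup \<beta> i + (if i = blk j then Suc (psi_b \<beta> j) else 0)"

definition psi_w :: "(nat \<Rightarrow>\<^sub>0 nat) \<Rightarrow> nat \<Rightarrow> nat" where
  "psi_w \<beta> j = (\<Sum>i<blk j. as ! i * psi_a \<beta> j i) + as ! blk j * psi_b \<beta> j + Suc (off j)"

text \<open>
  The \<open>w\<close>-exponents \<open>1, \<dots>, \<Sum> a\<^sub>i \<alpha>\<^sub>i\<close> belonging to a given \<open>\<alpha>\<close> are divided into consecutive intervals of
  lengths \<open>a\<^sub>i \<alpha>\<^sub>i\<close>, and the position in the \<open>i\<close>-th one is divided by \<open>a\<^sub>i\<close> with remainder.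
\<close>

definition psi :: "(nat \<Rightarrow>\<^sub>0 nat) \<times> nat \<Rightarrow> (indet \<Rightarrow>\<^sub>0 nat)" where
  "psi = (\<lambda>(\<beta>, j). if j = 0 \<and> lookup \<beta> s = 0 then mk (lookup \<beta>) 0 else mk (psi_a \<beta> j) (psi_w \<beta> j))"

lemma psi_w_bounds:
  assumes "j < r"
  shows "(\<Sum>i<blk j. as ! i * psi_a \<beta> j i) < psi_w \<beta> j"
    "psi_w \<beta> j \<le> (\<Sum>i<Suc (blk j). as ! i * psi_a \<beta> j i)"
proof -
  show "(\<Sum>i<blk j. as ! i * psi_a \<beta> j i) < psi_w \<beta> j" by (simp add: psi_w_def)
  have "as ! blk j * psi_b \<beta> j + Suc (off j) \<le> as ! blk j * Suc (psi_b \<beta> j)"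
    using blk_off[OF assms] by simp
  also have "\<dots> \<le> as ! blk j * psi_a \<beta> j (blk j)" by (intro mult_le_mono2) (simp add: psi_a_def)
  finally show "psi_w \<beta> j \<le> (\<Sum>i<Suc (blk j). as ! i * psi_a \<beta> j i)" by (simp add: psi_w_def)
qed

lemma mon_deg_IN: "keys \<beta> \<subseteq> {..<Suc s} \<Longrightarrow> mon_deg \<beta> = (\<Sum>i<s. lookup \<beta> i) + lookup \<beta> s"
  using mon_deg_superset[of "{..<Suc s}" \<beta>] by simp

lemma psi_in_MN: "k \<in> IN N \<Longrightarrow> psi k \<in> MN N"
proof -
  assume "k \<in> IN N"
  then obtain \<beta> j where k: "k = (\<beta>, j)" "keys \<beta> \<subseteq> {..<Suc s}" "j < r" "mon_deg \<beta> + (if j = 0 then 0 else 1) \<le> N"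
    by (auto simp: IN_def)
  note deg = mon_deg_IN[OF k(2)]
  show ?thesis
  proof (cases "j = 0 \<and> lookup \<beta> s = 0")
    case True
    then show ?thesis using k(4) keys_mk deg by (simp add: k(1) psi_def MN_def Mset_def lookup_mk)
  next
    case False
    have "psi_w \<beta> j \<le> (\<Sum>i<Suc (blk j). as ! i * psi_a \<beta> j i)" by (rule psi_w_bounds[OF k(3)])
    also have "\<dots> \<le> (\<Sum>i<s. as ! i * psi_a \<beta> j i)"
      using blk_off[OF k(3)] by (intro sum_mono2) auto
    finally have 1: "psi_w \<beta> j \<le> (\<Sum>i<s. as ! i * psi_a \<beta> j i)" .
    have "(\<Sum>i<s. psi_a \<beta> j i) = (\<Sum>i<s. lookup \<beta> i) + Suc (psi_b \<beta> j)"
      using blk_off[OF k(3)] by (simp add: psi_a_def sum.distrib)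
    also have "\<dots> \<le> N" using k(4) False unfolding deg by (auto simp: psi_b_def split: if_splits)
    finally show ?thesis
      using False 1 keys_mk by (auto simp: k(1) psi_def MN_def Mset_def lookup_mk)
  qed
qed

lemma inj_psi: "inj_on psi (IN N)"
proof (rule inj_onI)
  fix k k' assume "k \<in> IN N" "k' \<in> IN N" and eq: "psi k = psi k'"
  then obtain \<beta> j \<beta>' j' where k: "k = (\<beta>, j)" "keys \<beta> \<subseteq> {..<Suc s}" "j < r"
    and k': "k' = (\<beta>', j')" "keys \<beta>' \<subseteq> {..<Suc s}" "j' < r" by (auto simp: IN_def)
  have look: "\<beta> = \<beta>'" if "\<And>i. i < s \<Longrightarrow> lookup \<beta> i = lookup \<beta>' i" "lookup \<beta> s = lookup \<beta>' s"
  proof (rule poly_mapping_eqI)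
    fix i
    show "lookup \<beta> i = lookup \<beta>' i"
    proof (cases "i < Suc s")
      case True
      then show ?thesis using that by (auto simp: less_Suc_eq)
    next
      case False
      then have "i \<notin> keys \<beta>" "i \<notin> keys \<beta>'" using k(2) k'(2) by auto
      then show ?thesis by (simp add: in_keys_iff)
    qed
  qed
  have lk: "lookup (psi k) (Vt i) = lookup (psi k') (Vt i)" for i using eq by simp
  consider "j = 0 \<and> lookup \<beta> s = 0" "j' = 0 \<and> lookup \<beta>' s = 0"
    | "j = 0 \<and> lookup \<beta> s = 0" "\<not> (j' = 0 \<and> lookup \<beta>' s = 0)"
    | "\<not> (j = 0 \<and> lookup \<beta> s = 0)" "j' = 0 \<and> lookup \<beta>' s = 0"
    | "\<not> (j = 0 \<and> lookup \<beta> s = 0)" "\<not> (j' = 0 \<and> lookup \<beta>' s = 0)" by blast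
  then show "k = k'"
  proof cases
    case 1
    then have "lookup \<beta> i = lookup \<beta>' i" if "i < s" for i
      using lk[of i] that by (simp add: psi_def k(1) k'(1) lookup_mk)
    then show ?thesis using 1 look by (simp add: k(1) k'(1))
  next
    case 2
    then show ?thesis using lk[of s] by (auto simp: psi_def k(1) k'(1) lookup_mk psi_w_def split: if_splits)
  next
    case 3
    then show ?thesis using lk[of s] by (auto simp: psi_def k(1) k'(1) lookup_mk psi_w_def split: if_splits)
  next
    case 4
    have a: "psi_a \<beta> j i = psi_a \<beta>' j' i" if "i < s" for i
      using lk[of i] 4 that by (simp add: psi_def k(1) k'(1) lookup_mk)
    have w: "psi_w \<beta> j = psi_w \<beta>' j'"
      using lk[of s] 4 by (simp add: psi_def k(1) k'(1) lookup_mk)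
    have sums: "(\<Sum>i<b. as ! i * psi_a \<beta> j i) = (\<Sum>i<b. as ! i * psi_a \<beta>' j' i)" if "b \<le> s" for b
      using a that by (intro sum.cong) auto
    \<comment> \<open>Exponents of w belonging to different blocks lie in disjoint intervals. The
      statement has its own variables because it is applied in both directions.\<close>
    have not_less: "\<not> blk j1 < blk j2"
      if "j1 < r" "j2 < r" "psi_w \<beta>1 j1 = psi_w \<beta>2 j2"
        "\<And>b. b \<le> s \<Longrightarrow> (\<Sum>i<b. as ! i * psi_a \<beta>1 j1 i) = (\<Sum>i<b. as ! i * psi_a \<beta>2 j2 i)" for \<beta>1 \<beta>2 j1 j2
    proof
      assume less: "blk j1 < blk j2"
      have "psi_w \<beta>1 j1 \<le> (\<Sum>i<Suc (blk j1). as ! i * psi_a \<beta>1 j1 i)" by (rule psi_w_bounds[OF that(1)])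
      also have "\<dots> \<le> (\<Sum>i<blk j2. as ! i * psi_a \<beta>1 j1 i)" using less by (intro sum_mono2) auto
      also have "\<dots> = (\<Sum>i<blk j2. as ! i * psi_a \<beta>2 j2 i)" using that(4) blk_off[OF that(2)] by simp
      also have "\<dots> < psi_w \<beta>2 j2" by (rule psi_w_bounds[OF that(2)])
      finally show False using that(3) by simp
    qed
    have blk: "blk j = blk j'"
      using not_less[OF k(3) k'(3) w sums] not_less[OF k'(3) k(3) w[symmetric] sums[symmetric]] by simp
    have bj: "blk j < s" using blk_off[OF k(3)] by simp
    have "as ! blk j * psi_b \<beta> j + off j = as ! blk j * psi_b \<beta>' j' + off j'"
      using w sums[of "blk j"] bj by (simp add: psi_w_def blk)
    moreover have off: "off j < as ! blk j" "off j' < as ! blk j"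
      using blk_off[OF k(3)] blk_off[OF k'(3)] blk by auto
    ultimately have "(as ! blk j * psi_b \<beta> j + off j) div as ! blk j = (as ! blk j * psi_b \<beta>' j' + off j') div as ! blk j"
      "(as ! blk j * psi_b \<beta> j + off j) mod as ! blk j = (as ! blk j * psi_b \<beta>' j' + off j') mod as ! blk j"
      by simp_all
    then have b: "psi_b \<beta> j = psi_b \<beta>' j'" and o: "off j = off j'"
      using off by (simp_all add: div_mult_self1)
    have jj: "j = j'" using blk_off_inj[OF k(3) k'(3) blk o] .
    have "lookup \<beta> i = lookup \<beta>' i" if "i < s" for i
      using a[OF that] b blk by (simp add: psi_a_def split: if_splits)
    moreover have "lookup \<beta> s = lookup \<beta>' s"
      using b 4 jj by (auto simp: psi_b_def split: if_splits)
    ultimately show ?thesis using look jj by (simp add: k(1) k'(1))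
  qed
qed

lemma finite_MN: "finite (MN N)"
proof (rule finite_subset)
  let ?B = "N + (\<Sum>i<s. as ! i * N)"
  show "MN N \<subseteq> box W ?B"
  proof
    fix m assume m: "m \<in> MN N"
    have i: "lookup m (Vt i) \<le> N" if "i < s" for i
    proof -
      have "lookup m (Vt i) \<le> (\<Sum>i<s. lookup m (Vt i))" using that by (intro member_le_sum) auto
      then show ?thesis using m by (simp add: MN_def)
    qed
    have "lookup m (Vt s) \<le> (\<Sum>i<s. as ! i * lookup m (Vt i))" using m by (simp add: MN_def Mset_def)
    also have "\<dots> \<le> (\<Sum>i<s. as ! i * N)" using i by (intro sum_mono mult_le_mono2) auto
    finally have s: "lookup m (Vt s) \<le> (\<Sum>i<s. as ! i * N)" .
    have "lookup m v \<le> ?B" for v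
    proof (cases "v \<in> keys m")
      case True
      then have "v \<in> W" using m by (auto simp: MN_def Mset_def)
      then obtain i where "v = Vt i" "i < Suc s" by auto
      then show ?thesis using i[of i] s by (cases "i = s") auto
    qed (simp add: in_keys_iff)
    then show "m \<in> box W ?B" using m by (auto simp: box_def MN_def Mset_def)
  qed
qed (simp add: finite_box)

definition E :: "nat \<Rightarrow> 'k mpol set" where
  "E N = (\<lambda>m. single m 1) ` MN N"

lemma card_E: "card (IN N) \<le> card (E N)"
proof -
  have "card (IN N) \<le> card (MN N)"
    using inj_psi psi_in_MN finite_MN by (intro card_inj_on_le[of psi]) auto
  also have "inj_on (\<lambda>m. single m (1 :: 'k)) (MN N)" by (auto simp: inj_on_def single_eq_iff)
  then have "card (MN N) = card (E N)" unfolding E_def by (simp add: card_image)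
  finally show ?thesis .
qed

lemma lookup_mono_coord:
  assumes "scroll_coords 0 as ! c = (i, k)" "i < s"
  shows "lookup (mono_coord c) (Vt i') = (if i' = i then 1 else if i' = s then k else 0)"
  using assms by (auto simp: mono_coord_def lookup_add lookup_single when_def)

lemma mono_coord_in_Mset: "c < n \<Longrightarrow> mono_coord c \<in> Mset"
proof -
  assume c: "c < n"
  obtain i k where ik: "scroll_coords 0 as ! c = (i, k)" by fastforce
  have "(i, k) \<in> set (scroll_coords 0 as)"
    using nth_mem[of c "scroll_coords 0 as"] c n ik by (simp add: length_scroll_coords)
  then have *: "i < s" "k \<le> as ! i" by (auto simp: set_scroll_coords)
  have "(\<Sum>i'<s. as ! i' * lookup (mono_coord c) (Vt i')) = (\<Sum>i'<s. if i' = i then as ! i else 0)"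
    by (intro sum.cong refl) (auto simp: lookup_mono_coord[OF ik *(1)])
  moreover have "keys (mono_coord c) \<subseteq> W"
    using *(1) by (auto simp: mono_coord_def keys_nat_add ik split: if_splits)
  ultimately show ?thesis
    using * by (simp add: Mset_def lookup_mono_coord[OF ik *(1)])
qed

lemma Mset_add: "m \<in> Mset \<Longrightarrow> m' \<in> Mset \<Longrightarrow> m + m' \<in> Mset"
  by (auto simp: Mset_def keys_nat_add lookup_add distrib_left sum.distrib)

text \<open>Induction on the v-degree: a suitable coordinate monomial is split off, and
  multiplication by the coordinate raises the filtration by one.\<close>

lemma monomial_preimage:
  assumes "scroll_basis (tvars n) I \<theta> y (Suc s) r f"
  shows "m \<in> MN N \<Longrightarrow> \<exists>p\<in>scroll_basis.U I \<theta> y (Suc s) r f N. \<pi> p = single m 1"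
proof -
  interpret SB: scroll_basis "tvars n" I \<theta> y "Suc s" r f by fact
  show "m \<in> MN N \<Longrightarrow> \<exists>p\<in>SB.U N. \<pi> p = single m 1"
  proof (induction N arbitrary: m)
    case (0 m)
    then have "lookup m (Vt i) = 0" if "i < Suc s" for i
      using that by (cases "i = s") (auto simp: MN_def Mset_def)
    then have "m = 0"
      using 0 by (intro poly_mapping_eqI) (auto simp: MN_def Mset_def in_keys_iff subset_iff image_iff)
    then show ?case using SB.one_in_U by (intro bexI[of _ 1]) auto
  next
    case (Suc N m)
    show ?case
    proof (cases "m \<in> MN N")
      case True
      then show ?thesis using Suc.IH SB.U_mono[of N "Suc N"] by auto
    next
      case False
      then have "\<not> (\<Sum>i<s. lookup m (Vt i)) \<le> N" using Suc.prems by (simp add: MN_def)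
      then have "(\<Sum>i<s. lookup m (Vt i)) \<noteq> 0" by linarith
      then obtain i where "i \<in> {..<s}" "lookup m (Vt i) \<noteq> 0" by (rule sum.not_neutral_contains_not_neutral)
      then have i: "i < s" "lookup m (Vt i) \<noteq> 0" by auto
      \<comment> \<open>The greedy choice: either it uses up the whole power of w, or it is
        \<open>as ! i\<close>, by which the bound for the exponent of w drops too. In both cases the
        quotient stays in \<open>Mset\<close>.\<close>
      define k where "k = min (lookup m (Vt s)) (as ! i)"
      have "(i, k) \<in> set (scroll_coords 0 as)" using i by (auto simp: set_scroll_coords k_def)
      then obtain c where c: "c < n" "scroll_coords 0 as ! c = (i, k)"
        using n by (auto simp: in_set_conv_nth length_scroll_coords)
      note lk = lookup_mono_coord[OF c(2) i(1)]
      define m' where "m' = m - mono_coord c"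
      have m: "m = mono_coord c + m'"
        unfolding m'_def
      proof (rule monomial_eq_add_diff)
        fix v
        show "lookup (mono_coord c) v \<le> lookup m v"
          using i by (cases v) (auto simp: lk k_def, auto simp: mono_coord_def lookup_add lookup_single when_def)
      qed
      have sums: "(\<Sum>i'<s. e i' * lookup m (Vt i')) = (\<Sum>i'<s. e i' * lookup m' (Vt i')) + e i" for e
      proof -
        have "(\<Sum>i'<s. e i' * lookup m (Vt i')) = (\<Sum>i'<s. e i' * lookup m' (Vt i') + (if i' = i then e i else 0))"
          unfolding m lookup_add by (intro sum.cong refl) (auto simp: lk algebra_simps)
        then show ?thesis using i(1) by (simp add: sum.distrib)
      qed
      have "lookup m' (Vt s) = lookup m (Vt s) - k" using i(1) by (simp add: m'_def lookup_minus lk)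
      then have "lookup m' (Vt s) \<le> (\<Sum>i'<s. as ! i' * lookup m' (Vt i'))"
        using Suc.prems sums[of "\<lambda>i'. as ! i'"] by (auto simp: MN_def Mset_def k_def)
      moreover have "keys m' \<subseteq> W" using Suc.prems m keys_nat_add[of "mono_coord c" m'] by (auto simp: MN_def Mset_def)
      moreover have "(\<Sum>i'<s. lookup m' (Vt i')) \<le> N"
        using Suc.prems sums[of "\<lambda>_. 1"] by (simp add: MN_def)
      ultimately have "m' \<in> MN N" by (simp add: MN_def Mset_def)
      then obtain p where p: "p \<in> SB.U N" "\<pi> p = single m' 1" using Suc.IH by blast
      have "x c * p \<in> SB.U (Suc N)" using x_in_L[of c] c(1) by (intro SB.L_U p(1)) simp
      moreover have "\<pi> (x c * p) = single m 1" using c(1) p(2) m by (simp add: \<pi>.hom_mult \<pi>_x mult_single)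
      ultimately show ?thesis by blast
    qed
  qed
qed

lemma scroll_basis_indepI:
  assumes "\<And>i. i < Suc s \<Longrightarrow> lead_coeff (f i) = 1" "\<And>i. i < Suc s \<Longrightarrow> 0 < degree (f i)"
  shows "scroll_basis_indep (tvars n) I \<theta> y (Suc s) r f \<pi> E"
proof -
  have SB: "scroll_basis (tvars n) I \<theta> y (Suc s) r f" using assms by (rule scroll_basisI)
  interpret SB: scroll_basis "tvars n" I \<theta> y "Suc s" r f by (rule SB)
  have IN: "SB.idxN N = IN N" for N by (auto simp: SB.idxN_def SB.idx_def SB.siz_def IN_def)
  show ?thesis
  proof (rule scroll_basis_indep.intro[OF SB scroll_basis_indep_axioms.intro])
    show "mp.independent (E N)" for N unfolding E_def by (rule independent_monomials)
    show "E N \<subseteq> \<pi> ` SB.U N" for N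
      unfolding E_def
    proof (rule image_subsetI)
      fix m assume "m \<in> MN N"
      then obtain p where "p \<in> SB.U N" "\<pi> p = single m 1" using monomial_preimage[OF SB] by blast
      then show "single m 1 \<in> \<pi> ` SB.U N" by (metis image_eqI)
    qed
    show "card (SB.idxN N) \<le> card (E N)" for N unfolding IN by (rule card_E)
  qed (use \<pi>_const \<pi>_I \<pi>.comm_ring_hom_axioms in auto)
qed

text \<open>The instance with \<open>F i = \<theta> i\<close>. It determines the kernel of \<pi>, a
  statement that no longer mentions the polynomials \<open>f\<close>.\<close>

sublocale SB: scroll_basis_indep "tvars n" I \<theta> y "Suc s" r "\<lambda>_. [:0, 1:]" \<pi> E
  by (rule scroll_basis_indepI) auto

lemma keys_\<pi>: "p \<in> Pol (tvars n) \<Longrightarrow> keys (\<pi> p) \<subseteq> Mset"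
proof (induction p rule: Pol_induct)
  case (single m c)
  have mult: "keys (p * q) \<subseteq> Mset" if "keys p \<subseteq> Mset" "keys q \<subseteq> Mset" for p q :: "'k mpol"
    using keys_mult[of p q] that Mset_add by blast
  have "0 \<in> Mset" by (simp add: Mset_def)
  then have const: "keys (const_poly c :: 'k mpol) \<subseteq> Mset" for c
    by (simp add: const_poly_def)
  have "keys (\<Prod>v\<in>A. \<pi> (var_poly v) ^ lookup m v) \<subseteq> Mset" if "finite A" "A \<subseteq> tvars n" for A
    using that
  proof (induction A)
    case empty
    then show ?case using const[of 1] by simp
  next
    case (insert v A)
    then obtain l where l: "v = Vt l" "l < n" by auto
    have "keys (\<pi> (var_poly v)) \<subseteq> (\<Union>c<n. keys (const_poly (h l c) * single (mono_coord c) 1))"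
      unfolding l(1) \<pi>_var by (rule keys_sum)
    also have "\<dots> \<subseteq> Mset"
      by (intro UN_least mult[OF const]) (use mono_coord_in_Mset in simp)
    finally have v: "keys (\<pi> (var_poly v)) \<subseteq> Mset" .
    have "keys (\<pi> (var_poly v) ^ e) \<subseteq> Mset" for e
      using const[of 1] by (induction e) (simp_all add: mult v)
    then show ?case using insert mult by simp
  qed
  from this[of "keys m"] have "keys (\<pi> (mon_eval var_poly m)) \<subseteq> Mset"
    using single by (simp add: mon_eval_def \<pi>.hom_prod \<pi>.hom_power)
  then have "keys (const_poly c * \<pi> (single m 1)) \<subseteq> Mset"
    unfolding mon_eval_var_poly by (rule mult[OF const])
  then show ?case by (subst single_eq_const_mult) (simp add: \<pi>.hom_mult \<pi>_const)
next
  case (add p q)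
  then show ?case using keys_add[of "\<pi> p" "\<pi> q"] by (auto simp: \<pi>.hom_add)
qed

lemma \<pi>_surj:
  assumes "keys q \<subseteq> Mset"
  shows "\<exists>p\<in>Pol (tvars n). \<pi> p = q"
proof -
  have "\<exists>p. p \<in> Pol (tvars n) \<and> \<pi> p = single m 1" if "m \<in> Mset" for m
  proof -
    have "m \<in> MN (\<Sum>i<s. lookup m (Vt i))" using that by (simp add: MN_def)
    from monomial_preimage[OF SB.scroll_basis_axioms this] SB.U_in_Pol show ?thesis by blast
  qed
  then obtain P where P: "\<And>m. m \<in> Mset \<Longrightarrow> P m \<in> Pol (tvars n)" "\<And>m. m \<in> Mset \<Longrightarrow> \<pi> (P m) = single m 1"
    by metis
  have "\<pi> (\<Sum>m\<in>keys q. const_poly (lookup q m) * P m) = (\<Sum>m\<in>keys q. single m (lookup q m))"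
    using P(2) assms
    by (auto simp: \<pi>.hom_sum \<pi>.hom_mult \<pi>_const single_eq_const_mult[of _ "lookup q _"] intro!: sum.cong)
  also have "\<dots> = q" by (rule sum_single_lookup) auto
  finally show ?thesis
    using P(1) assms by (intro bexI[of _ "\<Sum>m\<in>keys q. const_poly (lookup q m) * P m"]) (auto intro!: Pol_sum Pol_mult)
qed

section \<open>Primality, normality and the Cohen-Macaulay property\<close>

lemma prime_I: "primeideal I (kt n)"
proof (rule primeideal_of_prime_set)
  note D = ideal_pol_ringD[OF I_ideal]
  have "1 \<notin> I" using \<pi>_I[of 1] by auto
  moreover have "a \<in> I \<or> b \<in> I" if "a \<in> Pol (tvars n)" "b \<in> Pol (tvars n)" "a * b \<in> I" for a b
    using \<pi>_I[OF that(3)] SB.ker_\<pi> that(1,2) by (auto simp: \<pi>.hom_mult)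
  ultimately show "prime_set (tvars n) I" using D unfolding prime_set_def by blast
qed

text \<open>Membership is decided by linear inequalities. One that is violated by \<alpha> - \<beta>
  would also be violated by \<gamma> + e (\<alpha> - \<beta>) for large e.\<close>

lemma Mset_saturated:
  assumes "\<alpha> \<in> Mset" "\<beta> \<in> Mset" "\<gamma> \<in> Mset"
    and mult: "\<And>e :: nat. \<exists>\<mu>\<in>Mset. \<forall>v. lookup \<gamma> v + e * lookup \<alpha> v = lookup \<mu> v + e * lookup \<beta> v"
  shows "\<exists>\<delta>\<in>Mset. \<alpha> = \<beta> + \<delta>"
proof -
  have "lookup \<beta> v \<le> lookup \<alpha> v" for v
  proof -
    have "0 \<le> int (lookup \<gamma> v) + int e * int (lookup \<alpha> v) - int e * int (lookup \<beta> v)" for e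
    proof -
      obtain \<mu> where "lookup \<gamma> v + e * lookup \<alpha> v = lookup \<mu> v + e * lookup \<beta> v" using mult[of e] by blast
      then have "int (lookup \<gamma> v) + int e * int (lookup \<alpha> v) = int (lookup \<mu> v) + int e * int (lookup \<beta> v)"
        by (metis of_nat_add of_nat_mult)
      then show ?thesis by simp
    qed
    from nat_le_of_multiples[OF _ this] show ?thesis by simp
  qed
  then have \<alpha>: "\<alpha> = \<beta> + (\<alpha> - \<beta>)" by (rule monomial_eq_add_diff)
  \<comment> \<open>The defining inequality as an additive function; it takes integer values because
    it may be negative outside the monoid.\<close>
  define wt where "wt m = (\<Sum>i<s. int (as ! i) * int (lookup m (Vt i))) - int (lookup m (Vt s))" for m
  have wt_add: "wt (m + m') = wt m + wt m'" for m m'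
    by (simp add: wt_def lookup_add distrib_left sum.distrib)
  have wt_ge: "m \<in> Mset \<longleftrightarrow> keys m \<subseteq> W \<and> 0 \<le> wt m" for m
  proof -
    have "(\<Sum>i<s. int (as ! i) * int (lookup m (Vt i))) = int (\<Sum>i<s. as ! i * lookup m (Vt i))" by simp
    then show ?thesis unfolding Mset_def wt_def by (simp only: mem_Collect_eq) linarith
  qed
  have "0 \<le> wt \<gamma> + int e * wt \<alpha> - int e * wt \<beta>" for e
  proof -
    obtain \<mu> where \<mu>: "\<mu> \<in> Mset" "\<forall>v. lookup \<gamma> v + e * lookup \<alpha> v = lookup \<mu> v + e * lookup \<beta> v"
      using mult[of e] by blast
    have "int (lookup \<gamma> v) + int e * int (lookup \<alpha> v) = int (lookup \<mu> v) + int e * int (lookup \<beta> v)" for v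
      using \<mu>(2) by (metis of_nat_add of_nat_mult)
    then have lk: "int (lookup \<mu> v) = int (lookup \<gamma> v) + int e * int (lookup \<alpha> v) - int e * int (lookup \<beta> v)" for v
      by (simp add: algebra_simps)
    have "wt \<mu> = wt \<gamma> + int e * wt \<alpha> - int e * wt \<beta>"
      unfolding wt_def lk by (simp add: algebra_simps sum.distrib sum_subtractf sum_distrib_left)
    then show ?thesis using \<mu>(1) wt_ge by simp
  qed
  then have "wt \<beta> \<le> wt \<alpha>" using assms(3) wt_ge nat_le_of_multiples[of "wt \<gamma>"] by blast
  moreover have "wt \<alpha> = wt \<beta> + wt (\<alpha> - \<beta>)" using wt_add \<alpha> by metis
  moreover have "keys (\<alpha> - \<beta>) \<subseteq> W"
    using assms(1) \<alpha> keys_nat_add[of \<beta> "\<alpha> - \<beta>"] by (auto simp: Mset_def)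
  ultimately show ?thesis using wt_ge \<alpha> by auto
qed

text \<open>Through \<pi> the quotient is the algebra of the monoid \<open>Mset\<close>, to which
  \<open>monoid_algebra_dvd\<close> applies; divisibility is carried there and back by
  representatives.\<close>

theorem normal_domain_quotient: "normal_domain (kt n Quot I)"
proof -
  interpret P: primeideal I "kt n" by (rule prime_I)
  let ?R = "kt n Quot I"
  let ?h = "\<lambda>a. I +>\<^bsub>kt n\<^esub> a"
  interpret R: "domain" ?R by (rule P.quotient_is_domain)
  have pow: "?h a [^]\<^bsub>?R\<^esub> m = ?h (a ^ m)" if "a \<in> Pol (tvars n)" for a :: "'k mpol" and m :: nat
  proof (induction m)
    case 0
    show ?case by (simp add: FactRing_def)
  next
    case (Suc m)
    then show ?case using quot_mult[OF I_ideal Pol_power[OF that] that] by (simp add: mult.commute)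
  qed
  have zero: "?h a = \<zero>\<^bsub>?R\<^esub> \<longleftrightarrow> \<pi> a = 0" if "a \<in> Pol (tvars n)" for a
  proof -
    have "\<zero>\<^bsub>?R\<^esub> = ?h 0" using P.a_rcos_const[of 0] P.is_additive_subgroup ideal_pol_ringD(2)[OF I_ideal]
      by (simp add: FactRing_def)
    then show ?thesis
      using coset_pol_ring_eq_iff[OF I_ideal that, of 0] SB.ker_\<pi>[OF that] \<pi>_I by auto
  qed
  show ?thesis
  proof (rule R.normal_domainI)
    fix a b c assume abc: "a \<in> carrier ?R" "b \<in> carrier ?R - {\<zero>\<^bsub>?R\<^esub>}" "c \<in> carrier ?R - {\<zero>\<^bsub>?R\<^esub>}"
      and ex: "\<And>m :: nat. \<exists>p\<in>carrier ?R. c \<otimes>\<^bsub>?R\<^esub> a [^]\<^bsub>?R\<^esub> m = b [^]\<^bsub>?R\<^esub> m \<otimes>\<^bsub>?R\<^esub> p"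
    then obtain a0 b0 c0 where *: "a0 \<in> Pol (tvars n)" "b0 \<in> Pol (tvars n)" "c0 \<in> Pol (tvars n)"
      "a = ?h a0" "b = ?h b0" "c = ?h c0" unfolding carrier_quot by blast
    have nz: "\<pi> b0 \<noteq> 0" "\<pi> c0 \<noteq> 0" using abc * zero by auto
    have "\<exists>p. keys p \<subseteq> Mset \<and> \<pi> c0 * \<pi> a0 ^ m = \<pi> b0 ^ m * p" for m
    proof -
      obtain p where p: "p \<in> carrier ?R" "c \<otimes>\<^bsub>?R\<^esub> a [^]\<^bsub>?R\<^esub> m = b [^]\<^bsub>?R\<^esub> m \<otimes>\<^bsub>?R\<^esub> p"
        using ex[of m] by blast
      then obtain p0 where p0: "p0 \<in> Pol (tvars n)" "p = ?h p0" unfolding carrier_quot by blast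
      have "?h (c0 * a0 ^ m) = ?h (b0 ^ m * p0)"
        using p(2) * p0 by (simp add: pow quot_mult[OF I_ideal] Pol_power)
      then have "c0 * a0 ^ m - b0 ^ m * p0 \<in> I"
        using coset_pol_ring_eq_iff[OF I_ideal, of "c0 * a0 ^ m" "b0 ^ m * p0"] * p0 by (simp add: Pol_mult Pol_power)
      then have "\<pi> c0 * \<pi> a0 ^ m = \<pi> b0 ^ m * \<pi> p0"
        using \<pi>_I by (fastforce simp: \<pi>.hom_minus \<pi>.hom_mult \<pi>.hom_power)
      then show ?thesis using keys_\<pi>[OF p0(1)] by blast
    qed
    then have "\<exists>q. keys q \<subseteq> Mset \<and> \<pi> a0 = \<pi> b0 * q"
      using nz * keys_\<pi> Mset_add Mset_saturated
      by (intro monoid_algebra_dvd[of W Mset "\<pi> b0" "\<pi> c0" "\<pi> a0"]) (auto simp: Mset_def)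
    then obtain q where q: "keys q \<subseteq> Mset" "\<pi> a0 = \<pi> b0 * q" by blast
    obtain q0 where q0: "q0 \<in> Pol (tvars n)" "\<pi> q0 = q" using \<pi>_surj[OF q(1)] by blast
    have "a0 - b0 * q0 \<in> I"
      using * q q0 by (intro SB.ker_\<pi> Pol_diff Pol_mult) (auto simp: \<pi>.hom_minus \<pi>.hom_mult)
    then have "a = b \<otimes>\<^bsub>?R\<^esub> ?h q0"
      using * q0 coset_pol_ring_eq_iff[OF I_ideal, of a0 "b0 * q0"] by (simp add: quot_mult[OF I_ideal] Pol_mult)
    then show "\<exists>q\<in>carrier ?R. a = b \<otimes>\<^bsub>?R\<^esub> q" using q0(1) unfolding carrier_quot by blast
  qed
qed

text \<open>At every maximal ideal, \<open>Suc s\<close> \<le> depth \<le> height \<le>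
  \<open>card W\<close> = \<open>Suc s\<close>: the first bound is a regular sequence, the last one
  the number of variables of the parametrization.\<close>

theorem cohen_macaulay_quotient: "cohen_macaulay (kt n Quot I)"
  unfolding cohen_macaulay_def
proof (intro conjI allI impI)
  let ?R = "kt n Quot I"
  interpret I: ideal I "kt n" by (rule I_ideal)
  show cring: "cring ?R" using I.quotient_is_cring[OF cring_pol_ring] .
  show noeth: "noetherian_ring ?R"
    by (rule noetherian_ring.noetherian_quotient[OF noetherian_pol_ring I_ideal]) simp
  fix P assume P: "maximalideal P ?R"
  interpret P: maximalideal P ?R by (rule P)
  have prime: "primeideal P ?R" using cring.maximalideal_prime[OF cring P] .
  have pU: "prime_set (tvars n) (\<Union> P)" by (rule prime_set_Union[OF I_ideal prime])
  note D = prime_setD[OF pU]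
  \<comment> \<open>The Nullstellensatz gives a nonzero polynomial, which is made monic. Its degree
    is positive since otherwise it would be 1, which is not in a proper ideal.\<close>
  have "\<exists>f. lead_coeff f = 1 \<and> 0 < degree f \<and> upoly_eval (\<theta> i) f \<in> \<Union> P" for i
  proof -
    have \<theta>: "\<theta> i \<in> Pol (tvars n)" using x_in_Pol by (auto simp: \<theta>_def intro: Pol_diff)
    have "\<exists>f. f \<noteq> 0 \<and> upoly_eval (\<theta> i) f \<in> \<Union> P"
      by (rule maximal_ideal_algebraic[OF _ D(1-4) maximal_Union_inverse[OF I_ideal P] \<theta>]) auto
    then obtain f where f: "f \<noteq> 0" "upoly_eval (\<theta> i) f \<in> \<Union> P" by blast
    define f' where "f' = smult (inverse (lead_coeff f)) f"
    have f': "lead_coeff f' = 1" "upoly_eval (\<theta> i) f' \<in> \<Union> P"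
      using f D(4)[OF f(2), of "const_poly (inverse (lead_coeff f))"] by (simp_all add: f'_def upoly_eval_smult)
    have "degree f' \<noteq> 0"
    proof
      assume "degree f' = 0"
      then have "f' = 1" using f'(1) by (metis degree_0_id one_poly_eq_simps(1) pCons_one)
      then show False using f'(2) D(5) by simp
    qed
    then show ?thesis using f' by blast
  qed
  then obtain f where f: "\<And>i. lead_coeff (f i) = 1" "\<And>i. 0 < degree (f i)" "\<And>i. upoly_eval (\<theta> i) (f i) \<in> \<Union> P"
    by metis
  interpret B: scroll_basis_indep "tvars n" I \<theta> y "Suc s" r f \<pi> E
    using f by (intro scroll_basis_indepI) auto
  let ?Fs = "map B.F [0..<Suc s]"
  have set_take: "set (take i ?Fs) = B.F ` {..<i}" if "i < Suc s" for i
    using that by (auto simp: take_map simp del: upt_Suc)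
  have reg: "regular_sequence ?R (map (\<lambda>a. I +>\<^bsub>kt n\<^esub> a) ?Fs) \<and> set (map (\<lambda>a. I +>\<^bsub>kt n\<^esub> a) ?Fs) \<subseteq> P"
  proof (rule regular_sequence_quotI[OF I_ideal _ P.is_ideal])
    show "set ?Fs \<subseteq> Pol (tvars n)" using B.F_in_Pol by auto
    show "P \<noteq> carrier ?R" using P.I_notcarr by blast
    show "F \<in> \<Union> P" if "F \<in> set ?Fs" for F using that f(3) by (auto simp: B.F_def)
    fix i a b assume i: "i < length ?Fs" and ab: "a \<in> Pol (tvars n)" "b \<in> genideal (kt n) (set (take i ?Fs))"
      "?Fs ! i * a - b \<in> I"
    have i': "i < Suc s" using i by simp
    have "?Fs ! i = B.F i" using i by (simp del: upt_Suc)
    then show "\<exists>b\<in>genideal (kt n) (set (take i ?Fs)). a - b \<in> I"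
      using ab B.regular[OF i' ab(1)] unfolding set_take[OF i'] by simp
  qed
  have "enat (Suc s) \<le> depth ?R P"
    unfolding depth_def
    by (intro Sup_upper CollectI exI[of _ "map (\<lambda>a. I +>\<^bsub>kt n\<^esub> a) ?Fs"] conjI)
      (use reg in \<open>simp_all only: length_map length_upt diff_zero\<close>)
  moreover have "prime_height ?R P \<le> enat (card W)"
    using prime_height_quot_le[OF I_ideal \<pi>.comm_ring_hom_axioms \<pi>_const _ SB.ker_\<pi> _ prime, of W] keys_\<pi>
    by (auto simp: Pol_def Mset_def subset_iff)
  moreover have "card W = Suc s" by (simp add: card_image inj_on_def)
  moreover have "depth ?R P \<le> prime_height ?R P"
    using noetherian_ring.depth_le_prime_height[OF noeth cring prime] .
  ultimately show "depth ?R P = prime_height ?R P" by (metis dual_order.trans order_antisym)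
qed

end

section \<open>Pencils whose maximal minors have no common factor\<close>

lemma hom_eq_on_Pol:
  fixes f g :: "'k::field mpol \<Rightarrow> 'b::comm_ring_1"
  assumes "comm_ring_hom f" "comm_ring_hom g" "\<And>c. f (const_poly c) = g (const_poly c)"
    and "\<And>v. v \<in> V \<Longrightarrow> f (var_poly v) = g (var_poly v)" "p \<in> Pol V"
  shows "f p = g p"
proof -
  interpret f: comm_ring_hom f by fact
  interpret g: comm_ring_hom g by fact
  show ?thesis
    using assms(5)
  proof (induction p rule: Pol_induct)
    case (single m c)
    have "f (mon_eval var_poly m) = g (mon_eval var_poly m)"
      unfolding mon_eval_def f.hom_prod g.hom_prod f.hom_power g.hom_power
      using single assms(4) by (intro prod.cong refl) (auto simp: subset_iff)
    then have "f (single m 1) = g (single m 1)" unfolding mon_eval_var_poly .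
    then show ?case by (subst (1 2) single_eq_const_mult) (simp add: f.hom_mult g.hom_mult assms(3))
  qed (simp add: f.hom_add g.hom_add)
qed

lemma ker_prime_set:
  fixes f :: "'k::field mpol \<Rightarrow> 'b::idom"
  assumes "comm_ring_hom f"
  shows "prime_set V {p \<in> Pol V. f p = 0}"
proof -
  interpret comm_ring_hom f by fact
  show ?thesis by (auto simp: prime_set_def hom_add hom_mult intro: Pol_add Pol_mult)
qed

lemma det_in_Pol:
  fixes A :: "'k::field mpol mat"
  assumes "\<And>i j. i < dim_row A \<Longrightarrow> j < dim_col A \<Longrightarrow> A $$ (i, j) \<in> Pol V"
  shows "det A \<in> Pol V"
proof -
  have sg: "(signof p :: 'k mpol) \<in> Pol V" for p :: "nat \<Rightarrow> nat"
    by (simp add: sign_def Pol_uminus)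
  show ?thesis
    unfolding det_def
    by (auto intro!: Pol_sum Pol_mult sg Pol_prod assms dest: permutes_in_image[where x = "_ :: nat"])
qed

lemma linear_form_expand:
  assumes "linear_form V p" "finite V"
  shows "p = (\<Sum>v\<in>V. const_poly (lookup p (single v 1)) * var_poly v)"
proof -
  have "m \<in> (\<lambda>v. single v 1) ` V" if m: "m \<in> keys p" for m
  proof -
    have deg: "(\<Sum>v\<in>keys m. lookup m v) = 1" and sub: "keys m \<subseteq> V"
      using assms(1) m by (auto simp: linear_form_def homogeneous_def Pol_def)
    then obtain v where v: "v \<in> keys m" by (metis sum.empty zero_neq_one ex_in_conv)
    have "lookup m v + (\<Sum>w\<in>keys m - {v}. lookup m w) = 1" using deg v by (simp add: sum.remove)
    moreover have "lookup m v \<noteq> 0" using v by (simp add: in_keys_iff)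
    ultimately have "lookup m v = 1" "(\<Sum>w\<in>keys m - {v}. lookup m w) = 0" by linarith+
    moreover from this have "\<forall>w\<in>keys m - {v}. lookup m w = 0" by (subst (asm) sum_eq_0_iff) auto
    ultimately have "lookup m w = 0" if "w \<noteq> v" for w
      using that by (cases "w \<in> keys m") (blast, meson in_keys_iff)
    then have "m = single v 1"
      using \<open>lookup m v = 1\<close> by (intro poly_mapping_eqI) (auto simp: lookup_single when_def)
    then show ?thesis using v sub by auto
  qed
  then have "p = (\<Sum>m\<in>(\<lambda>v. single v 1) ` V. single m (lookup p m))"
    using assms(2) by (intro sum_single_lookup[symmetric]) auto
  also have "\<dots> = (\<Sum>v\<in>V. single (single v 1) (lookup p (single v 1)))"
    by (subst sum.reindex) (auto simp: inj_on_def single_eq_iff)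
  also have "\<dots> = (\<Sum>v\<in>V. const_poly (lookup p (single v 1)) * var_poly v)"
    by (intro sum.cong refl) (simp add: const_poly_def var_poly_def mult_single)
  finally show ?thesis .
qed

interpretation const_ac: comm_ring_hom "\<lambda>c :: 'k::field. const_poly (to_ac c)"
  by unfold_locales (auto simp: const_poly.hom_add const_poly.hom_mult)

text \<open>Restriction of polynomials to the plane of the points (x, \<eta> z, \<zeta> z) over the
  algebraic closure. Taking \<open>e = 0\<close> cuts this down to a line, and scaling (\<eta>,
  \<zeta>) to 0 as well leaves the origin.\<close>

definition point_hom :: "'k::field alg_closure \<Rightarrow> 'k alg_closure \<Rightarrow> 'k alg_closure \<Rightarrow> 'k mpol \<Rightarrow> 'k alg_closure mpol" where
  "point_hom e \<eta> \<zeta> = eval_mpoly (\<lambda>c. const_poly (to_ac c))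
    (\<lambda>v. case v of Vx \<Rightarrow> const_poly e * var_poly Vx | Vy \<Rightarrow> const_poly \<eta> * var_poly Vz
      | Vz \<Rightarrow> const_poly \<zeta> * var_poly Vz | _ \<Rightarrow> 0)"

lemma point_hom: "comm_ring_hom (point_hom e \<eta> \<zeta>)"
  unfolding point_hom_def by (rule const_ac.comm_ring_hom_eval_mpoly)

lemma point_hom_simps:
  "point_hom e \<eta> \<zeta> (const_poly c) = const_poly (to_ac c)"
  "point_hom e \<eta> \<zeta> (var_poly Vx) = const_poly e * var_poly Vx"
  "point_hom e \<eta> \<zeta> (var_poly Vy) = const_poly \<eta> * var_poly Vz"
  "point_hom e \<eta> \<zeta> (var_poly Vz) = const_poly \<zeta> * var_poly Vz"
  by (simp_all add: point_hom_def var_poly_def, simp_all add: const_poly_def[of c])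

lemma point_hom_specialize:
  assumes "point_hom e \<eta> \<zeta> p = 0" "p \<in> Pol {Vx, Vy, Vz}"
  shows "point_hom (e * e') (\<eta> * f) (\<zeta> * f) p = 0"
proof -
  define \<psi> where "\<psi> = eval_mpoly const_poly (\<lambda>v. case v of Vx \<Rightarrow> const_poly e' * var_poly Vx
    | Vz \<Rightarrow> const_poly f * var_poly Vz | _ \<Rightarrow> (0 :: 'a alg_closure mpol))"
  interpret \<psi>: comm_ring_hom \<psi> unfolding \<psi>_def by (rule const_poly.comm_ring_hom_eval_mpoly)
  interpret h: comm_ring_hom "point_hom e \<eta> \<zeta>" by (rule point_hom)
  have \<psi>: "\<psi> (const_poly c) = const_poly c" "\<psi> (var_poly Vx) = const_poly e' * var_poly Vx"
    "\<psi> (var_poly Vz) = const_poly f * var_poly Vz" for c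
    by (simp_all add: \<psi>_def var_poly_def, simp_all add: const_poly_def[of c])
  have "\<psi> (point_hom e \<eta> \<zeta> p) = point_hom (e * e') (\<eta> * f) (\<zeta> * f) p"
  proof (rule hom_eq_on_Pol[where f = "\<lambda>p. \<psi> (point_hom e \<eta> \<zeta> p)", OF _ point_hom _ _ assms(2)])
    show "comm_ring_hom (\<lambda>p. \<psi> (point_hom e \<eta> \<zeta> p))"
      by unfold_locales (auto simp: h.hom_add h.hom_mult \<psi>.hom_add \<psi>.hom_mult)
  next
    fix c
    show "\<psi> (point_hom e \<eta> \<zeta> (const_poly c)) = point_hom (e * e') (\<eta> * f) (\<zeta> * f) (const_poly c)"
      by (simp only: point_hom_simps \<psi>)
  next
    fix v assume "v \<in> {Vx, Vy, Vz}"
    then show "\<psi> (point_hom e \<eta> \<zeta> (var_poly v)) = point_hom (e * e') (\<eta> * f) (\<zeta> * f) (var_poly v)"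
      by (elim insertE emptyE) (simp_all only: point_hom_simps \<psi> \<psi>.hom_mult const_poly.hom_mult mult.assoc)
  qed
  then show ?thesis using assms(1) by simp
qed

text \<open>
  A common zero \<open>(\<eta> : \<zeta>)\<close> of the maximal minors of the pencil yields a prime \<open>P\<close> containing the maximal
  minors of \<open>\<phi>\<close> and a chain \<open>P \<subset> P' \<subset> P''\<close>. As \<open>P\<close> has height at least 2, there would be a chain of
  five primes in \<open>k[x,y,z]\<close>.
\<close>

lemma no_common_zero:
  fixes \<phi> :: "'k::field mpol mat" and \<eta> \<zeta> :: "'k alg_closure"
  assumes \<phi>: "\<phi> \<in> carrier_mat n (n - 1)" "u < n"
    and lin: "\<And>i j. i < n \<Longrightarrow> j < n - 1 \<Longrightarrow> \<phi> $$ (i, j) \<in> Pol {Vx, Vy, Vz}"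
    and pencil: "\<And>i j. i < n \<Longrightarrow> u \<le> j \<Longrightarrow> j < n - 1 \<Longrightarrow>
      \<phi> $$ (i, j) = const_poly (A i j) * var_poly Vy + const_poly (C i j) * var_poly Vz"
    and ht: "height kxyz (minors_ideal kxyz (n - 1) \<phi>) = 2"
    and pt: "\<eta> \<noteq> 0 \<or> \<zeta> \<noteq> 0"
    and \<kappa>: "\<And>i. i < n \<Longrightarrow> (\<Sum>j\<in>{u..<n - 1}. \<kappa> j * (to_ac (A i j) * \<eta> + to_ac (C i j) * \<zeta>)) = 0"
      "j0 \<in> {u..<n - 1}" "\<kappa> j0 \<noteq> 0"
  shows False
proof -
  let ?V = "{Vx, Vy, Vz}"
  let ?\<chi> = "point_hom 1 \<eta> \<zeta>"
  interpret \<chi>: comm_ring_hom ?\<chi> by (rule point_hom)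
  \<comment> \<open>The primes of the plane over the point, of its line x = 0 and of the origin are
    \<open>P 1 1\<close>, \<open>P 0 1\<close> and \<open>P 0 0\<close>. The kernels are taken in
    k[x,y,z] although the point has coordinates in the closure.\<close>
  define P where "P e f = {p \<in> Pol ?V. point_hom e (\<eta> * f) (\<zeta> * f) p = 0}" for e f
  have prime: "prime_set ?V (P e f)" for e f unfolding P_def by (rule ker_prime_set[OF point_hom])
  have spec: "P e f \<subseteq> P (e * e') (f * f')" for e f e' f'
    unfolding P_def using point_hom_specialize[of e "\<eta> * f" "\<zeta> * f" _ e' f'] by (auto simp: mult.assoc)
  have vn: "(var_poly v :: 'k alg_closure mpol) \<noteq> 0" for v
    by (metis lookup_single_eq lookup_zero var_poly_def zero_neq_one)
  have P1: "P 1 1 \<subset> P 0 1"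
  proof
    show "P 1 1 \<subseteq> P 0 1" using spec[of 1 1 0 1] by simp
    have "var_poly Vx \<in> P 0 1" "var_poly Vx \<notin> P 1 1" using vn by (auto simp: P_def point_hom_simps)
    then show "P 1 1 \<noteq> P 0 1" by blast
  qed
  have P2: "P 0 1 \<subset> P 0 0"
  proof
    show "P 0 1 \<subseteq> P 0 0" using spec[of 0 1 1 0] by simp
    have "var_poly Vy \<in> P 0 0" "var_poly Vz \<in> P 0 0" "var_poly Vy \<notin> P 0 1 \<or> var_poly Vz \<notin> P 0 1"
      using vn pt by (auto simp: P_def point_hom_simps)
    then show "P 0 1 \<noteq> P 0 0" by blast
  qed
  have minors: "det (submatrix \<phi> I J) \<in> P 1 1"
    if IJ: "I \<subseteq> {..<dim_row \<phi>}" "J \<subseteq> {..<dim_col \<phi>}" "card I = n - 1" "card J = n - 1" for I J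
  proof -
    have dims: "dim_row \<phi> = n" "dim_col \<phi> = n - 1" using \<phi> by auto
    have J: "J = {..<n - 1}" using IJ(2,4) dims by (intro card_subset_eq) auto
    have cI: "card {i. i < n \<and> i \<in> I} = n - 1"
      using IJ(1,3) dims by (metis (no_types, lifting) Collect_cong Collect_mem_eq lessThan_iff subset_iff)
    have cJ: "card {j. j < n - 1 \<and> j \<in> J} = n - 1" by (simp add: J)
    let ?S = "submatrix \<phi> I J"
    have S: "?S \<in> carrier_mat (n - 1) (n - 1)" 
      by (rule carrier_matI) (unfold dim_submatrix dims, rule cI, rule cJ)
    have pickJ: "pick J j = j" if "j < n - 1" for j
    proof -
      have "card {a \<in> J. a < j} = j"
      proof -
        have "{a \<in> J. a < j} = {..<j}" using that by (auto simp: J)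
        then show ?thesis by simp
      qed
      then show ?thesis using pick_card_in_set[of j J] that by (simp add: J)
    qed
    have pickI: "pick I i < n" if "i < n - 1" for i
      using pick_le[of i n I] that cI by simp
    have ix: "?S $$ (i, j) = \<phi> $$ (pick I i, j)" if "i < n - 1" "j < n - 1" for i j
    proof -
      have "?S $$ (i, j) = \<phi> $$ (pick I i, pick J j)"
        by (rule submatrix_index) (unfold dims cI cJ, rule that(1), rule that(2))
      then show ?thesis unfolding pickJ[OF that(2)] .
    qed
    \<comment> \<open>Extended by 0 over the first \<open>u\<close> columns, the dependency is a
      kernel vector of every square submatrix of size \<open>n - 1\<close>, because substitution
      turns an entry of a later column into (A \<eta> + C \<zeta>) z.\<close>
    define v where "v = vec (n - 1) (\<lambda>j. if u \<le> j then const_poly (\<kappa> j) else 0 :: 'k alg_closure mpol)"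
    have "v \<noteq> 0\<^sub>v (n - 1)"
    proof
      assume "v = 0\<^sub>v (n - 1)"
      then have "v $ j0 = 0\<^sub>v (n - 1) $ j0" by simp
      then show False using \<kappa>(2,3) by (simp add: v_def)
    qed
    moreover have "map_mat ?\<chi> ?S *\<^sub>v v = 0\<^sub>v (n - 1)"
    proof (rule eq_vecI)
      fix i assume "i < dim_vec (0\<^sub>v (n - 1) :: 'k alg_closure mpol vec)"
      then have i: "i < n - 1" by simp
      have "(map_mat ?\<chi> ?S *\<^sub>v v) $ i = (\<Sum>j = 0..<n - 1. ?\<chi> (?S $$ (i, j)) * v $ j)"
        using i S by (simp add: scalar_prod_def v_def)
      also have "\<dots> = (\<Sum>j\<in>{u..<n - 1}. ?\<chi> (\<phi> $$ (pick I i, j)) * const_poly (\<kappa> j))"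
        using i by (intro sum.mono_neutral_cong_right) (auto simp: v_def ix)
      also have "\<dots> = (\<Sum>j\<in>{u..<n - 1}. const_poly (\<kappa> j * (to_ac (A (pick I i) j) * \<eta> + to_ac (C (pick I i) j) * \<zeta>)) * var_poly Vz)"
      proof (intro sum.cong refl)
        fix j assume "j \<in> {u..<n - 1}"
        then have "\<phi> $$ (pick I i, j) = const_poly (A (pick I i) j) * var_poly Vy + const_poly (C (pick I i) j) * var_poly Vz"
          using pickI[OF i] by (intro pencil) auto
        then show "?\<chi> (\<phi> $$ (pick I i, j)) * const_poly (\<kappa> j) =
          const_poly (\<kappa> j * (to_ac (A (pick I i) j) * \<eta> + to_ac (C (pick I i) j) * \<zeta>)) * var_poly Vz"
          by (simp only: \<chi>.hom_add \<chi>.hom_mult point_hom_simps const_poly.hom_add const_poly.hom_mult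
              distrib_left distrib_right mult_ac)
      qed
      also have "\<dots> = const_poly (\<Sum>j\<in>{u..<n - 1}. \<kappa> j * (to_ac (A (pick I i) j) * \<eta> + to_ac (C (pick I i) j) * \<zeta>)) * var_poly Vz"
        by (simp only: const_poly.hom_sum sum_distrib_right)
      also have "\<dots> = 0" unfolding \<kappa>(1)[OF pickI[OF i]] by simp
      finally show "(map_mat ?\<chi> ?S *\<^sub>v v) $ i = 0\<^sub>v (n - 1) $ i" using i by simp
    qed (use S in auto)
    moreover have "v \<in> carrier_vec (n - 1)" by (simp add: v_def)
    ultimately have "det (map_mat ?\<chi> ?S) = 0"
      using det_0_iff_vec_prod_zero[of "map_mat ?\<chi> ?S" "n - 1"] S by auto
    then have "?\<chi> (det ?S) = 0" by (simp only: \<chi>.hom_det)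
    moreover have "det ?S \<in> Pol ?V"
    proof (rule det_in_Pol)
      fix i j assume "i < dim_row ?S" "j < dim_col ?S"
      then have "i < n - 1" "j < n - 1" using S by auto
      then show "?S $$ (i, j) \<in> Pol ?V" using ix pickI lin by simp
    qed
    ultimately show ?thesis by (simp add: P_def)
  qed
  have "minors_ideal kxyz (n - 1) \<phi> \<subseteq> P 1 1"
    unfolding minors_ideal_def
  proof (rule ring.genideal_minimal[OF cring.axioms(1)[OF cring_pol_ring]])
    show "ideal (P 1 1) kxyz" using primeideal_of_prime_set[OF prime] by (rule primeideal.axioms(1))
  qed (use minors in blast)
  then have "height kxyz (minors_ideal kxyz (n - 1) \<phi>) \<le> prime_height kxyz (P 1 1)"
    unfolding height_def using primeideal_of_prime_set[OF prime] by (intro Inf_lower) blast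
  then have "enat 1 < prime_height kxyz (P 1 1)"
    unfolding ht by (rule order.strict_trans2[rotated]) (simp add: numeral_eq_enat)
  then obtain l where "l \<in> {enat (length Ps) |Ps. (\<forall>Q\<in>set Ps. primeideal Q (kxyz :: 'k mpol ring)) \<and> sorted_wrt (\<subset>) (Ps @ [P 1 1])}"
    "enat 1 < l" unfolding prime_height_def less_Sup_iff by blast
  then obtain Ps where Ps: "1 < length Ps" "\<forall>Q\<in>set Ps. primeideal Q (kxyz :: 'k mpol ring)"
    "sorted_wrt (\<subset>) (Ps @ [P 1 1])" by auto
  \<comment> \<open>Height at least 2 provides two primes below \<open>P 1 1\<close>. Together with
    the three kernels they form a chain of five primes in three variables.\<close>
  define Q where "Q i = ([Ps ! 0, Ps ! 1, P 1 1, P 0 1, P 0 0] ! i)" for i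
  have Ps_mem: "Ps ! 0 \<in> set Ps" "Ps ! 1 \<in> set Ps" by (intro nth_mem, use Ps(1) in linarith)+
  have "sorted_wrt (\<subset>) Ps" using Ps(3) by (simp add: sorted_wrt_append)
  then have s1: "Ps ! 0 \<subset> Ps ! 1" by (rule sorted_wrt_nth_less) (use Ps(1) in auto)
  have s2: "Ps ! 1 \<subset> P 1 1" using Ps(3) Ps_mem by (simp add: sorted_wrt_append)
  have Qp: "prime_set ?V (Q i)" if "i \<le> 4" for i
  proof -
    have "i \<in> {0, 1, 2, 3, 4}" using that by auto
    then show ?thesis
      using prime prime_set_of_primeideal[OF Ps(2)[rule_format, OF Ps_mem(1)]]
        prime_set_of_primeideal[OF Ps(2)[rule_format, OF Ps_mem(2)]] by (auto simp: Q_def)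
  qed
  have Qs: "Q i \<subset> Q (Suc i)" if "i < 4" for i
  proof -
    have "i \<in> {0, 1, 2, 3}" using that by auto
    then show ?thesis using s1 s2 P1 P2 by (auto simp: Q_def numeral_eq_Suc)
  qed
  show False
  proof (rule no_long_prime_chain[where \<pi> = id and V = ?V and W = ?V and N = 4 and Q = Q])
    show "comm_ring_hom (id :: 'k mpol \<Rightarrow> 'k mpol)" by unfold_locales auto
    show "p \<in> Q 0" if "id p = 0" for p using that prime_setD(2)[OF Qp[of 0]] by simp
  qed (use Qp Qs in auto)
qed

section \<open>Invariant subspaces and eigenvectors\<close>

interpretation mpp: vector_space_pair "\<lambda>(c :: 'k::field) (p :: 'k mpol). const_poly c * p" "\<lambda>(c :: 'k) (p :: 'k mpol). const_poly c * p"
  by unfold_locales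

abbreviation k_linear :: "('k::field mpol \<Rightarrow> 'k mpol) \<Rightarrow> bool" where
  "k_linear T \<equiv> Vector_Spaces.linear (\<lambda>c p. const_poly c * p) (\<lambda>c p. const_poly c * p) T"

lemma k_linearD:
  assumes "k_linear T"
  shows "T (p + q) = T p + T q" "T (const_poly c * p) = const_poly c * T p" "T (sum g A) = (\<Sum>i\<in>A. T (g i))"
proof -
  interpret T: Vector_Spaces.linear "\<lambda>c p. const_poly c * p" "\<lambda>c p. const_poly c * p" T by fact
  show "T (p + q) = T p + T q" "T (const_poly c * p) = const_poly c * T p" "T (sum g A) = (\<Sum>i\<in>A. T (g i))"
    by (rule T.add T.scale T.sum)+
qed

text \<open>The number \<open>e\<close> is the least one for which the power of T applied to
  \<open>y\<close> depends on the preceding ones; for linear T, the \<open>c i\<close> give its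
  minimal polynomial at \<open>y\<close>.\<close>

lemma cyclic_relation:
  fixes T :: "'k::field mpol \<Rightarrow> 'k mpol"
  assumes "finite F" "\<And>i. (T ^^ i) y \<in> mp.span F" "y \<noteq> 0"
  obtains e c where "0 < e" "inj_on (\<lambda>i. (T ^^ i) y) {..<e}" "mp.independent ((\<lambda>i. (T ^^ i) y) ` {..<e})"
    "(T ^^ e) y = (\<Sum>i<e. const_poly (c i) * (T ^^ i) y)"
proof -
  let ?w = "\<lambda>i. (T ^^ i) y"
  have ind: "inj_on ?w {..<e} \<and> mp.independent (?w ` {..<e})" if "\<And>i. i < e \<Longrightarrow> ?w i \<notin> mp.span (?w ` {..<i})" for e
    using that
  proof (induction e)
    case (Suc e)
    then have IH: "inj_on ?w {..<e}" "mp.independent (?w ` {..<e})" by auto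
    have e: "?w e \<notin> mp.span (?w ` {..<e})" using Suc.prems by blast
    have "?w e \<notin> ?w ` {..<e}"
    proof
      assume "?w e \<in> ?w ` {..<e}"
      from mp.span_base[OF this] e show False by contradiction
    qed
    then show ?case
      using IH e mp.independent_insertI[OF e] by (simp add: lessThan_Suc)
  qed (auto simp: mp.independent_empty)
  have "\<exists>i. ?w i \<in> mp.span (?w ` {..<i})"
  proof (rule ccontr)
    assume no: "\<nexists>i. ?w i \<in> mp.span (?w ` {..<i})"
    let ?e = "Suc (card F)"
    have *: "inj_on ?w {..<?e}" "mp.independent (?w ` {..<?e})" using ind[of ?e] no by blast+
    have "?w ` {..<?e} \<subseteq> mp.span F" using assms(2) by blast
    then have "card (?w ` {..<?e}) \<le> card F" using mp.independent_span_bound[OF assms(1) *(2)] by blast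
    then show False using card_image[OF *(1)] by simp
  qed
  define e where "e = (LEAST i. ?w i \<in> mp.span (?w ` {..<i}))"
  have e: "?w e \<in> mp.span (?w ` {..<e})" "\<And>i. i < e \<Longrightarrow> ?w i \<notin> mp.span (?w ` {..<i})"
    unfolding e_def by (rule LeastI_ex, fact) (rule not_less_Least)
  have "e \<noteq> 0" using e(1) assms(3) by (intro notI) simp
  note ie = ind[OF e(2)]
  obtain r where "?w e = (\<Sum>v\<in>?w ` {..<e}. const_poly (r v) * v)"
    using e(1) unfolding mp.span_finite[OF finite_imageI[OF finite_lessThan]] by blast
  then have "?w e = (\<Sum>i<e. const_poly (r (?w i)) * ?w i)" using ie by (simp add: sum.reindex)
  then show ?thesis using that[of e "\<lambda>i. r (?w i)"] ie \<open>e \<noteq> 0\<close> by blast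
qed

lemma span_family_coeffs:
  fixes b :: "nat \<Rightarrow> 'k::field mpol"
  assumes "p \<in> mp.span (b ` {..<m})"
  shows "\<exists>h. p = (\<Sum>j<m. const_poly (h j) * b j)"
  using assms
proof (induction rule: span_induct_mp)
  case zero
  show ?case by (intro exI[of _ "\<lambda>_. 0"]) simp
next
  case (add p q)
  then obtain h h' where "p = (\<Sum>j<m. const_poly (h j) * b j)" "q = (\<Sum>j<m. const_poly (h' j) * b j)" by blast
  then show ?case
    by (intro exI[of _ "\<lambda>j. h j + h' j"]) (simp add: const_poly.hom_add distrib_right sum.distrib)
next
  case (scale a p)
  then obtain h where "p = (\<Sum>j<m. const_poly (h j) * b j)" by blast
  then show ?case by (intro exI[of _ "\<lambda>j. a * h j"]) (simp only: const_poly_mult_sum)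
next
  case (base p)
  then obtain j where j: "j < m" "p = b j" by blast
  have "(\<Sum>j'<m. const_poly (if j' = j then 1 else 0) * b j') = (\<Sum>j'<m. if j' = j then b j else 0)"
    by (intro sum.cong) auto
  then show ?case using j by (intro exI[of _ "\<lambda>j'. if j' = j then 1 else 0"]) simp
qed

lemma lookup_linear_combination:
  assumes "l < n"
  shows "lookup (\<Sum>l<n. const_poly (g l) * var_poly (Vt l)) (single (Vt l) 1) = g l"
proof -
  have "lookup (\<Sum>l<n. const_poly (g l) * var_poly (Vt l)) (single (Vt l) 1) = (\<Sum>l'<n. if l' = l then g l else 0)"
    unfolding lookup_sum
    by (intro sum.cong refl) (auto simp: lookup_const_mult var_poly_def lookup_single when_def single_eq_iff)
  then show ?thesis using assms by simp
qed

text \<open>Let P be the minimal polynomial of T at \<open>y\<close>, with a root \<open>ev\<close>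
  in the closure and P = (Y - ev) q. Then q(T) y is an eigenvector, nonzero because q has smaller
  degree. Since it exists only after extension of scalars, it is represented by its coordinates
  \<kappa> with respect to the \<open>b j\<close>.\<close>

lemma invariant_subspace_eigenvector:
  fixes b c :: "nat \<Rightarrow> 'k::field mpol"
  assumes b: "\<And>j. j < m \<Longrightarrow> b j = (\<Sum>l<n. const_poly (A l j) * var_poly (Vt l))"
    and c: "\<And>j. j < m \<Longrightarrow> c j = (\<Sum>l<n. const_poly (C l j) * var_poly (Vt l))"
    and T: "k_linear T" "\<And>j. j < m \<Longrightarrow> T (b j) = c j"
    and Y: "Y \<subseteq> mp.span (b ` {..<m})" "T ` Y \<subseteq> Y" "y \<in> Y" "y \<noteq> 0"
  shows "\<exists>ev \<kappa> j0. j0 < m \<and> \<kappa> j0 \<noteq> 0 \<and>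
    (\<forall>l<n. (\<Sum>j<m. \<kappa> j * (to_ac (A l j) * (- ev) + to_ac (C l j))) = 0)"
proof -
  let ?w = "\<lambda>i. (T ^^ i) y"
  have wY: "?w i \<in> Y" for i using Y by (induction i) auto
  then have wspan: "?w i \<in> mp.span (b ` {..<m})" for i using Y(1) by blast
  from cyclic_relation[of "b ` {..<m}" T y, OF _ wspan Y(4)]
  obtain e d where e: "0 < e" "inj_on ?w {..<e}" "mp.independent (?w ` {..<e})"
    "?w e = (\<Sum>i<e. const_poly (d i) * ?w i)" by auto
  have "\<exists>h. ?w i = (\<Sum>j<m. const_poly (h j) * b j)" for i
    using wspan[of i] by (rule span_family_coeffs)
  then obtain H where H: "\<And>i. ?w i = (\<Sum>j<m. const_poly (H i j) * b j)" by metis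
  have Tw: "?w (Suc i) = (\<Sum>j<m. const_poly (H i j) * c j)" for i
    using T(2) by (simp add: H[of i] k_linearD[OF T(1)])
  \<comment> \<open>The coefficient of t_l in the i-th iterate of \<open>y\<close>.\<close>
  define W where "W l i = lookup (?w i) (single (Vt l) 1)" for l i
  have WA: "W l i = (\<Sum>j<m. H i j * A l j)" if "l < n" for l i
    unfolding W_def H[of i] lookup_sum lookup_const_mult using that by (intro sum.cong refl) (simp only: lessThan_iff b lookup_linear_combination)
  have WC: "W l (Suc i) = (\<Sum>j<m. H i j * C l j)" if "l < n" for l i
    unfolding W_def Tw lookup_sum lookup_const_mult using that by (intro sum.cong refl) (simp only: lessThan_iff c lookup_linear_combination)
  define P where "P = monom 1 e - (\<Sum>i<e. monom (to_ac (d i)) i)"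
  have coeffP: "coeff P i = (if i = e then 1 else if i < e then - to_ac (d i) else 0)" for i
  proof -
    have "coeff (\<Sum>j<e. monom (to_ac (d j)) j) i = (\<Sum>j<e. if j = i then to_ac (d j) else 0)"
      unfolding coeff_sum by (intro sum.cong) auto
    also have "\<dots> = (if i < e then to_ac (d i) else 0)" by simp
    finally show ?thesis by (simp add: P_def)
  qed
  have degP: "degree P = e"
  proof (rule antisym)
    show "degree P \<le> e" by (rule degree_le) (simp add: coeffP)
    show "e \<le> degree P" by (rule le_degree) (simp add: coeffP)
  qed
  obtain ev where "poly P ev = 0" using alg_closed_imp_poly_has_root[of P] degP e(1) by auto
  then obtain q where q: "P = [:- ev, 1:] * q" using poly_eq_0_iff_dvd by (metis dvdE)
  have "q \<noteq> 0" using q degP e(1) by auto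
  have "degree P = 1 + degree q" unfolding q using \<open>q \<noteq> 0\<close> by (subst degree_mult_eq) auto
  then have degq: "degree q = e - 1" using degP by simp
  have coeffq: "coeff P i = (if i = 0 then 0 else coeff q (i - 1)) - ev * coeff q i" for i
    unfolding q by (cases i) (simp_all add: coeff_pCons)
  have "coeff q (e - 1) = 1"
    using coeffq[of e] coeffP[of e] degq e(1) by (simp add: coeff_eq_0)
  define \<kappa> where "\<kappa> j = (\<Sum>i<e. coeff q i * to_ac (H i j))" for j
  have zero: "(\<Sum>j<m. \<kappa> j * (to_ac (A l j) * (- ev) + to_ac (C l j))) = 0" if l: "l < n" for l
  proof -
    \<comment> \<open>In coordinates, this is the coefficient of t_l in (T - ev) q(T) y = P(T) y =
      0.\<close>
    have "(\<Sum>j<m. \<kappa> j * (to_ac (A l j) * (- ev) + to_ac (C l j))) =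
      (\<Sum>j<m. \<Sum>i<e. coeff q i * (to_ac (H i j * C l j) - ev * to_ac (H i j * A l j)))"
      unfolding \<kappa>_def sum_distrib_right by (intro sum.cong refl) (simp add: algebra_simps)
    also have "\<dots> = (\<Sum>i<e. coeff q i * (to_ac (W l (Suc i)) - ev * to_ac (W l i)))"
    proof (subst sum.swap, rule sum.cong[OF refl])
      fix i
      show "(\<Sum>j<m. coeff q i * (to_ac (H i j * C l j) - ev * to_ac (H i j * A l j))) =
        coeff q i * (to_ac (W l (Suc i)) - ev * to_ac (W l i))"
        unfolding WC[OF l] WA[OF l, of i]
        by (simp add: to_ac_sum sum_distrib_left sum_subtractf right_diff_distrib)
    qed
    also have "\<dots> = (\<Sum>i<e. coeff q i * to_ac (W l (Suc i))) - (\<Sum>i<e. ev * coeff q i * to_ac (W l i))"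
      by (simp add: sum_subtractf right_diff_distrib mult_ac)
    also have "(\<Sum>i<e. coeff q i * to_ac (W l (Suc i))) = (\<Sum>i<Suc e. (if i = 0 then 0 else coeff q (i - 1)) * to_ac (W l i))"
      by (simp add: sum.lessThan_Suc_shift del: sum.lessThan_Suc)
    also have "(\<Sum>i<e. ev * coeff q i * to_ac (W l i)) = (\<Sum>i<Suc e. ev * coeff q i * to_ac (W l i))"
      using degq e(1) by (simp add: coeff_eq_0)
    also have "(\<Sum>i<Suc e. (if i = 0 then 0 else coeff q (i - 1)) * to_ac (W l i)) - (\<Sum>i<Suc e. ev * coeff q i * to_ac (W l i)) =
      (\<Sum>i<Suc e. coeff P i * to_ac (W l i))"
      unfolding coeffq by (simp only: sum_subtractf[symmetric] left_diff_distrib)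
    also have "\<dots> = to_ac (W l e - (\<Sum>i<e. d i * W l i))"
      by (simp add: coeffP to_ac_sum sum_negf)
    also have "W l e = (\<Sum>i<e. d i * W l i)"
      unfolding W_def[of l e] e(4) lookup_sum lookup_const_mult W_def ..
    finally show ?thesis by simp
  qed
  have "\<exists>j0<m. \<kappa> j0 \<noteq> 0"
  proof (rule ccontr)
    assume "\<not> (\<exists>j0<m. \<kappa> j0 \<noteq> 0)"
    then have \<kappa>0: "\<kappa> j = 0" if "j < m" for j using that by blast
    \<comment> \<open>A linear functional with constants as values, equal to 1 on the last iterate
      before the relation and to 0 on the earlier ones. On the eigenvector it takes the leading
      coefficient of q, which is 1; vanishing of all \<kappa> would make it 0.\<close>
    obtain f where f: "k_linear f" "\<forall>x\<in>?w ` {..<e}. f x = (if x = ?w (e - 1) then 1 else 0)"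
      using mpp.linear_independent_extend[OF e(3), of "\<lambda>x. if x = ?w (e - 1) then 1 else 0"] by blast
    define \<xi> where "\<xi> j = lookup (f (b j)) 0" for j
    have \<xi>: "(\<Sum>j<m. H i j * \<xi> j) = (if i = e - 1 then 1 else 0)" if "i < e" for i
    proof -
      have "f (?w i) = (if i = e - 1 then 1 else 0)"
        using f(2) that e(1) inj_onD[OF e(2), of i "e - 1"] by auto
      moreover have "lookup (f (?w i)) 0 = (\<Sum>j<m. H i j * \<xi> j)"
        unfolding H[of i] k_linearD[OF f(1)] lookup_sum lookup_const_mult \<xi>_def ..
      ultimately show ?thesis by (cases "i = e - 1") (simp_all add: lookup_one)
    qed
    have "0 = (\<Sum>j<m. \<kappa> j * to_ac (\<xi> j))" using \<kappa>0 by simp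
    also have "\<dots> = (\<Sum>i<e. coeff q i * to_ac (\<Sum>j<m. H i j * \<xi> j))"
      unfolding \<kappa>_def sum_distrib_right to_ac_sum sum_distrib_left
      by (subst sum.swap) (simp add: mult.assoc)
    also have "\<dots> = (\<Sum>i<e. if i = e - 1 then coeff q (e - 1) else 0)"
      by (intro sum.cong refl) (simp add: \<xi>)
    also have "\<dots> = 1" using e(1) \<open>coeff q (e - 1) = 1\<close> by simp
    finally show False by simp
  qed
  then show ?thesis using zero by blast
qed

section \<open>Two-rowed matrices\<close>

lemma Collect_pairs_cong:
  assumes "\<And>j k. j < k \<Longrightarrow> k < (m :: nat) \<Longrightarrow> f j k = g j k"
  shows "{f j k | j k. j < k \<and> k < m} = {g j k | j k. j < k \<and> k < m}"
  using assms by (intro Collect_cong ex_cong1) auto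

lemma minors_ideal_2:
  fixes M :: "'k::field mpol mat"
  assumes M: "M \<in> carrier_mat 2 m"
  shows "minors_ideal R 2 M =
    genideal R {M $$ (0, j) * M $$ (1, k) - M $$ (0, k) * M $$ (1, j) | j k. j < k \<and> k < m}"
proof -
  have dims: "dim_row M = 2" "dim_col M = m" using M by auto
  have det: "det (submatrix M {..<2} {j, k}) = M $$ (0, j) * M $$ (1, k) - M $$ (0, k) * M $$ (1, j)"
    if jk: "j < k" "k < m" for j k
  proof -
    let ?S = "submatrix M {..<2} {j, k}"
    have "{i. i < (2::nat) \<and> i \<in> {..<2}} = {..<2}" by auto
    then have cI: "card {i. i < (2::nat) \<and> i \<in> {..<2}} = 2" by simp
    have "{i. i < m \<and> i \<in> {j, k}} = {j, k}" using jk by auto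
    then have cJ: "card {i. i < m \<and> i \<in> {j, k}} = 2" using jk by simp
    have S: "?S \<in> carrier_mat 2 2" by (rule carrier_matI) (unfold dim_submatrix dims, rule cI, rule cJ)
    have pI: "pick {..<2} i = i" if "i < 2" for i :: nat
    proof -
      have "{a \<in> {..<2}. a < i} = {..<i}" using that by auto
      then show ?thesis using pick_card_in_set[of i "{..<2}"] that by simp
    qed
    have below: "{a \<in> {j, k}. a < j} = {}" "{a \<in> {j, k}. a < k} = {j}" using jk by auto
    have pJ0: "pick {j, k} 0 = j" using pick_card_in_set[of j "{j, k}"] unfolding below(1) by simp
    have pJ1: "pick {j, k} 1 = k" using pick_card_in_set[of k "{j, k}"] unfolding below(2) by simp
    have ix: "?S $$ (i, l) = M $$ (i, pick {j, k} l)" if "i < 2" "l < 2" for i l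
    proof -
      have "?S $$ (i, l) = M $$ (pick {..<2} i, pick {j, k} l)"
        by (rule submatrix_index) (unfold dims cI cJ, rule that(1), rule that(2))
      then show ?thesis unfolding pI[OF that(1)] .
    qed
    have "det ?S = ?S $$ (0, 0) * ?S $$ (1, 1) - ?S $$ (0, 1) * ?S $$ (1, 0)"
    proof -
      have "{p. p permutes {0..<2::nat}} = {id, transpose 0 1}"
      proof (intro equalityI subsetI)
        have e: "{0..<2::nat} = {0, 1}" by auto
        show "p \<in> {id, transpose 0 1}" if "p \<in> {p. p permutes {0..<2}}" for p :: "nat \<Rightarrow> nat"
          using that unfolding mem_Collect_eq e permutes_doubleton_iff by blast
        show "p \<in> {p. p permutes {0..<2}}" if "p \<in> {id, transpose 0 1}" for p :: "nat \<Rightarrow> nat"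
          using that unfolding mem_Collect_eq e permutes_doubleton_iff by blast
      qed
      moreover have "(id :: nat \<Rightarrow> nat) \<noteq> transpose 0 1" by (metis id_apply transpose_apply_first zero_neq_one)
      ultimately show ?thesis
        unfolding det_def'[OF S] by (simp add: sign_swap_id numeral_2_eq_2 transpose_def)
    qed
    moreover have "?S $$ (i, 0) = M $$ (i, j)" "?S $$ (i, 1) = M $$ (i, k)" if "i < 2" for i
      using ix[OF that, of 0] ix[OF that, of 1] unfolding pJ0 pJ1 by simp_all
    ultimately show ?thesis by simp
  qed
  have "{det (submatrix M I J) | I J. I \<subseteq> {..<dim_row M} \<and> J \<subseteq> {..<dim_col M} \<and> card I = 2 \<and> card J = 2} =
    {M $$ (0, j) * M $$ (1, k) - M $$ (0, k) * M $$ (1, j) | j k. j < k \<and> k < m}" (is "?A = ?B")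
  proof (intro equalityI subsetI)
    fix p assume "p \<in> ?A"
    then obtain I J where p: "p = det (submatrix M I J)"
      and IJ: "I \<subseteq> {..<2}" "J \<subseteq> {..<m}" "card I = 2" "card J = 2" unfolding dims by blast
    have I: "I = {..<2}" using IJ(1,3) by (intro card_subset_eq) auto
    obtain a b where ab: "J = {a, b}" "a \<noteq> b" using IJ(4) card_2_iff by metis
    define j k where "j = min a b" and "k = max a b"
    have J: "J = {j, k}" "j < k" "k < m" using ab IJ(2) by (auto simp: j_def k_def min_def max_def)
    show "p \<in> ?B" unfolding p I J(1) det[OF J(2,3)] using J(2,3) by blast
  next
    fix p assume "p \<in> ?B"
    then obtain j k where jk: "j < k" "k < m"
      and p: "p = M $$ (0, j) * M $$ (1, k) - M $$ (0, k) * M $$ (1, j)" by blast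
    have "p = det (submatrix M {..<2} {j, k})" unfolding p det[OF jk] ..
    moreover have "{j, k} \<subseteq> {..<m}" "card {j, k} = 2" using jk by auto
    ultimately show "p \<in> ?A" unfolding dims by (intro CollectI exI[of _ "{..<2}"] exI[of _ "{j, k}"]) auto
  qed
  then show ?thesis unfolding minors_ideal_def by (simp only:)
qed

lemma ideal_pol_ring_sum:
  assumes "ideal I (pol_ring V)" "finite A" "\<And>i. i \<in> A \<Longrightarrow> f i \<in> I"
  shows "sum f A \<in> I"
  using assms(2,3) by (induction A rule: finite_induct) (auto intro: ideal_pol_ringD[OF assms(1)])

text \<open>The expression x T(y) - y T(x) is bilinear and alternating. The ideal of minors
  therefore depends only on the span of the top row, and the basis of that span may be
  changed.\<close>

lemma genideal_alternating_span:
  fixes b q :: "nat \<Rightarrow> 'k::field mpol"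
  assumes T: "k_linear T" and b: "\<And>j. j < m \<Longrightarrow> b j \<in> Pol V" "\<And>j. j < m \<Longrightarrow> T (b j) \<in> Pol V"
    and q: "\<And>j. j < m' \<Longrightarrow> q j \<in> mp.span (b ` {..<m})"
  shows "genideal (pol_ring V) {q j * T (q k) - q k * T (q j) | j k. j < k \<and> k < m'} \<subseteq>
    genideal (pol_ring V) {b j * T (b k) - b k * T (b j) | j k. j < k \<and> k < m}" (is "_ \<subseteq> ?K")
proof -
  interpret R: cring "pol_ring V :: 'k mpol ring" by (rule cring_pol_ring)
  let ?G = "{b j * T (b k) - b k * T (b j) | j k. j < k \<and> k < m}"
  have G: "?G \<subseteq> Pol V" using b by (auto intro!: Pol_diff Pol_mult)
  then have K: "ideal ?K (pol_ring V)" by (intro R.genideal_ideal) simp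
  have gen: "b j * T (b k) - b k * T (b j) \<in> ?K" if jk: "j < k" "k < m" for j k
    using R.genideal_self[of ?G] G jk by auto
  have gen': "b j * T (b k) - b k * T (b j) \<in> ?K" if "j < m" "k < m" for j k
  proof (cases j k rule: linorder_cases)
    case less
    then show ?thesis using gen that by blast
  next
    case equal
    then show ?thesis using ideal_pol_ringD(2)[OF K] by simp
  next
    case greater
    have "0 - (b k * T (b j) - b j * T (b k)) \<in> ?K"
      using ideal_pol_ringD(2)[OF K] gen[OF greater that(1)] by (rule ideal_pol_ringD(5)[OF K])
    then show ?thesis by simp
  qed
  have span: "x * T y - y * T x \<in> ?K" if xy: "x \<in> mp.span (b ` {..<m})" "y \<in> mp.span (b ` {..<m})" for x y
  proof -
    obtain h where x: "x = (\<Sum>j<m. const_poly (h j) * b j)" using span_family_coeffs[OF xy(1)] by blast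
    obtain h' where y: "y = (\<Sum>j<m. const_poly (h' j) * b j)" using span_family_coeffs[OF xy(2)] by blast
    have Tx: "T x = (\<Sum>j<m. const_poly (h j) * T (b j))" and Ty: "T y = (\<Sum>j<m. const_poly (h' j) * T (b j))"
      unfolding x y k_linearD[OF T] by (rule refl)+
    have 1: "x * T y = (\<Sum>j<m. \<Sum>k<m. const_poly (h j) * const_poly (h' k) * (b j * T (b k)))"
      unfolding Ty unfolding x sum_product by (simp only: mult_ac)
    have 2: "y * T x = (\<Sum>j<m. \<Sum>k<m. const_poly (h j) * const_poly (h' k) * (b k * T (b j)))"
      unfolding Tx unfolding y sum_product by (subst sum.swap) (simp only: mult_ac)
    have "x * T y - y * T x = (\<Sum>j<m. \<Sum>k<m. const_poly (h j) * const_poly (h' k) * (b j * T (b k) - b k * T (b j)))"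
      unfolding 1 2 sum_subtractf[symmetric] right_diff_distrib ..
    also have "\<dots> \<in> ?K"
      by (intro ideal_pol_ring_sum[OF K] finite_lessThan ideal_pol_ringD(4)[OF K] gen' Pol_mult const_poly_in_Pol) auto
    finally show ?thesis .
  qed
  show ?thesis
  proof (rule R.genideal_minimal[OF K], rule subsetI)
    fix p assume "p \<in> {q j * T (q k) - q k * T (q j) | j k. j < k \<and> k < m'}"
    then obtain j k where jk: "j < k" "k < m'" "p = q j * T (q k) - q k * T (q j)" by blast
    show "p \<in> ?K" unfolding jk(3) by (intro span q) (use jk(1,2) in linarith)+
  qed
qed

lemma length_chain_list: "length (chain_list T cs) = sum_list (map snd cs)"
  by (induction cs) (auto simp: chain_list_def)

lemma sum_list_Suc_snd:
  "sum_list (map snd (map (\<lambda>(w, a). (w, Suc a)) cs)) = sum_list (map snd cs) + length cs"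
  by (induction cs) auto

text \<open>This produces the Hankel shape: when full chains are listed consecutively,
  \<open>scroll_tops\<close> points at the vectors to which T still applies, and their images are
  next in the list.\<close>

lemma nth_chain_list_Suc:
  assumes "j < sum_list (map snd cs)"
  shows "m \<le> scroll_tops m (map snd cs) ! j \<and>
    chain_list T (map (\<lambda>(w, a). (w, Suc a)) cs) ! (scroll_tops m (map snd cs) ! j - m) = chain_list T cs ! j \<and>
    chain_list T (map (\<lambda>(w, a). (w, Suc a)) cs) ! (Suc (scroll_tops m (map snd cs) ! j) - m) = T (chain_list T cs ! j)"
  using assms
proof (induction cs arbitrary: m j)
  case (Cons wa cs)
  obtain w a where wa: "wa = (w, a)" by force
  have ys: "chain_list T (wa # cs) = map (\<lambda>j. (T ^^ j) w) [0..<a] @ chain_list T cs"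
    by (simp add: chain_list_def wa)
  have xs: "chain_list T (map (\<lambda>(w, a). (w, Suc a)) (wa # cs)) =
    map (\<lambda>j. (T ^^ j) w) [0..<Suc a] @ chain_list T (map (\<lambda>(w, a). (w, Suc a)) cs)"
    by (simp add: chain_list_def wa)
  have tops: "scroll_tops m (map snd (wa # cs)) = [m..<m + a] @ scroll_tops (m + a + 1) (map snd cs)"
    by (simp add: wa)
  show ?case
  proof (cases "j < a")
    case True
    then show ?thesis unfolding ys xs tops by (simp add: nth_append del: upt_Suc)
  next
    case False
    define c where "c = scroll_tops (m + a + 1) (map snd cs) ! (j - a)"
    have "j - a < sum_list (map snd cs)" using False Cons.prems by (simp add: wa)
    note IH = Cons.IH[OF this, of "m + a + 1", folded c_def]
    have top: "scroll_tops m (map snd (wa # cs)) ! j = c"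
      unfolding tops c_def using False by (simp add: nth_append)
    have "c - m - Suc a = c - (m + a + 1)" "Suc c - m - Suc a = Suc c - (m + a + 1)"
      "\<not> c - m < Suc a" "\<not> Suc c - m < Suc a" using IH by auto
    then show ?thesis unfolding top ys xs
      using IH False by (simp add: nth_append del: upt_Suc)
  qed
qed simp

lemma family_independentI:
  fixes b :: "nat \<Rightarrow> 'k::field mpol"
  assumes "\<And>\<kappa> j. (\<Sum>j<m. const_poly (\<kappa> j) * b j) = 0 \<Longrightarrow> j < m \<Longrightarrow> \<kappa> j = 0"
  shows "inj_on b {..<m}" "mp.independent (b ` {..<m})"
proof -
  show inj: "inj_on b {..<m}"
  proof (rule inj_onI, rule ccontr)
    fix i j assume ij: "i \<in> {..<m}" "j \<in> {..<m}" "b i = b j" "i \<noteq> j"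
    define \<kappa> where "\<kappa> l = (if l = i then 1 else 0) - (if l = j then 1 else (0 :: 'k))" for l
    have "(\<Sum>l<m. const_poly (\<kappa> l) * b l) = (\<Sum>l<m. (if l = i then b l else 0) - (if l = j then b l else 0))"
      by (intro sum.cong refl) (simp add: \<kappa>_def const_poly.hom_minus const_poly.hom_uminus)
    also have "\<dots> = 0" using ij by (simp add: sum_subtractf)
    finally show False using assms[of \<kappa> i] ij by (simp add: \<kappa>_def)
  qed
  show "mp.independent (b ` {..<m})"
  proof
    assume "mp.dependent (b ` {..<m})"
    then obtain w v where w: "v \<in> b ` {..<m}" "w v \<noteq> 0" "(\<Sum>v\<in>b ` {..<m}. const_poly (w v) * v) = 0"
      unfolding mp.dependent_finite[OF finite_imageI[OF finite_lessThan]] by blast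
    then show False using assms[of "\<lambda>j. w (b j)"] inj by (auto simp: sum.reindex)
  qed
qed

lemma span_card_eq:
  fixes A B :: "'k::field mpol set"
  assumes "mp.independent A" "mp.independent B" "mp.span A = mp.span B"
  shows "card A = card B"
  using mp.dim_eq_card[OF assms(3,1)] mp.dim_eq_card[OF refl assms(2)] by simp

lemma mat_product_entries:
  fixes \<phi> B :: "'k::field mpol mat"
  assumes "\<phi> \<in> carrier_mat n m" "is_matrix_B \<phi> B" "j < m"
  shows "(\<Sum>l<n. var_poly (Vt l) * \<phi> $$ (l, j)) =
    var_poly Vx * B $$ (0, j) + var_poly Vy * B $$ (1, j) + var_poly Vz * B $$ (2, j)"
proof -
  have dims: "dim_row \<phi> = n" "dim_col \<phi> = m" "dim_row B = 3" "dim_col B = m"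
    using assms(1,2) by (auto simp: is_matrix_B_def)
  have "(mat 1 n (\<lambda>(_, j). var_poly (Vt j)) * \<phi>) $$ (0, j) = (mat 1 3 (\<lambda>(_, j). var_poly ([Vx, Vy, Vz] ! j)) * B) $$ (0, j)"
    using assms(2) by (simp add: is_matrix_B_def dims)
  moreover have "(mat 1 n (\<lambda>(_, j). var_poly (Vt j)) * \<phi>) $$ (0, j) = (\<Sum>l<n. var_poly (Vt l) * \<phi> $$ (l, j))"
    using assms(3) by (simp add: dims scalar_prod_def atLeast0LessThan)
  moreover have "(mat 1 3 (\<lambda>(_, j). var_poly ([Vx, Vy, Vz] ! j)) * B) $$ (0, j) =
    var_poly Vx * B $$ (0, j) + var_poly Vy * B $$ (1, j) + var_poly Vz * B $$ (2, j)"
    using assms(3) by (simp add: dims scalar_prod_def atLeast0LessThan numeral_3_eq_3 numeral_2_eq_2)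
  ultimately show ?thesis by simp
qed

text \<open>Setting x = 0 and (y, z) = (1, 0) or (0, 1) in the equation defining B, with all t_l
  fixed, isolates its second or third row.\<close>

lemma matrix_B_entries:
  fixes \<phi> B :: "'k::field mpol mat"
  assumes \<phi>: "\<phi> \<in> carrier_mat n m" and B: "is_matrix_B \<phi> B" and j: "j < m"
    and pencil: "\<And>l. l < n \<Longrightarrow> \<phi> $$ (l, j) = const_poly (A l) * var_poly Vy + const_poly (C l) * var_poly Vz"
  shows "B $$ (1, j) = (\<Sum>l<n. const_poly (A l) * var_poly (Vt l))"
    and "B $$ (2, j) = (\<Sum>l<n. const_poly (C l) * var_poly (Vt l))"
proof -
  define ev :: "'k \<Rightarrow> 'k \<Rightarrow> 'k mpol \<Rightarrow> 'k mpol" where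
    "ev a c = eval_mpoly const_poly (\<lambda>v. case v of Vx \<Rightarrow> 0 | Vy \<Rightarrow> const_poly a | Vz \<Rightarrow> const_poly c | Vt l \<Rightarrow> var_poly (Vt l))" for a c
  have hom: "comm_ring_hom (ev a c)" for a c
    unfolding ev_def by (rule const_poly.comm_ring_hom_eval_mpoly)
  have ev: "ev a c (const_poly d) = const_poly d" "ev a c (var_poly Vx) = 0" "ev a c (var_poly Vy) = const_poly a"
    "ev a c (var_poly Vz) = const_poly c" "ev a c (var_poly (Vt l)) = var_poly (Vt l)" for a c d l
    by (simp_all add: ev_def var_poly_def, simp_all add: const_poly_def[of d])
  have Bid: "ev a c (B $$ (i, j)) = B $$ (i, j)" if "i < 3" for a c i
  proof (rule hom_eq_on_Pol[OF hom, where g = "\<lambda>p. p" and V = "tvars n"])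
    show "B $$ (i, j) \<in> Pol (tvars n)" using B \<phi> j that by (auto simp: is_matrix_B_def linear_form_def)
  qed (unfold_locales, auto simp: ev)
  have main: "(\<Sum>l<n. const_poly (A l * a + C l * c) * var_poly (Vt l)) = const_poly a * B $$ (1, j) + const_poly c * B $$ (2, j)" for a c
  proof -
    interpret e: comm_ring_hom "ev a c" by (rule hom)
    have "ev a c (\<Sum>l<n. var_poly (Vt l) * \<phi> $$ (l, j)) =
      ev a c (var_poly Vx * B $$ (0, j) + var_poly Vy * B $$ (1, j) + var_poly Vz * B $$ (2, j))"
      unfolding mat_product_entries[OF \<phi> B j] ..
    moreover have "ev a c (\<Sum>l<n. var_poly (Vt l) * \<phi> $$ (l, j)) = (\<Sum>l<n. const_poly (A l * a + C l * c) * var_poly (Vt l))"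
      unfolding e.hom_sum
    proof (intro sum.cong refl)
      fix l assume "l \<in> {..<n}"
      then show "ev a c (var_poly (Vt l) * \<phi> $$ (l, j)) = const_poly (A l * a + C l * c) * var_poly (Vt l)"
        by (simp only: lessThan_iff pencil e.hom_add e.hom_mult ev const_poly.hom_add const_poly.hom_mult mult_ac)
    qed
    moreover have "ev a c (var_poly Vx * B $$ (0, j) + var_poly Vy * B $$ (1, j) + var_poly Vz * B $$ (2, j)) =
      const_poly a * B $$ (1, j) + const_poly c * B $$ (2, j)"
      by (simp only: e.hom_add e.hom_mult ev) (simp add: Bid)
    ultimately show ?thesis by simp
  qed
  show "B $$ (1, j) = (\<Sum>l<n. const_poly (A l) * var_poly (Vt l))" using main[of 1 0] by simp
  show "B $$ (2, j) = (\<Sum>l<n. const_poly (C l) * var_poly (Vt l))" using main[of 0 1] by simp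
qed

lemma linear_form_pencil:
  assumes "linear_form {Vy, Vz} p"
  shows "p = const_poly (lookup p (single Vy 1)) * var_poly Vy + const_poly (lookup p (single Vz 1)) * var_poly Vz"
  using linear_form_expand[OF assms] by simp

lemma linear_basis_matrices:
  fixes q :: "nat \<Rightarrow> 'k::field mpol"
  assumes "mp.span (q ` {..<n}) = mp.span ((\<lambda>l. var_poly (Vt l)) ` {..<n})"
  shows "\<exists>g h. (\<forall>c<n. q c = (\<Sum>l<n. const_poly (g c l) * var_poly (Vt l))) \<and>
    (\<forall>c<n. \<forall>c'<n. (\<Sum>l<n. g c l * h l c') = (if c = c' then 1 else 0)) \<and>
    (\<forall>l<n. \<forall>l'<n. (\<Sum>c<n. h l c * g c l') = (if l = l' then 1 else 0))"
proof -
  have "\<exists>g. q c = (\<Sum>l<n. const_poly (g l) * var_poly (Vt l))" if "c < n" for c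
  proof (rule span_family_coeffs)
    show "q c \<in> mp.span ((\<lambda>l. var_poly (Vt l)) ` {..<n})"
      using that by (auto simp: assms[symmetric] intro: mp.span_base)
  qed
  then obtain g where g: "\<And>c. c < n \<Longrightarrow> q c = (\<Sum>l<n. const_poly (g c l) * var_poly (Vt l))" by metis
  have "\<exists>h. var_poly (Vt l) = (\<Sum>c<n. const_poly (h c) * q c)" if "l < n" for l
  proof (rule span_family_coeffs)
    show "var_poly (Vt l) \<in> mp.span (q ` {..<n})"
      using that by (auto simp: assms intro: mp.span_base)
  qed
  then obtain h where h: "\<And>l. l < n \<Longrightarrow> var_poly (Vt l) = (\<Sum>c<n. const_poly (h l c) * q c)" by metis
  have hg: "(\<Sum>c<n. h l c * g c l') = (if l = l' then 1 else 0)" if "l < n" "l' < n" for l l'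
  proof -
    have "lookup (var_poly (Vt l)) (single (Vt l') 1) = (\<Sum>c<n. h l c * g c l')"
      unfolding h[OF that(1)] lookup_sum lookup_const_mult
      by (intro sum.cong refl) (simp only: lessThan_iff g lookup_linear_combination[OF that(2)])
    then show ?thesis by (simp add: var_poly_def lookup_single when_def single_eq_iff)
  qed
  let ?G = "mat n n (\<lambda>(c, l). g c l)" and ?H = "mat n n (\<lambda>(l, c). h l c)"
  have "?H * ?G = 1\<^sub>m n"
    by (rule eq_matI) (simp_all add: scalar_prod_def atLeast0LessThan hg)
  then have GH: "?G * ?H = 1\<^sub>m n" by (intro mat_mult_left_right_inverse[of ?H n ?G]) auto
  have "(\<Sum>l<n. g c l * h l c') = (if c = c' then 1 else 0)" if "c < n" "c' < n" for c c'
  proof -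
    have "(?G * ?H) $$ (c, c') = (if c = c' then 1 else 0)" unfolding GH using that by simp
    then show ?thesis using that by (simp add: scalar_prod_def atLeast0LessThan)
  qed
  then show ?thesis using g hg by blast
qed

section \<open>The scroll of a pencil\<close>

text \<open>The condition \<open>no_zero\<close> enters at two kinds of points: at (1 : 0) it makes
  the \<open>b j\<close> independent, so that T exists, and at (-ev : 1) it excludes eigenvectors
  and with them invariant subspaces.\<close>

lemma scroll_of_pencil:
  fixes b c :: "nat \<Rightarrow> 'k::field mpol"
  assumes m: "0 < m" "m < n"
    and b: "\<forall>j<m. b j = (\<Sum>l<n. const_poly (A l j) * var_poly (Vt l))"
    and c: "\<forall>j<m. c j = (\<Sum>l<n. const_poly (C l j) * var_poly (Vt l))"
    and no_zero: "\<forall>\<eta> \<zeta> \<kappa> j0. (\<eta> \<noteq> 0 \<or> \<zeta> \<noteq> 0) \<longrightarrow> j0 < m \<longrightarrow> \<kappa> j0 \<noteq> 0 \<longrightarrow>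
      (\<exists>l<n. (\<Sum>j<m. \<kappa> j * (to_ac (A l j) * \<eta> + to_ac (C l j) * \<zeta>)) \<noteq> 0)"
  shows "\<exists>as g h. sum_list as = m \<and> sum_list as + length as = n \<and>
    (\<forall>c<n. \<forall>c'<n. (\<Sum>l<n. g c l * h l c') = (if c = c' then 1 else 0)) \<and>
    (\<forall>l<n. \<forall>l'<n. (\<Sum>c<n. h l c * g c l') = (if l = l' then 1 else 0)) \<and>
    genideal (kt n) {b j * c k - b k * c j | j k. j < k \<and> k < m} =
      minors_ideal (kt n) 2 (hankel_blocks (\<lambda>c. \<Sum>l<n. const_poly (g c l) * var_poly (Vt l)) as)"
proof -
  let ?t = "\<lambda>l. var_poly (Vt l) :: 'k mpol"
  note b = b[rule_format] and c = c[rule_format] and no_zero = no_zero[rule_format]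
  define W where "W = mp.span (?t ` {..<n})"
  have bW: "b j \<in> W" if "j < m" for j
    unfolding b[OF that] W_def by (intro mp.span_sum mp.span_scale mp.span_base) auto
  have cW: "c j \<in> W" if "j < m" for j
    unfolding c[OF that] W_def by (intro mp.span_sum mp.span_scale mp.span_base) auto
  have WPol: "W \<subseteq> Pol (tvars n)"
  proof
    fix p assume "p \<in> W"
    then obtain f where "p = (\<Sum>l<n. const_poly (f l) * ?t l)" using span_family_coeffs[of p ?t n] unfolding W_def by blast
    then show "p \<in> Pol (tvars n)"
      by (auto intro!: Pol_sum Pol_mult const_poly_in_Pol var_poly_in_Pol)
  qed
  have "\<kappa> j = 0" if \<kappa>: "(\<Sum>j<m. const_poly (\<kappa> j) * b j) = 0" and j: "j < m" for \<kappa> j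
  proof (rule ccontr)
    assume "\<kappa> j \<noteq> 0"
    then obtain l where l: "l < n" and nz: "(\<Sum>j<m. to_ac (\<kappa> j) * (to_ac (A l j) * 1 + to_ac (C l j) * 0)) \<noteq> 0"
      using no_zero[of 1 0 j "\<lambda>j. to_ac (\<kappa> j)"] j by auto
    have "lookup (\<Sum>j<m. const_poly (\<kappa> j) * b j) (single (Vt l) 1) = (\<Sum>j<m. \<kappa> j * A l j)"
      unfolding lookup_sum lookup_const_mult
      by (intro sum.cong refl) (simp only: lessThan_iff b lookup_linear_combination[OF l])
    then have "(\<Sum>j<m. \<kappa> j * A l j) = 0" unfolding \<kappa> by simp
    then have "to_ac (\<Sum>j<m. \<kappa> j * A l j) = 0" by simp
    then show False using nz by (simp add: to_ac_sum)
  qed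
  note ind0 = this
  have indb: "inj_on b {..<m}" "mp.independent (b ` {..<m})"
    by (rule family_independentI, erule (1) ind0)+
  \<comment> \<open>Outside the span of the \<open>b j\<close> the extension is arbitrary; in the
    chains T is applied only to vectors of this span.\<close>
  obtain T where T: "k_linear T" "\<And>j. j < m \<Longrightarrow> T (b j) = c j"
  proof -
    obtain T where T: "k_linear T" "\<forall>x\<in>b ` {..<m}. T x = c (inv_into {..<m} b x)"
      using mpp.linear_independent_extend[OF indb(2), of "\<lambda>x. c (inv_into {..<m} b x)"] by blast
    have "T (b j) = c j" if "j < m" for j using T(2) indb that by (simp add: inv_into_f_f)
    then show thesis using T(1) by (rule that[rotated])
  qed
  define U where "U = mp.span (b ` {..<m})"
  have UW: "U \<subseteq> W" unfolding U_def W_def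
    by (rule mp.span_minimal) (use bW in \<open>auto simp: W_def intro: mp.subspace_span\<close>)
  have TU: "T ` U \<subseteq> W"
  proof
    fix p assume "p \<in> T ` U"
    then obtain f where p: "p = T (\<Sum>j<m. const_poly (f j) * b j)" unfolding U_def using span_family_coeffs by fast
    show "p \<in> W" unfolding p k_linearD[OF T(1)] W_def
      by (intro mp.span_sum mp.span_scale) (use cW T(2) in \<open>auto simp: W_def\<close>)
  qed
  have noinv: "Y = {0}" if Y: "mp.subspace Y" "Y \<subseteq> U" "T ` Y \<subseteq> Y" for Y
  proof (rule ccontr)
    assume "Y \<noteq> {0}"
    then obtain y where y: "y \<in> Y" "y \<noteq> 0" using mp.subspace_0[OF Y(1)] by blast
    from invariant_subspace_eigenvector[OF b c T Y(2)[unfolded U_def] Y(3) y]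
    obtain ev \<kappa> j0 where "j0 < m" "\<kappa> j0 \<noteq> 0"
      "\<forall>l<n. (\<Sum>j<m. \<kappa> j * (to_ac (A l j) * (- ev) + to_ac (C l j))) = 0" by blast
    then show False using no_zero[of "- ev" 1 j0 \<kappa>] by auto
  qed
  obtain cs where cs: "distinct (chain_list T (map (\<lambda>(w, a). (w, Suc a)) cs))"
    "mp.independent (set (chain_list T (map (\<lambda>(w, a). (w, Suc a)) cs)))"
    "mp.span (set (chain_list T (map (\<lambda>(w, a). (w, Suc a)) cs))) = W"
    "mp.span (set (chain_list T cs)) = U"
    using mp.chain_basis_exists[OF T(1), of "?t ` {..<n}" W U] UW TU noinv
    by (auto simp: W_def U_def)
  define xs where "xs = chain_list T (map (\<lambda>(w, a). (w, Suc a)) cs)"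
  define ys where "ys = chain_list T cs"
  define as where "as = map snd cs"
  note cs = cs[folded xs_def ys_def]
  have ms: "mset xs = mset ys + mset (map (\<lambda>(w, a). (T ^^ a) w) cs)"
    unfolding xs_def ys_def by (rule mset_chain_list_Suc)
  have ys: "distinct ys" "set ys \<subseteq> set xs"
  proof -
    define zs where "zs = map (\<lambda>(w, a). (T ^^ a) w) cs"
    have "mset xs = mset (ys @ zs)" using ms by (simp only: zs_def mset_append)
    then have "distinct (ys @ zs)" "set xs = set (ys @ zs)" using cs(1) by (metis mset_eq_imp_distinct_iff, metis mset_eq_setD)
    then show "distinct ys" "set ys \<subseteq> set xs" by auto
  qed
  \<comment> \<open>Both families are bases of U, so the inner chain vectors are as numerous as the
    columns of the pencil.\<close>
  have "card (set ys) = card (b ` {..<m})"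
    using cs(4) mp.independent_mono[OF cs(2) ys(2)] indb by (intro span_card_eq) (auto simp: U_def)
  then have len_ys: "length ys = m" using indb distinct_card[OF ys(1)] by (simp add: card_image)
  have tm: "?t ` {..<n} = (\<lambda>m. single m 1) ` (\<lambda>l. single (Vt l) 1) ` {..<n}" by (auto simp: var_poly_def image_image)
  have "inj_on ?t {..<n}" by (rule inj_onI) (simp add: var_poly_def single_eq_iff)
  then have "card (?t ` {..<n}) = n" by (simp add: card_image)
  moreover have "card (set xs) = card (?t ` {..<n})"
    using cs(2,3) by (intro span_card_eq) (auto simp: W_def tm independent_monomials)
  ultimately have len_xs: "length xs = n" using distinct_card[OF cs(1)] by simp
  have r: "sum_list as = m" using len_ys unfolding ys_def length_chain_list as_def .
  have s: "sum_list as + length as = n"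
    using len_xs unfolding xs_def length_chain_list sum_list_Suc_snd by (simp add: as_def)
  have "(\<lambda>c. xs ! c) ` {..<n} = set xs" using len_xs by (auto simp: set_conv_nth)
  then have "mp.span ((\<lambda>c. xs ! c) ` {..<n}) = mp.span (?t ` {..<n})" using cs(3) by (simp add: W_def)
  from linear_basis_matrices[OF this] obtain g h where
    g: "\<And>c. c < n \<Longrightarrow> xs ! c = (\<Sum>l<n. const_poly (g c l) * ?t l)"
    and gh: "\<forall>c<n. \<forall>c'<n. (\<Sum>l<n. g c l * h l c') = (if c = c' then 1 else 0)"
    and hg: "\<forall>l<n. \<forall>l'<n. (\<Sum>c<n. h l c * g c l') = (if l = l' then 1 else 0)" by blast
  define x where "x c = (\<Sum>l<n. const_poly (g c l) * ?t l)" for c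
  have x: "x (scroll_tops 0 as ! j) = ys ! j" "x (Suc (scroll_tops 0 as ! j)) = T (ys ! j)" if j: "j < m" for j
  proof -
    have j': "j < sum_list (map snd cs)" using j r by (simp add: as_def)
    have "scroll_tops 0 as ! j \<in> set (scroll_tops 0 as)" using j r by (simp add: length_scroll_tops)
    then have "Suc (scroll_tops 0 as ! j) < n" using scroll_tops_bounds s by fastforce
    then show "x (scroll_tops 0 as ! j) = ys ! j" "x (Suc (scroll_tops 0 as ! j)) = T (ys ! j)"
      using nth_chain_list_Suc[OF j', of 0 T, folded as_def xs_def ys_def] g by (simp_all add: x_def)
  qed
  have hb: "hankel_blocks x as \<in> carrier_mat 2 m" by (simp add: hankel_blocks_def r)
  have hank: "hankel_blocks x as $$ (0, j) = ys ! j" "hankel_blocks x as $$ (1, j) = T (ys ! j)" if "j < m" for j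
    using that x by (simp_all add: hankel_blocks_def r)
  have "{hankel_blocks x as $$ (0, j) * hankel_blocks x as $$ (1, k) -
      hankel_blocks x as $$ (0, k) * hankel_blocks x as $$ (1, j) | j k. j < k \<and> k < m} =
    {ys ! j * T (ys ! k) - ys ! k * T (ys ! j) | j k. j < k \<and> k < m}"
    by (rule Collect_pairs_cong) (simp add: hank[unfolded One_nat_def])
  then have minors: "minors_ideal (kt n) 2 (hankel_blocks x as) =
    genideal (kt n) {ys ! j * T (ys ! k) - ys ! k * T (ys ! j) | j k. j < k \<and> k < m}"
    unfolding minors_ideal_2[OF hb] by (simp only:)
  have "{b j * c k - b k * c j | j k. j < k \<and> k < m} = {b j * T (b k) - b k * T (b j) | j k. j < k \<and> k < m}"
    by (rule Collect_pairs_cong) (simp add: T(2))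
  moreover have "genideal (kt n) {b j * T (b k) - b k * T (b j) | j k. j < k \<and> k < m} =
    genideal (kt n) {ys ! j * T (ys ! k) - ys ! k * T (ys ! j) | j k. j < k \<and> k < m}"
  proof (intro equalityI genideal_alternating_span T(1))
    have sys: "set ys = (!) ys ` {..<m}" using len_ys by (auto simp: set_conv_nth)
    show "b j \<in> mp.span ((!) ys ` {..<m})" if "j < m" for j
      using that cs(4) by (auto simp: sys[symmetric] U_def intro: mp.span_base)
    show ysU: "ys ! j \<in> mp.span (b ` {..<m})" if "j < m" for j
      using that cs(4) len_ys mp.span_base[of "ys ! j" "set ys"] by (simp add: U_def)
    show "b j \<in> Pol (tvars n)" "T (b j) \<in> Pol (tvars n)" if "j < m" for j
      using that bW cW T(2) WPol by auto
    show "ys ! j \<in> Pol (tvars n)" "T (ys ! j) \<in> Pol (tvars n)" if "j < m" for j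
      using ysU[OF that] UW TU WPol by (auto simp: U_def[symmetric])
  qed
  ultimately have "genideal (kt n) {b j * c k - b k * c j | j k. j < k \<and> k < m} =
    minors_ideal (kt n) 2 (hankel_blocks x as)" unfolding minors by (simp only:)
  then show ?thesis using r s gh hg unfolding x_def by blast
qed

section \<open>From the matrix to its scroll\<close>

lemma nth_scroll_tops_bound:
  "j < sum_list as \<Longrightarrow> Suc (scroll_tops 0 as ! j) < sum_list as + length as"
  using scroll_tops_bounds[of "scroll_tops 0 as ! j" 0 as] by (simp add: length_scroll_tops)

lemma hankel_blocks_cong:
  assumes "\<And>c. c < sum_list as + length as \<Longrightarrow> x c = y c"
  shows "hankel_blocks x as = hankel_blocks y as"
proof (rule eq_matI)
  fix i j assume "i < dim_row (hankel_blocks y as)" "j < dim_col (hankel_blocks y as)"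
  then have ij: "i < 2" "j < sum_list as" by (simp_all add: hankel_blocks_def)
  then have "scroll_tops 0 as ! j + i < sum_list as + length as"
    using nth_scroll_tops_bound[OF ij(2)] by linarith
  then show "hankel_blocks x as $$ (i, j) = hankel_blocks y as $$ (i, j)"
    using ij by (simp add: hankel_blocks_def assms)
qed (simp_all add: hankel_blocks_def)

lemma scroll_ring_hankel_blocks:
  fixes g h :: "nat \<Rightarrow> nat \<Rightarrow> 'k::field"
  assumes "0 < sum_list as" and n: "sum_list as + length as = n"
    and "\<forall>c<n. \<forall>c'<n. (\<Sum>l<n. g c l * h l c') = (if c = c' then 1 else 0)"
    and "\<forall>l<n. \<forall>l'<n. (\<Sum>c<n. h l c * g c l') = (if l = l' then 1 else 0)"
  shows "scroll_ring as n g h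
    (minors_ideal (kt n) 2 (hankel_blocks (\<lambda>c. \<Sum>l<n. const_poly (g c l) * var_poly (Vt l)) as))"
proof -
  have hb: "hankel_blocks (\<lambda>c. \<Sum>l<n. const_poly (g c l) * var_poly (Vt l)) as \<in> carrier_mat 2 (sum_list as)"
    by (simp add: hankel_blocks_def)
  have bounds: "Suc (scroll_tops 0 as ! j) < n" "scroll_tops 0 as ! j < n" if "j < sum_list as" for j
    using nth_scroll_tops_bound[OF that] n by simp_all
  show ?thesis
    unfolding scroll_ring_def minors_ideal_2[OF hb]
    by (intro conjI arg_cong[where f = "genideal (kt n)"] Collect_pairs_cong)
      (use assms in \<open>auto simp: hankel_blocks_def bounds mult.commute\<close>)
qed

theorem theorem3p2:
  fixes \<phi> B :: "'k::field mpol mat" and n u :: nat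
  assumes "\<phi> \<in> carrier_mat n (n - 1)"
    and "\<forall>i < n. \<forall>j < n - 1. linear_form {Vx, Vy, Vz} (\<phi> $$ (i, j))"
    and "height kxyz (minors_ideal kxyz 1 \<phi>) = 3"
    and "height kxyz (minors_ideal kxyz (n - 1) \<phi>) = 2"
    and "chaos_invariant \<phi> u"
    and "\<forall>i < u. \<exists>a. linear_form {Vy, Vz} a \<and> \<phi> $$ (i, i) = var_poly Vx + a"
    and "\<forall>i < n. \<forall>j < n - 1. \<not> (i = j \<and> i < u) \<longrightarrow> linear_form {Vy, Vz} (\<phi> $$ (i, j))"
    and "is_matrix_B \<phi> B"
  shows "(\<exists>J. rational_normal_scroll_ideal n (u + 1) J \<and>
            graded_algebra_iso n (minors_ideal (kt n) 2 (matrix_B' u B)) J) \<and>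
         cohen_macaulay (kt n Quot minors_ideal (kt n) 2 (matrix_B' u B)) \<and>
         normal_domain (kt n Quot minors_ideal (kt n) 2 (matrix_B' u B))"
proof -
  have u: "u + 2 \<le> n" using assms(1,5) by (simp add: chaos_invariant_def)
  define m where "m = n - 1 - u"
  have m: "0 < m" "m < n" using u by (auto simp: m_def)
  \<comment> \<open>The first \<open>u\<close> columns, in which x occurs, are dropped; the
    remaining ones are numbered from 0 and are forms in y and z.\<close>
  define A C where "A l j = lookup (\<phi> $$ (l, j + u)) (single Vy 1)"
    and "C l j = lookup (\<phi> $$ (l, j + u)) (single Vz 1)" for l j
  define b c where "b j = B $$ (1, j + u)" and "c j = B $$ (2, j + u)" for j
  have pencil: "\<phi> $$ (l, j + u) = const_poly (A l j) * var_poly Vy + const_poly (C l j) * var_poly Vz"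
    if "l < n" "j < m" for l j
    unfolding A_def C_def by (rule linear_form_pencil) (use assms(7) that m_def in auto)
  have b: "b j = (\<Sum>l<n. const_poly (A l j) * var_poly (Vt l))"
    and c: "c j = (\<Sum>l<n. const_poly (C l j) * var_poly (Vt l))" if "j < m" for j
    unfolding b_def c_def using matrix_B_entries[OF assms(1,8), of "j + u" "\<lambda>l. A l j" "\<lambda>l. C l j"] pencil that
    by (auto simp: m_def)
  have no_zero: "\<forall>\<eta> \<zeta> \<kappa> j0. (\<eta> \<noteq> 0 \<or> \<zeta> \<noteq> 0) \<longrightarrow> j0 < m \<longrightarrow> \<kappa> j0 \<noteq> 0 \<longrightarrow>
    (\<exists>l<n. (\<Sum>j<m. \<kappa> j * (to_ac (A l j) * \<eta> + to_ac (C l j) * \<zeta>)) \<noteq> 0)"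
  \<comment> \<open>A dependency of these columns at a point of the projective line is excluded by
    the height of the ideal of maximal minors; in that argument the columns keep their numbers in
    \<phi>, hence the shifts by \<open>u\<close>.\<close>
  proof (intro allI impI, rule ccontr)
    fix \<eta> \<zeta> :: "'k alg_closure" and \<kappa> j0
    assume pt: "\<eta> \<noteq> 0 \<or> \<zeta> \<noteq> 0" and j0: "j0 < m" "\<kappa> j0 \<noteq> 0"
      and no: "\<not> (\<exists>l<n. (\<Sum>j<m. \<kappa> j * (to_ac (A l j) * \<eta> + to_ac (C l j) * \<zeta>)) \<noteq> 0)"
    have shift: "(\<Sum>j\<in>{u..<n - 1}. f (j - u)) = (\<Sum>j<m. f j)" for f :: "nat \<Rightarrow> 'k alg_closure"
      by (rule sum.reindex_bij_witness[of _ "\<lambda>j. j + u" "\<lambda>j. j - u"]) (auto simp: m_def)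
    show False
    proof (rule no_common_zero[where \<phi> = \<phi> and n = n and u = u and A = "\<lambda>l j. A l (j - u)" and C = "\<lambda>l j. C l (j - u)"
          and \<kappa> = "\<lambda>j. \<kappa> (j - u)" and ?j0.0 = "j0 + u", OF assms(1) _ _ _ assms(4) pt])
      show "u < n" using u by simp
      show "\<phi> $$ (i, j) \<in> Pol {Vx, Vy, Vz}" if "i < n" "j < n - 1" for i j
        using assms(2) that by (auto simp: linear_form_def)
      show "\<phi> $$ (i, j) = const_poly (A i (j - u)) * var_poly Vy + const_poly (C i (j - u)) * var_poly Vz"
        if "i < n" "u \<le> j" "j < n - 1" for i j
        using pencil[of i "j - u"] that by (simp add: m_def)
      show "(\<Sum>j\<in>{u..<n - 1}. \<kappa> (j - u) * (to_ac (A i (j - u)) * \<eta> + to_ac (C i (j - u)) * \<zeta>)) = 0" if "i < n" for i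
        using no that unfolding shift[of "\<lambda>j. \<kappa> j * (to_ac (A i j) * \<eta> + to_ac (C i j) * \<zeta>)"] by blast
      show "j0 + u \<in> {u..<n - 1}" "\<kappa> (j0 + u - u) \<noteq> 0" using j0 by (auto simp: m_def)
    qed
  qed
  have b': "\<forall>j<m. b j = (\<Sum>l<n. const_poly (A l j) * var_poly (Vt l))"
    and c': "\<forall>j<m. c j = (\<Sum>l<n. const_poly (C l j) * var_poly (Vt l))" using b c by blast+
  obtain as g h where r: "sum_list as = m" and s: "sum_list as + length as = n"
    and gh: "\<forall>c<n. \<forall>c'<n. (\<Sum>l<n. g c l * h l c') = (if c = c' then 1 else (0 :: 'k))"
    and hg: "\<forall>l<n. \<forall>l'<n. (\<Sum>c<n. h l c * g c l') = (if l = l' then 1 else 0)"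
    and J: "genideal (kt n) {b j * c k - b k * c j | j k. j < k \<and> k < m} =
      minors_ideal (kt n) 2 (hankel_blocks (\<lambda>c. \<Sum>l<n. const_poly (g c l) * var_poly (Vt l)) as)"
    using scroll_of_pencil[OF m b' c' no_zero] by blast
  define K where "K = minors_ideal (kt n) 2 (matrix_B' u B)"
  have dimB: "dim_col B = n - 1" using assms(1,8) by (auto simp: is_matrix_B_def)
  have B': "matrix_B' u B \<in> carrier_mat 2 m" by (simp add: matrix_B'_def dimB m_def)
  have "matrix_B' u B $$ (0, j) = b j" "matrix_B' u B $$ (1, j) = c j" if "j < m" for j
    using that by (simp_all add: matrix_B'_def dimB m_def b_def c_def numeral_2_eq_2)
  then have "{matrix_B' u B $$ (0, j) * matrix_B' u B $$ (1, k) - matrix_B' u B $$ (0, k) * matrix_B' u B $$ (1, j) |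
      j k. j < k \<and> k < m} = {b j * c k - b k * c j | j k. j < k \<and> k < m}"
    by (intro Collect_pairs_cong) simp
  then have K: "K = minors_ideal (kt n) 2 (hankel_blocks (\<lambda>c. \<Sum>l<n. const_poly (g c l) * var_poly (Vt l)) as)"
    unfolding K_def minors_ideal_2[OF B'] J[symmetric] by (simp only:)
  define G where "G = mat n n (\<lambda>(c, l). g c l)"
  define H where "H = mat n n (\<lambda>(l, c). h l c)"
  have "G * H = 1\<^sub>m n" "H * G = 1\<^sub>m n"
    unfolding G_def H_def by (rule eq_matI; simp add: scalar_prod_def atLeast0LessThan gh hg)+
  then have "invertible_mat G"
    unfolding invertible_mat_def inverts_mat_def by (auto simp: G_def H_def intro!: exI[of _ H])
  moreover have "hankel_blocks (\<lambda>c. \<Sum>l<n. const_poly (G $$ (c, l)) * var_poly (Vt l)) as =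
    hankel_blocks (\<lambda>c. \<Sum>l<n. const_poly (g c l) * var_poly (Vt l)) as"
    by (rule hankel_blocks_cong) (simp add: G_def s)
  \<comment> \<open>The \<open>n\<close> coordinates exceed the \<open>n - 1 - u\<close> columns by
    one for each block, empty blocks included.\<close>
  moreover have "length as = u + 1" using r s u by (simp add: m_def)
  ultimately have "rational_normal_scroll_ideal n (u + 1) K"
    unfolding rational_normal_scroll_ideal_def K
    using r s m by (intro exI[of _ as] exI[of _ G]) (simp add: G_def)
  \<comment> \<open>The ideal of minors is itself a scroll ideal, so the identity is the required
    isomorphism.\<close>
  moreover have "graded_algebra_iso n K K"
    unfolding graded_algebra_iso_def by (rule bexI[OF _ ring_iso_set_refl]) auto
  moreover have "scroll_ring as n g h K"
    unfolding K using r s m gh hg by (intro scroll_ring_hankel_blocks) auto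
  ultimately show ?thesis
    unfolding K_def[symmetric]
    using scroll_ring.normal_domain_quotient scroll_ring.cohen_macaulay_quotient by blast
qed

end
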